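(* Let $\mathbb M^2\subset\mathbb C^{1+8}$ be the rigid real analytic CR-generic submanifold given in coordinates $(z,w^1,\dots,w^8)$ by $$w^1-\overline w^1=2i\,z\overline z,\quad w^2-\overline w^2=2i(z^2\overline z+z\overline z^2),\quad w^3-\overline w^3=2(z^2\overline z-z\overline z^2),\quad w^4-\overline w^4=2i(z^3\overline z+z\overline z^3),$$ $$w^5-\overline w^5=2(z^3\overline z-z\overline z^3),\quad w^6-\overline w^6=2i\,z^2\overline z^2,\quad w^7-\overline w^7=2i(z^3\overline z^2+z^2\overline z^3),\quad w^8-\overline w^8=2(z^3\overline z^2-z^2\overline z^3).$$ The Lie algebra of infinitesimal CR-automorphisms $\mathfrak{aut}_{CR}(\mathbb M^2)$ is $12$-dimensional: its elements $Z\,\partial_z+\sum_{l=1}^8W^l\,\partial_{w^l}$ are those with holomorphic coefficients $$\begin{aligned} Z&=(\mathsf c+i\mathsf d)+(\mathsf a+i\mathsf b)z,\\ W^1&=\mathsf c_1+2\mathsf a w^1+2(\mathsf d+i\mathsf c)z,\\ W^2&=\mathsf c_2+4\mathsf c w^1+3\mathsf a w^2-\mathsf b w^3+2(\mathsf d+i\mathsf c)z^2,\\ W^3&=\mathsf c_3+4\mathsf d w^1+\mathsf b w^2+3\mathsf a w^3+2(\mathsf c-i\mathsf d)z^2,\\ W^4&=\mathsf c_4+3\mathsf c w^2-3\mathsf d w^3+4\mathsf a w^4-2\mathsf b w^5+2(\mathsf d+i\mathsf c)z^3,\\ W^5&=\mathsf c_5+3\mathsf d w^2+3\mathsf c w^3+2\mathsf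 b w^4+4\mathsf a w^5+2(\mathsf c-i\mathsf d)z^3,\\ W^6&=\mathsf c_6+2\mathsf c w^2+2\mathsf d w^3+4\mathsf a w^6,\\ W^7&=\mathsf c_7+2\mathsf c w^4+2\mathsf d w^5+6\mathsf c w^6+5\mathsf a w^7-\mathsf b w^8,\\ W^8&=\mathsf c_8-2\mathsf d w^4+2\mathsf c w^5+6\mathsf d w^6+\mathsf b w^7+5\mathsf a w^8, \end{aligned}$$ with real parameters $\mathsf c_1,\dots,\mathsf c_8,\mathsf a,\mathsf b,\mathsf c,\mathsf d\in\mathbb R$; and it is generated by the twelve $\mathbb R$-linearly independent holomorphic vector fields $\mathsf X_i=\partial_{w^i}$, $i=1,\dots,8$, and $$\mathsf X_9=z\partial_z+2w^1\partial_{w^1}+3w^2\partial_{w^2}+3w^3\partial_{w^3}+4w^4\partial_{w^4}+4w^5\partial_{w^5}+4w^6\partial_{w^6}+5w^7\partial_{w^7}+5w^8\partial_{w^8},$$ $$\mathsf X_{10}=iz\partial_z-w^3\partial_{w^2}+w^2\partial_{w^3}-2w^5\partial_{w^4}+2w^4\partial_{w^5}-w^8\partial_{w^7}+w^7\partial_{w^8},$$ $$\mathsf X_{11}=\partial_z+2iz\partial_{w^1}+(4w^1+2iz^2)\partial_{w^2}+2z^2\partial_{w^3}+(3w^2+2iz^3)\partial_{w^4}+(3w^3+2z^3)\partial_{w^5}+2w^2\partial_{w^6}+(2w^4+6w^6)\partial_{w^7}+2w^5\partial_{w^8},$$ $$\mathsf X_{12}=i\partial_z+2z\partial_{w^1}+2z^2\partial_{w^2}+(4w^1-2iz^2)\partial_{w^3}+(-3w^3+2z^3)\partial_{w^4}+(3w^2-2iz^3)\partial_{w^5}+2w^3\partial_{w^6}+2w^5\partial_{w^7}+(-2w^4+6w^6)\partial_{w^8}.$$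 Furthermore, it is graded of the form $\mathfrak{aut}_{CR}(\mathbb M^2)=\mathfrak g_{-5}\oplus\mathfrak g_{-4}\oplus\mathfrak g_{-3}\oplus\mathfrak g_{-2}\oplus\mathfrak g_{-1}\oplus\mathfrak g_0$ with $\mathfrak g_{-5}=\langle\mathsf X_7,\mathsf X_8\rangle$, $\mathfrak g_{-4}=\langle\mathsf X_4,\mathsf X_5,\mathsf X_6\rangle$, $\mathfrak g_{-3}=\langle\mathsf X_2,\mathsf X_3\rangle$, $\mathfrak g_{-2}=\langle\mathsf X_1\rangle$, $\mathfrak g_{-1}=\langle\mathsf X_{11},\mathsf X_{12}\rangle$, $\mathfrak g_0=\langle\mathsf X_9,\mathsf X_{10}\rangle$, and with the following commutators: $[\mathsf X_i,\mathsf X_j]=0$ for $1\le i,j\le8$; $[\mathsf X_1,\mathsf X_9]=2\mathsf X_1$, $[\mathsf X_1,\mathsf X_{10}]=0$, $[\mathsf X_1,\mathsf X_{11}]=4\mathsf X_2$, $[\mathsf X_1,\mathsf X_{12}]=4\mathsf X_3$; $[\mathsf X_2,\mathsf X_9]=3\mathsf X_2$, $[\mathsf X_2,\mathsf X_{10}]=\mathsf X_3$, $[\mathsf X_2,\mathsf X_{11}]=3\mathsf X_4+2\mathsf X_6$, $[\mathsf X_2,\mathsf X_{12}]=3\mathsf X_5$; $[\mathsf X_3,\mathsf X_9]=3\mathsf X_3$, $[\mathsf X_3,\mathsf X_{10}]=-\mathsf X_2$, $[\mathsf X_3,\mathsf X_{11}]=3\mathsf X_5$, $[\mathsf X_3,\mathsf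 X_{12}]=-3\mathsf X_4+2\mathsf X_6$; $[\mathsf X_4,\mathsf X_9]=4\mathsf X_4$, $[\mathsf X_4,\mathsf X_{10}]=2\mathsf X_5$, $[\mathsf X_4,\mathsf X_{11}]=2\mathsf X_7$, $[\mathsf X_4,\mathsf X_{12}]=-2\mathsf X_8$; $[\mathsf X_5,\mathsf X_9]=4\mathsf X_5$, $[\mathsf X_5,\mathsf X_{10}]=-2\mathsf X_4$, $[\mathsf X_5,\mathsf X_{11}]=2\mathsf X_8$, $[\mathsf X_5,\mathsf X_{12}]=2\mathsf X_7$; $[\mathsf X_6,\mathsf X_9]=4\mathsf X_6$, $[\mathsf X_6,\mathsf X_{10}]=0$, $[\mathsf X_6,\mathsf X_{11}]=6\mathsf X_7$, $[\mathsf X_6,\mathsf X_{12}]=6\mathsf X_8$; $[\mathsf X_7,\mathsf X_9]=5\mathsf X_7$, $[\mathsf X_7,\mathsf X_{10}]=\mathsf X_8$, $[\mathsf X_7,\mathsf X_{11}]=[\mathsf X_7,\mathsf X_{12}]=0$; $[\mathsf X_8,\mathsf X_9]=5\mathsf X_8$, $[\mathsf X_8,\mathsf X_{10}]=-\mathsf X_7$, $[\mathsf X_8,\mathsf X_{11}]=[\mathsf X_8,\mathsf X_{12}]=0$; $[\mathsf X_9,\mathsf X_{10}]=0$, $[\mathsf X_9,\mathsf X_{11}]=-\mathsf X_{11}$, $[\mathsf X_9,\mathsf X_{12}]=-\mathsf X_{12}$, $[\mathsf X_{10},\mathsf X_{11}]=-\mathsf X_{12}$, $[\mathsf X_{10},\mathsf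 X_{12}]=\mathsf X_{11}$, $[\mathsf X_{11},\mathsf X_{12}]=4\mathsf X_1$.
   Context: For a real analytic CR-generic submanifold $M\subset\mathbb C^{1+8}$ through the origin, an infinitesimal CR-automorphism of $M$ is a $(1,0)$ vector field $\mathsf X=Z(z,w)\,\partial_z+\sum_{l=1}^8W^l(z,w)\,\partial_{w^l}$ with coefficients holomorphic near the origin such that $\mathsf X+\overline{\mathsf X}$ is tangent to $M$. These form the real Lie algebra $\mathfrak{aut}_{CR}(M)$. "Rigid" means that the right-hand sides of the defining equations do not depend on $w$. Superscripts on $w$ are indices. $\langle\cdot\rangle$ denotes the real span. A Lie algebra $\mathfrak g$ is graded (in the sense of Tanaka) if $\mathfrak g=\mathfrak g_{-k}\oplus\cdots\oplus\mathfrak g_{k'}$ with $[\mathfrak g_i,\mathfrak g_j]\subset\mathfrak g_{i+j}$. *)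

theory Defs
  imports "HOL-Analysis.Analysis"
begin

text \<open>Points (z, w) of C^{1+8}. The index type 8 is arithmetic modulo 8, so that the literals
  1, ..., 8 are its eight distinct elements (with 8 = 0), and \<open>vector [x1, ..., x8]\<close> has
  \<open>$ l\<close>-component xl.\<close>

type_synonym pt = "complex \<times> (complex ^ 8)"

definition cscale :: "complex \<Rightarrow> pt \<Rightarrow> pt" where
  "cscale c p = (c * fst p, c *s snd p)"

definition complex_differentiable_at :: "(pt \<Rightarrow> complex) \<Rightarrow> pt \<Rightarrow> bool" where
  "complex_differentiable_at f p \<longleftrightarrow>
     (\<exists>L. (f has_derivative L) (at p) \<and> (\<forall>c v. L (cscale c v) = c * L v))"

text \<open>A (1,0) vector field \<open>Z \<partial>\<^sub>z + \<Sum>\<^sub>l W\<^sup>l \<partial>\<^sub>w\<^sub>l\<close> is represented by its coefficient map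
  p \<mapsto> (Z p, W p).\<close>

definition holomorphic_field_on :: "pt set \<Rightarrow> (pt \<Rightarrow> pt) \<Rightarrow> bool" where
  "holomorphic_field_on U V \<longleftrightarrow>
     (\<forall>p\<in>U. complex_differentiable_at (\<lambda>q. fst (V q)) p \<and>
            (\<forall>l. complex_differentiable_at (\<lambda>q. snd (V q) $ l) p))"

text \<open>For a submanifold, the tangent space at p is the set of velocities at p of the curves
  lying in it.\<close>

definition tangent_space :: "pt set \<Rightarrow> pt \<Rightarrow> pt set" where
  "tangent_space M p =
     {v. \<exists>\<gamma> :: real \<Rightarrow> pt. \<gamma> 0 = p \<and> eventually (\<lambda>t. \<gamma> t \<in> M) (nhds 0) \<and>
           (\<gamma> has_vector_derivative v) (at 0)}"

text \<open>If the (1,0) field X has coefficient map V, then the real vector field X + cnj X acts on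
  functions at p as the real directional derivative along V p. Hence its value at p, as a real
  tangent vector of C^9 = R^18, is V p, without a factor 2.\<close>

definition inf_CR_automorphism :: "pt set \<Rightarrow> (pt \<Rightarrow> pt) \<Rightarrow> bool" where
  "inf_CR_automorphism M V \<longleftrightarrow>
     (\<exists>U. open U \<and> 0 \<in> U \<and> holomorphic_field_on U V \<and>
          (\<forall>p\<in>M \<inter> U. V p \<in> tangent_space M p))"

text \<open>As the coefficients are only required to exist near the origin, the elements of the Lie
  algebra are germs at 0. The type below contains germs of arbitrary maps; holomorphy is imposed
  in the definition of \<open>aut_CR\<close>.\<close>

quotient_type vf_germ = "pt \<Rightarrow> pt" /
  "\<lambda>V W. eventually (\<lambda>p. V p = W p) (nhds (0 :: pt))"
  morphisms rep_germ germ
proof (rule equivpI)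
  show "reflp (\<lambda>V W. eventually (\<lambda>p. V p = W p) (nhds (0 :: pt)))"
    by (simp add: reflp_def)
  show "symp (\<lambda>V W. eventually (\<lambda>p. V p = W p) (nhds (0 :: pt)))"
    by (simp add: symp_def eq_commute)
  show "transp (\<lambda>V W. eventually (\<lambda>p. V p = W p) (nhds (0 :: pt)))"
    unfolding transp_def by (auto elim: eventually_elim2)
qed

instantiation vf_germ :: real_vector
begin

lift_definition zero_vf_germ :: vf_germ is "\<lambda>_. 0" .

lift_definition plus_vf_germ :: "vf_germ \<Rightarrow> vf_germ \<Rightarrow> vf_germ" is "\<lambda>V W p. V p + W p"
  by (auto elim: eventually_elim2)

lift_definition minus_vf_germ :: "vf_germ \<Rightarrow> vf_germ \<Rightarrow> vf_germ" is "\<lambda>V W p. V p - W p"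
  by (auto elim: eventually_elim2)

lift_definition uminus_vf_germ :: "vf_germ \<Rightarrow> vf_germ" is "\<lambda>V p. - V p"
  by (auto elim: eventually_mono)

lift_definition scaleR_vf_germ :: "real \<Rightarrow> vf_germ \<Rightarrow> vf_germ" is "\<lambda>r V p. r *\<^sub>R V p"
  by (auto elim: eventually_mono)

instance
  by standard (transfer; simp add: algebra_simps)+

end

lemma frechet_derivative_cong_germ:
  assumes "eventually (\<lambda>q. f q = g q) (nhds p)"
  shows "frechet_derivative f (at p) = frechet_derivative g (at p)"
proof -
  have "(f has_derivative L) (at p) \<longleftrightarrow> (g has_derivative L) (at p)" for L
  proof -
    have ev: "eventually (\<lambda>q. f q = g q) (at p)" and eq: "f p = g p"
      using assms eventually_nhds_x_imp_x[OF assms] by (auto simp: eventually_at_filter elim: eventually_mono)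
    then show ?thesis
      using has_derivative_transform_eventually[of f L p UNIV g]
            has_derivative_transform_eventually[of g L p UNIV f]
      by (auto simp: eq_commute)
  qed
  then show ?thesis
    by (simp add: frechet_derivative_def)
qed

text \<open>The commutator [X, Y] has coefficients \<open>X(Y\<^sup>k) - Y(X\<^sup>k)\<close>; for holomorphic coefficients
  \<open>X(f)\<close> is the derivative of f in the direction of the coefficient vector of X.\<close>

lift_definition bracket :: "vf_germ \<Rightarrow> vf_germ \<Rightarrow> vf_germ" is
  "\<lambda>V W p. frechet_derivative W (at p) (V p) - frechet_derivative V (at p) (W p)"
proof -
  fix V V' W W' :: "pt \<Rightarrow> pt"
  assume V: "eventually (\<lambda>p. V p = V' p) (nhds 0)" and W: "eventually (\<lambda>p. W p = W' p) (nhds 0)"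
  from V have V2: "eventually (\<lambda>p. eventually (\<lambda>q. V q = V' q) (nhds p)) (nhds 0)"
    by (simp add: eventually_eventually)
  from W have W2: "eventually (\<lambda>p. eventually (\<lambda>q. W q = W' q) (nhds p)) (nhds 0)"
    by (simp add: eventually_eventually)
  from V W V2 W2 show "eventually (\<lambda>p. frechet_derivative W (at p) (V p) - frechet_derivative V (at p) (W p) =
      frechet_derivative W' (at p) (V' p) - frechet_derivative V' (at p) (W' p)) (nhds 0)"
    by eventually_elim (simp add: frechet_derivative_cong_germ)
qed

definition aut_CR :: "pt set \<Rightarrow> vf_germ set" where
  "aut_CR M = germ ` {V. inf_CR_automorphism M V}"

definition lie_subalgebra :: "vf_germ set \<Rightarrow> bool" where
  "lie_subalgebra \<gg> \<longleftrightarrow> subspace \<gg> \<and> (\<forall>x\<in>\<gg>. \<forall>y\<in>\<gg>. bracket x y \<in> \<gg>)"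

definition is_direct_sum :: "vf_germ set \<Rightarrow> int set \<Rightarrow> (int \<Rightarrow> vf_germ set) \<Rightarrow> bool" where
  "is_direct_sum \<gg> I G \<longleftrightarrow>
     (\<forall>i\<in>I. subspace (G i)) \<and>
     \<gg> = {(\<Sum>i\<in>I. x i) | x. \<forall>i\<in>I. x i \<in> G i} \<and>
     (\<forall>x. (\<forall>i\<in>I. x i \<in> G i) \<and> (\<Sum>i\<in>I. x i) = 0 \<longrightarrow> (\<forall>i\<in>I. x i = 0))"

definition graded_lie_algebra ::
    "vf_germ set \<Rightarrow> nat \<Rightarrow> nat \<Rightarrow> (int \<Rightarrow> vf_germ set) \<Rightarrow> bool" where
  "graded_lie_algebra \<gg> k k' G \<longleftrightarrow>
     lie_subalgebra \<gg> \<and>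
     is_direct_sum \<gg> {- int k .. int k'} G \<and>
     (\<forall>i. i \<notin> {- int k .. int k'} \<longrightarrow> G i = {0}) \<and>
     (\<forall>i j. \<forall>x\<in>G i. \<forall>y\<in>G j. bracket x y \<in> G (i + j))"

definition M2 :: "pt set" where
  "M2 = {(z, w).
     w $ 1 - cnj (w $ 1) = 2 * \<i> * z * cnj z \<and>
     w $ 2 - cnj (w $ 2) = 2 * \<i> * (z^2 * cnj z + z * cnj z ^ 2) \<and>
     w $ 3 - cnj (w $ 3) = 2 * (z^2 * cnj z - z * cnj z ^ 2) \<and>
     w $ 4 - cnj (w $ 4) = 2 * \<i> * (z^3 * cnj z + z * cnj z ^ 3) \<and>
     w $ 5 - cnj (w $ 5) = 2 * (z^3 * cnj z - z * cnj z ^ 3) \<and>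
     w $ 6 - cnj (w $ 6) = 2 * \<i> * z^2 * cnj z ^ 2 \<and>
     w $ 7 - cnj (w $ 7) = 2 * \<i> * (z^3 * cnj z ^ 2 + z^2 * cnj z ^ 3) \<and>
     w $ 8 - cnj (w $ 8) = 2 * (z^3 * cnj z ^ 2 - z^2 * cnj z ^ 3)}"

text \<open>The general field; cs collects the eight parameters \<open>c\<^sub>1, ..., c\<^sub>8\<close>.\<close>

definition aut_field :: "real ^ 8 \<Rightarrow> real \<Rightarrow> real \<Rightarrow> real \<Rightarrow> real \<Rightarrow> pt \<Rightarrow> pt" where
  "aut_field cs a b c d = (\<lambda>(z, w).
     ((of_real c + \<i> * of_real d) + (of_real a + \<i> * of_real b) * z,
      vector [
        of_real (cs $ 1) + 2 * of_real a * w $ 1 + 2 * (of_real d + \<i> * of_real c) * z,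
        of_real (cs $ 2) + 4 * of_real c * w $ 1 + 3 * of_real a * w $ 2 - of_real b * w $ 3
          + 2 * (of_real d + \<i> * of_real c) * z^2,
        of_real (cs $ 3) + 4 * of_real d * w $ 1 + of_real b * w $ 2 + 3 * of_real a * w $ 3
          + 2 * (of_real c - \<i> * of_real d) * z^2,
        of_real (cs $ 4) + 3 * of_real c * w $ 2 - 3 * of_real d * w $ 3 + 4 * of_real a * w $ 4
          - 2 * of_real b * w $ 5 + 2 * (of_real d + \<i> * of_real c) * z^3,
        of_real (cs $ 5) + 3 * of_real d * w $ 2 + 3 * of_real c * w $ 3 + 2 * of_real b * w $ 4
          + 4 * of_real a * w $ 5 + 2 * (of_real c - \<i> * of_real d) * z^3,
        of_real (cs $ 6) + 2 * of_real c * w $ 2 + 2 * of_real d * w $ 3 + 4 * of_real a * w $ 6,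
        of_real (cs $ 7) + 2 * of_real c * w $ 4 + 2 * of_real d * w $ 5 + 6 * of_real c * w $ 6
          + 5 * of_real a * w $ 7 - of_real b * w $ 8,
        of_real (cs $ 8) - 2 * of_real d * w $ 4 + 2 * of_real c * w $ 5 + 6 * of_real d * w $ 6
          + of_real b * w $ 7 + 5 * of_real a * w $ 8]))"

definition X9_field :: "pt \<Rightarrow> pt" where
  "X9_field = (\<lambda>(z, w).
     (z, vector [2 * w $ 1, 3 * w $ 2, 3 * w $ 3, 4 * w $ 4, 4 * w $ 5, 4 * w $ 6,
                 5 * w $ 7, 5 * w $ 8]))"

definition X10_field :: "pt \<Rightarrow> pt" where
  "X10_field = (\<lambda>(z, w).
     (\<i> * z, vector [0, - w $ 3, w $ 2, - 2 * w $ 5, 2 * w $ 4, 0, - w $ 8, w $ 7]))"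

definition X11_field :: "pt \<Rightarrow> pt" where
  "X11_field = (\<lambda>(z, w).
     (1, vector [2 * \<i> * z, 4 * w $ 1 + 2 * \<i> * z^2, 2 * z^2, 3 * w $ 2 + 2 * \<i> * z^3,
                 3 * w $ 3 + 2 * z^3, 2 * w $ 2, 2 * w $ 4 + 6 * w $ 6, 2 * w $ 5]))"

definition X12_field :: "pt \<Rightarrow> pt" where
  "X12_field = (\<lambda>(z, w).
     (\<i>, vector [2 * z, 2 * z^2, 4 * w $ 1 - 2 * \<i> * z^2, - 3 * w $ 3 + 2 * z^3,
                 3 * w $ 2 - 2 * \<i> * z^3, 2 * w $ 3, 2 * w $ 5, - 2 * w $ 4 + 6 * w $ 6]))"

text \<open>For i = 1, ..., 8 the germ \<open>X i\<close> is that of the coordinate field \<open>\<partial>\<^sub>w\<^sub>i\<close>.\<close>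

definition X :: "nat \<Rightarrow> vf_germ" where
  "X i = germ
     (if i = 9 then X9_field
      else if i = 10 then X10_field
      else if i = 11 then X11_field
      else if i = 12 then X12_field
      else (\<lambda>_. (0, axis (of_nat i) 1)))"

definition grading :: "int \<Rightarrow> vf_germ set" where
  "grading k =
     (if k = -5 then span {X 7, X 8}
      else if k = -4 then span {X 4, X 5, X 6}
      else if k = -3 then span {X 2, X 3}
      else if k = -2 then span {X 1}
      else if k = -1 then span {X 11, X 12}
      else if k = 0 then span {X 9, X 10}
      else {0})"

end

theory Submission
  imports Defs "HOL-Complex_Analysis.Conformal_Mappings"
begin

text \<open>Write \<open>P(z, s) = s p1(z) + s\<^sup>2 p2(z) + s\<^sup>3 p3(z)\<close> for the vector of the eight polynomials with
\<open>M2 = {Im w = P(z, cnj z)}\<close>. A field \<open>Z \<partial>\<^sub>z + W \<partial>\<^sub>w\<close> is tangent to \<open>M2\<close> exactly when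
\<open>W - cnj W = 2 \<i> (P\<^sub>z Z + P\<^sub>s cnj Z)\<close> along \<open>M2\<close> (\<open>tangent_space_M2_iff\<close>). As \<open>Z\<close> and \<open>W\<close> are
holomorphic and \<open>M2\<close> is totally real in the complexification, the identity survives when \<open>cnj z\<close> is
replaced by an independent variable \<open>s\<close> and \<open>cnj w\<close> by \<open>w - 2 \<i> P(z, s)\<close>
(\<open>complexified_tangency\<close>).

That every infinitesimal automorphism lies in the twelve-parameter family is then read off from the
first Taylor coefficients in \<open>s\<close>. At \<open>s = 0\<close> one gets \<open>W\<^sup>l(z, w) = A\<^sup>l(w) + 2 \<i> p1\<^sup>l(z) Bb(w)\<close>, where
\<open>A = W(0, \<cdot>)\<close> is real on real \<open>w\<close>, \<open>B = Z(0, \<cdot>)\<close>, and \<open>Bb\<close> is \<open>B\<close> conjugated. The coefficients of \<open>s\<close>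
and \<open>s\<^sup>2\<close> are identities between polynomials in \<open>z\<close> (\<open>order1\<close>, \<open>order2\<close>) whose coefficients involve
the combinations \<open>\<partial>\<^sub>m A\<^sup>l - \<i> \<partial>\<^sub>n A\<^sup>l\<close>, in the first case with \<open>(m, n) = (2, 3)\<close> or \<open>(4, 5)\<close>, in the second
with \<open>(7, 8)\<close>; since \<open>A\<close> is real, conjugation separates the two derivatives (\<open>real_imag_split\<close>). The
component \<open>l = 4\<close> of the coefficient of \<open>s\<close> forces \<open>Z = B + z Z1\<close>, and now all derivatives of all
\<open>A\<^sup>l\<close> in the directions \<open>w\<^sup>1, \<dots>, w\<^sup>5\<close> are combinations of \<open>B\<close>, \<open>Z1\<close> and their conjugates. Many of them vanish, and equality of mixed
derivatives turns this into independence of \<open>B\<close> and \<open>Z1\<close> from \<open>w\<^sup>1, \<dots>, w\<^sup>5\<close> (by \<open>order1\<close>), then from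
\<open>w\<^sup>6, w\<^sup>7, w\<^sup>8\<close> (by \<open>order2\<close>). So \<open>B = c + \<i> d\<close> and \<open>Z1 = a + \<i> b\<close> are constants, the \<open>A\<^sup>l\<close> are affine with
prescribed linear parts, and only the eight real constants \<open>A\<^sup>l(0)\<close> remain free
(\<open>field_is_aut_field\<close>). The converse is a direct check of the tangency equation
(\<open>aut_field_tangent\<close>).

The equality of mixed derivatives is used through difference quotients (\<open>indep_of_pd\<close>): if
\<open>\<partial>\<^sub>u f = g\<close> depends neither on \<open>w\<^sup>u\<close> nor on \<open>w\<^sup>v\<close>, then \<open>f(w + t e\<^sub>u) - f(w) = t g(w)\<close>, and applying
\<open>\<partial>\<^sub>v\<close> to this shows that \<open>\<partial>\<^sub>v f\<close> does not depend on \<open>w\<^sup>u\<close>. This form uses complex differentiability of \<open>f\<close> alone, whereas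
the symmetry of second derivatives would first require holomorphy of the partial derivatives.

For the algebraic part, the parameters identify \<open>aut_CR M2\<close> linearly with \<open>\<real>\<^sup>1\<^sup>2\<close> (\<open>aut_germ\<close>). The
bracket is computed once for two general fields (\<open>bracket_aut_germ\<close>); the commutator table, closure
under brackets and compatibility with the grading are all instances of that formula.\<close>

section \<open>The defining equations of the submanifold\<close>

lemma exhaust_8: "x = 1 \<or> x = 2 \<or> x = 3 \<or> x = 4 \<or> x = 5 \<or> x = 6 \<or> x = 7 \<or> x = 8" for x :: 8
proof (induct x)
  case (of_int z)
  then have "0 \<le> z" and "z < 8" by simp_all
  then have "z = 0 | z = 1 | z = 2 | z = 3 | z = 4 | z = 5 | z = 6 | z = 7" by arith
  then show ?case by auto
qed

lemma forall_8: "(\<forall>i::8. P i) \<longleftrightarrow> P 1 \<and> P 2 \<and> P 3 \<and> P 4 \<and> P 5 \<and> P 6 \<and> P 7 \<and> P 8"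
  by (metis exhaust_8)

lemma sum_8: "sum f (UNIV::8 set) = f 1 + f 2 + f 3 + f 4 + f 5 + f 6 + f 7 + f 8"
proof -
  have *: "UNIV = {1, 2, 3, 4, 5, 6, 7, 8::8}"
    using exhaust_8 by auto
  show ?thesis unfolding * by (simp add: add.assoc)
qed

lemma vector_8:
  "vector [x1,x2,x3,x4,x5,x6,x7,x8] $ (1::8) = x1"
  "vector [x1,x2,x3,x4,x5,x6,x7,x8] $ (2::8) = x2"
  "vector [x1,x2,x3,x4,x5,x6,x7,x8] $ (3::8) = x3"
  "vector [x1,x2,x3,x4,x5,x6,x7,x8] $ (4::8) = x4"
  "vector [x1,x2,x3,x4,x5,x6,x7,x8] $ (5::8) = x5"
  "vector [x1,x2,x3,x4,x5,x6,x7,x8] $ (6::8) = x6"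
  "vector [x1,x2,x3,x4,x5,x6,x7,x8] $ (7::8) = x7"
  "vector [x1,x2,x3,x4,x5,x6,x7,x8] $ (8::8) = x8"
  by (simp_all add: vector_def)

lemma vec_eq_8: "x = y \<longleftrightarrow> x $ 1 = y $ 1 \<and> x $ 2 = y $ 2 \<and> x $ 3 = y $ 3 \<and> x $ 4 = y $ 4 \<and>
    x $ 5 = y $ 5 \<and> x $ 6 = y $ 6 \<and> x $ 7 = y $ 7 \<and> x $ 8 = y $ 8" for x y :: "'a ^ 8"
  by (simp add: vec_eq_iff forall_8)

text \<open>The three coefficients of \<open>P(z, s)\<close> as a polynomial in \<open>s\<close>, followed by their derivatives in \<open>z\<close>.
  The components 2 and 3, 4 and 5, 7 and 8 come in pairs in which the second entry is
  \<open>\<plusminus>\<i>\<close> times the first; this is what pairs the derivatives of the unknown functions below.\<close>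

definition p1 :: "complex \<Rightarrow> complex ^ 8" where
  "p1 z = vector [z, z^2, - \<i> * z^2, z^3, - \<i> * z^3, 0, 0, 0]"
definition p2 :: "complex \<Rightarrow> complex ^ 8" where
  "p2 z = vector [0, z, \<i> * z, 0, 0, z^2, z^3, - \<i> * z^3]"
definition p3 :: "complex \<Rightarrow> complex ^ 8" where
  "p3 z = vector [0, 0, 0, z, \<i> * z, 0, z^2, \<i> * z^2]"
definition dp1 :: "complex \<Rightarrow> complex ^ 8" where
  "dp1 z = vector [1, 2 * z, - 2 * \<i> * z, 3 * z^2, - 3 * \<i> * z^2, 0, 0, 0]"
definition dp2 :: "complex \<Rightarrow> complex ^ 8" where
  "dp2 z = vector [0, 1, \<i>, 0, 0, 2 * z, 3 * z^2, - 3 * \<i> * z^2]"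
definition dp3 :: "complex \<Rightarrow> complex ^ 8" where
  "dp3 z = vector [0, 0, 0, 1, \<i>, 0, 2 * z, 2 * \<i> * z]"

lemmas p_defs = p1_def p2_def p3_def dp1_def dp2_def dp3_def

definition P :: "complex \<Rightarrow> complex \<Rightarrow> complex ^ 8" where
  "P z s = (\<chi> l. s * p1 z $ l + s^2 * p2 z $ l + s^3 * p3 z $ l)"
definition Pz :: "complex \<Rightarrow> complex \<Rightarrow> complex ^ 8" where
  "Pz z s = (\<chi> l. s * dp1 z $ l + s^2 * dp2 z $ l + s^3 * dp3 z $ l)"
definition Ps :: "complex \<Rightarrow> complex \<Rightarrow> complex ^ 8" where
  "Ps z s = (\<chi> l. p1 z $ l + 2 * s * p2 z $ l + 3 * s^2 * p3 z $ l)"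

lemma DERIV_p:
  "((\<lambda>z. p1 z $ l) has_field_derivative dp1 z $ l) (at z)"
  "((\<lambda>z. p2 z $ l) has_field_derivative dp2 z $ l) (at z)"
  "((\<lambda>z. p3 z $ l) has_field_derivative dp3 z $ l) (at z)"
proof -
  have "\<forall>l. ((\<lambda>z. p1 z $ l) has_field_derivative dp1 z $ l) (at z)"
    unfolding forall_8 p_defs vector_8
    by (intro conjI; (rule derivative_eq_intros refl)+; simp)
  then show "((\<lambda>z. p1 z $ l) has_field_derivative dp1 z $ l) (at z)" ..
  have "\<forall>l. ((\<lambda>z. p2 z $ l) has_field_derivative dp2 z $ l) (at z)"
    unfolding forall_8 p_defs vector_8
    by (intro conjI; (rule derivative_eq_intros refl)+; simp)
  then show "((\<lambda>z. p2 z $ l) has_field_derivative dp2 z $ l) (at z)" ..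
  have "\<forall>l. ((\<lambda>z. p3 z $ l) has_field_derivative dp3 z $ l) (at z)"
    unfolding forall_8 p_defs vector_8
    by (intro conjI; (rule derivative_eq_intros refl)+; simp)
  then show "((\<lambda>z. p3 z $ l) has_field_derivative dp3 z $ l) (at z)" ..
qed

text \<open>The polynomials \<open>P\<^sup>l\<close> are Hermitian, so that \<open>P(z, cnj z)\<close> is real.\<close>

lemma cnj_P: "cnj (P z s $ l) = P (cnj s) (cnj z) $ l"
  using exhaust_8[of l]
  by (elim disjE; simp add: P_def p_defs vector_8 algebra_simps)

lemma M2_iff: "(z, w) \<in> M2 \<longleftrightarrow> (\<forall>l. w $ l - cnj (w $ l) = 2 * \<i> * P z (cnj z) $ l)"
  unfolding M2_def forall_8 by (simp add: P_def p_defs vector_8 algebra_simps)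

section \<open>Tangent vectors\<close>

lemma P_has_vector_derivative:
  assumes "(z has_vector_derivative z') (at t)" "(s has_vector_derivative s') (at t)"
  shows "((\<lambda>t. P (z t) (s t) $ l) has_vector_derivative (Pz (z t) (s t) $ l * z' + Ps (z t) (s t) $ l * s')) (at t)"
proof -
  have p: "((\<lambda>t. p1 (z t) $ l) has_vector_derivative z' * dp1 (z t) $ l) (at t)"
    "((\<lambda>t. p2 (z t) $ l) has_vector_derivative z' * dp2 (z t) $ l) (at t)"
    "((\<lambda>t. p3 (z t) $ l) has_vector_derivative z' * dp3 (z t) $ l) (at t)"
    using field_vector_diff_chain_at[OF assms(1) DERIV_p(1)] field_vector_diff_chain_at[OF assms(1) DERIV_p(2)]
      field_vector_diff_chain_at[OF assms(1) DERIV_p(3)] by (simp_all add: o_def)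
  have 2: "((\<lambda>t. (s t)^2) has_vector_derivative 2 * s t * s') (at t)"
    unfolding power2_eq_square by (rule derivative_eq_intros assms refl)+ (simp add: algebra_simps)
  have 3: "((\<lambda>t. (s t)^3) has_vector_derivative 3 * (s t)^2 * s') (at t)"
    unfolding power3_eq_cube power2_eq_square
    by (rule derivative_eq_intros assms refl)+ (simp add: algebra_simps)
  show ?thesis
    unfolding P_def vec_lambda_beta
    by (rule derivative_eq_intros p 2 3 assms refl)+ (simp add: Pz_def Ps_def algebra_simps)
qed

lemma has_derivative_vecI:
  fixes f :: "'a::real_normed_vector \<Rightarrow> 'b::real_normed_vector ^ 'n"
  assumes "\<And>i. ((\<lambda>x. f x $ i) has_derivative (\<lambda>h. f' h $ i)) F"
  shows "(f has_derivative f') F"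
proof -
  have ax: "bounded_linear (axis i :: 'b \<Rightarrow> 'b ^ 'n)" for i
  proof (rule bounded_linear_intro[where K = 1])
    fix x y :: 'b and r :: real
    show "(axis i (x + y) :: 'b ^ 'n) = axis i x + axis i y"
      "(axis i (r *\<^sub>R x) :: 'b ^ 'n) = r *\<^sub>R axis i x"
      by (simp_all add: vec_eq_iff axis_def)
    show "norm (axis i x :: 'b ^ 'n) \<le> norm x * 1" 
      by (simp add: norm_vec_def L2_set_def axis_def if_distrib[of norm] if_distrib[of "\<lambda>x. x\<^sup>2"] cong: if_cong)
  qed
  have sum_axis: "y = (\<Sum>i\<in>UNIV. axis i (y $ i))" for y :: "'b ^ 'n"
    by (simp add: vec_eq_iff axis_def sum.delta)
  have "((\<lambda>x. \<Sum>i\<in>UNIV. axis i (f x $ i)) has_derivative (\<lambda>h. \<Sum>i\<in>UNIV. axis i (f' h $ i))) F"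
    by (intro has_derivative_sum bounded_linear.has_derivative[OF ax] assms)
  then show ?thesis by (simp flip: sum_axis)
qed

lemma graph_in_M2: "(z, \<chi> l. complex_of_real (r l) + \<i> * P z (cnj z) $ l) \<in> M2"
  using cnj_P[of z "cnj z"] by (simp add: M2_iff)

lemma eq_Re_plus_i:
  assumes "x - cnj x = 2 * \<i> * y"
  shows "x = of_real (Re x) + \<i> * y"
  using assms by (simp add: complex_eq_iff)

text \<open>The linearisation of \<open>w - cnj w = 2 \<i> P(z, cnj z)\<close> at a point of the submanifold.\<close>

definition tangency :: "complex \<Rightarrow> complex \<Rightarrow> complex ^ 8 \<Rightarrow> bool" where
  "tangency z Z W \<longleftrightarrow> (\<forall>l. W $ l - cnj (W $ l) =
      2 * \<i> * (Pz z (cnj z) $ l * Z + Ps z (cnj z) $ l * cnj Z))"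

text \<open>Differentiating the defining equation along a curve gives one direction. For the other one the
  submanifold is a graph over \<open>(z, Re w)\<close>, so the straight line in \<open>(z, Re w)\<close> lifts to a curve in it, and
  the tangency equation says that its imaginary part moves with the right velocity.\<close>

lemma tangent_space_M2_iff:
  assumes "(z, w) \<in> M2"
  shows "(Z, W) \<in> tangent_space M2 (z, w) \<longleftrightarrow> tangency z Z W"
proof
  assume "(Z, W) \<in> tangent_space M2 (z, w)"
  then obtain \<gamma> :: "real \<Rightarrow> pt" where \<gamma>: "\<gamma> 0 = (z, w)" "eventually (\<lambda>t. \<gamma> t \<in> M2) (nhds 0)"
    "(\<gamma> has_vector_derivative (Z, W)) (at 0)"
    unfolding tangent_space_def by blast
  have z': "((\<lambda>t. fst (\<gamma> t)) has_vector_derivative Z) (at 0)"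
    using bounded_linear.has_vector_derivative[OF bounded_linear_fst \<gamma>(3)] by simp
  have zc': "((\<lambda>t. cnj (fst (\<gamma> t))) has_vector_derivative cnj Z) (at 0)"
    using bounded_linear.has_vector_derivative[OF bounded_linear_cnj z'] by simp
  have W': "((\<lambda>t. snd (\<gamma> t)) has_vector_derivative W) (at 0)"
    using bounded_linear.has_vector_derivative[OF bounded_linear_snd \<gamma>(3)] by simp
  have w': "((\<lambda>t. snd (\<gamma> t) $ l) has_vector_derivative W $ l) (at 0)" for l
    using bounded_linear.has_vector_derivative[OF bounded_linear_vec_nth W'] by simp
  have wc': "((\<lambda>t. cnj (snd (\<gamma> t) $ l)) has_vector_derivative cnj (W $ l)) (at 0)" for l
    using bounded_linear.has_vector_derivative[OF bounded_linear_cnj w'] by simp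
  show "tangency z Z W"
    unfolding tangency_def
  proof
    fix l
    let ?\<rho> = "\<lambda>t. snd (\<gamma> t) $ l - cnj (snd (\<gamma> t) $ l) - 2 * \<i> * P (fst (\<gamma> t)) (cnj (fst (\<gamma> t))) $ l"
    have "(?\<rho> has_vector_derivative W $ l - cnj (W $ l) - 2 * \<i> * (Pz z (cnj z) $ l * Z + Ps z (cnj z) $ l * cnj Z)) (at 0)"
      using has_vector_derivative_diff[OF has_vector_derivative_diff[OF w'[of l] wc'[of l]]
          has_vector_derivative_mult_right[where a = "2 * \<i>", OF P_has_vector_derivative[OF z' zc', of l]]]
      by (simp only: \<gamma>(1) fst_conv)
    moreover have "(?\<rho> has_vector_derivative 0) (at 0)"
    proof -
      obtain S where S: "open S" "0 \<in> S" "\<And>t. t \<in> S \<Longrightarrow> \<gamma> t \<in> M2"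
        using \<gamma>(2) unfolding eventually_nhds by auto
      have 0: "0 = ?\<rho> t" if "t \<in> S" for t
      proof -
        have "(fst (\<gamma> t), snd (\<gamma> t)) \<in> M2" using S(3)[OF that] by simp
        then have "snd (\<gamma> t) $ l - cnj (snd (\<gamma> t) $ l) = 2 * \<i> * P (fst (\<gamma> t)) (cnj (fst (\<gamma> t))) $ l"
          unfolding M2_iff by (rule spec)
        then show ?thesis by (simp only: diff_self)
      qed
      have "((\<lambda>_. 0 :: complex) has_vector_derivative 0) (at (0::real))"
        by (rule has_vector_derivative_const)
      from has_vector_derivative_transform_within_open[OF this S(1,2) 0] show ?thesis .
    qed
    ultimately have "W $ l - cnj (W $ l) - 2 * \<i> * (Pz z (cnj z) $ l * Z + Ps z (cnj z) $ l * cnj Z) = 0"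
      by (rule vector_derivative_unique_at)
    then show "W $ l - cnj (W $ l) = 2 * \<i> * (Pz z (cnj z) $ l * Z + Ps z (cnj z) $ l * cnj Z)"
      by (simp only: right_minus_eq)
  qed
next
  assume T: "tangency z Z W"
  let ?z = "\<lambda>t::real. z + of_real t * Z"
  let ?w = "\<lambda>t l. complex_of_real (Re (w $ l) + t * Re (W $ l)) + \<i> * P (?z t) (cnj (?z t)) $ l"
  let ?\<gamma> = "\<lambda>t. (?z t, \<chi> l. ?w t l)"
  have imw: "w $ l = of_real (Re (w $ l)) + \<i> * P z (cnj z) $ l" for l
  proof -
    have "w $ l - cnj (w $ l) = 2 * \<i> * P z (cnj z) $ l" using assms by (simp add: M2_iff)
    then show ?thesis by (rule eq_Re_plus_i)
  qed
  have imW: "W $ l = of_real (Re (W $ l)) + \<i> * (Pz z (cnj z) $ l * Z + Ps z (cnj z) $ l * cnj Z)" for l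
  proof -
    have "W $ l - cnj (W $ l) = 2 * \<i> * (Pz z (cnj z) $ l * Z + Ps z (cnj z) $ l * cnj Z)"
      using T by (simp add: tangency_def)
    then show ?thesis by (rule eq_Re_plus_i)
  qed
  have g0: "?\<gamma> 0 = (z, w)" by (simp add: vec_eq_iff flip: imw)
  have gM: "?\<gamma> t \<in> M2" for t
    by (rule graph_in_M2)
  have z': "(?z has_vector_derivative Z) (at 0)"
    by (auto intro!: derivative_eq_intros simp: has_vector_derivative_def scaleR_conv_of_real)
  have zc': "((\<lambda>t. cnj (?z t)) has_vector_derivative cnj Z) (at 0)"
    using bounded_linear.has_vector_derivative[OF bounded_linear_cnj z'] by simp
  have r': "((\<lambda>t. complex_of_real (Re (w $ l) + t * Re (W $ l))) has_vector_derivative of_real (Re (W $ l))) (at 0)" for l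
    by (auto intro!: derivative_eq_intros simp: has_vector_derivative_def scaleR_conv_of_real)
  have w': "((\<lambda>t. ?w t l) has_vector_derivative W $ l) (at 0)" for l
    using has_vector_derivative_add[OF r'[of l]
        has_vector_derivative_mult_right[where a = "\<i>", OF P_has_vector_derivative[OF z' zc', of l]]] imW[of l]
    by simp
  have "((\<lambda>t. \<chi> l. ?w t l) has_vector_derivative W) (at 0)"
    unfolding has_vector_derivative_def
    by (rule has_derivative_vecI) (use w' in \<open>simp add: has_vector_derivative_def\<close>)
  then have "(?\<gamma> has_vector_derivative (Z, W)) (at 0)"
    by (intro has_vector_derivative_Pair z')
  then show "(Z, W) \<in> tangent_space M2 (z, w)"
    unfolding tangent_space_def using g0 gM by (intro CollectI exI[of _ ?\<gamma>]) auto
qed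

section \<open>Complexification of the tangency equation\<close>

definition cnjv :: "complex ^ 8 \<Rightarrow> complex ^ 8" where
  "cnjv w = (\<chi> l. cnj (w $ l))"

definition cnjp :: "pt \<Rightarrow> pt" where
  "cnjp p = (cnj (fst p), cnjv (snd p))"

text \<open>The function with conjugated Taylor coefficients, which is again holomorphic.\<close>

definition bar :: "(pt \<Rightarrow> complex) \<Rightarrow> pt \<Rightarrow> complex" where
  "bar f = (\<lambda>p. cnj (f (cnjp p)))"

lemma cnjv_nth [simp]: "cnjv w $ l = cnj (w $ l)"
  by (simp add: cnjv_def)

lemma cnjv_cnjv [simp]: "cnjv (cnjv w) = w"
  by (simp add: vec_eq_iff)

lemma norm_cnjv [simp]: "norm (cnjv w) = norm w"
  by (simp add: norm_vec_def)

lemma cnjv_0 [simp]: "cnjv 0 = 0"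
  by (simp add: vec_eq_iff)

lemma bounded_linear_cnjv: "bounded_linear cnjv"
  by (rule bounded_linear_intro[where K = 1]) (auto simp: vec_eq_iff)

lemma bounded_linear_cnjp: "bounded_linear cnjp"
  unfolding cnjp_def
  by (intro bounded_linear_Pair bounded_linear_compose[OF bounded_linear_cnj]
      bounded_linear_compose[OF bounded_linear_cnjv] bounded_linear_fst bounded_linear_snd)

lemma complex_differentiable_at_bar:
  assumes "complex_differentiable_at f (cnjp p)"
  shows "complex_differentiable_at (bar f) p"
proof -
  obtain L where L: "(f has_derivative L) (at (cnjp p))" "\<And>c v. L (cscale c v) = c * L v"
    using assms unfolding complex_differentiable_at_def by blast
  have "(bar f has_derivative (\<lambda>h. cnj (L (cnjp h)))) (at p)"
    unfolding bar_def
    by (rule bounded_linear.has_derivative[OF bounded_linear_cnj])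
       (rule has_derivative_compose[OF bounded_linear_imp_has_derivative[OF bounded_linear_cnjp] L(1)])
  moreover have "cnjp (cscale c v) = cscale (cnj c) (cnjp v)" for c v
    by (simp add: cnjp_def cscale_def vec_eq_iff)
  ultimately show ?thesis
    unfolding complex_differentiable_at_def by (auto simp: L(2))
qed

lemma complex_differentiable_at_chain:
  assumes L: "(f has_derivative L) (at (z t, \<chi> l. w l t))" "\<And>c v. L (cscale c v) = c * L v"
    and z: "(z has_field_derivative z') (at t)"
    and w: "\<And>l. (w l has_field_derivative w' l) (at t)"
  shows "((\<lambda>t. f (z t, \<chi> l. w l t)) has_field_derivative L (z', \<chi> l. w' l)) (at t)"
proof -
  have "((\<lambda>t. \<chi> l. w l t) has_derivative (\<lambda>h. \<chi> l. w' l * h)) (at t)"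
    by (rule has_derivative_vecI) (use w in \<open>simp add: has_field_derivative_def\<close>)
  then have "((\<lambda>t. (z t, \<chi> l. w l t)) has_derivative (\<lambda>h. (z' * h, \<chi> l. w' l * h))) (at t)"
    using z by (intro has_derivative_Pair) (simp_all add: has_field_derivative_def)
  from has_derivative_compose[OF this L(1)]
  have "((\<lambda>t. f (z t, \<chi> l. w l t)) has_derivative (\<lambda>h. L (z' * h, \<chi> l. w' l * h))) (at t)" .
  moreover have "(z' * h, \<chi> l. w' l * h) = cscale h (z', \<chi> l. w' l)" for h
    by (simp add: cscale_def vec_eq_iff)
  ultimately show ?thesis
    by (simp add: has_field_derivative_def L(2) mult.commute[of _ "L _"])
qed

lemma holomorphic_on_chain:
  assumes "open S" "z holomorphic_on S" "\<And>l. w l holomorphic_on S"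
    and "\<And>t. t \<in> S \<Longrightarrow> complex_differentiable_at f (z t, \<chi> l. w l t)"
  shows "(\<lambda>t. f (z t, \<chi> l. w l t)) holomorphic_on S"
  unfolding holomorphic_on_open[OF assms(1)]
proof
  fix t assume t: "t \<in> S"
  obtain L where L: "(f has_derivative L) (at (z t, \<chi> l. w l t))" "\<And>c v. L (cscale c v) = c * L v"
    using assms(4)[OF t] unfolding complex_differentiable_at_def by blast
  obtain z' where z': "(z has_field_derivative z') (at t)"
    using assms(1,2) t by (auto simp: holomorphic_on_open)
  have "\<exists>D. (w l has_field_derivative D) (at t)" for l
    using assms(1,3) t by (auto simp: holomorphic_on_open)
  then obtain w' where w': "\<And>l. (w l has_field_derivative w' l) (at t)" by metis
  show "\<exists>f'. ((\<lambda>t. f (z t, \<chi> l. w l t)) has_field_derivative f') (at t)"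
    using complex_differentiable_at_chain[where w = w, OF L z' w'] by blast
qed

lemma holomorphic_on_p:
  "(\<lambda>z. p1 z $ l) holomorphic_on S" "(\<lambda>z. p2 z $ l) holomorphic_on S" "(\<lambda>z. p3 z $ l) holomorphic_on S"
  "(\<lambda>z. dp1 z $ l) holomorphic_on S" "(\<lambda>z. dp2 z $ l) holomorphic_on S" "(\<lambda>z. dp3 z $ l) holomorphic_on S"
proof -
  have "\<forall>l. (\<lambda>z. p1 z $ l) holomorphic_on S" "\<forall>l. (\<lambda>z. p2 z $ l) holomorphic_on S"
    "\<forall>l. (\<lambda>z. p3 z $ l) holomorphic_on S" "\<forall>l. (\<lambda>z. dp1 z $ l) holomorphic_on S"
    "\<forall>l. (\<lambda>z. dp2 z $ l) holomorphic_on S" "\<forall>l. (\<lambda>z. dp3 z $ l) holomorphic_on S"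
    unfolding forall_8 p_defs vector_8 by (intro conjI holomorphic_intros)+
  then show "(\<lambda>z. p1 z $ l) holomorphic_on S" "(\<lambda>z. p2 z $ l) holomorphic_on S" "(\<lambda>z. p3 z $ l) holomorphic_on S"
  "(\<lambda>z. dp1 z $ l) holomorphic_on S" "(\<lambda>z. dp2 z $ l) holomorphic_on S" "(\<lambda>z. dp3 z $ l) holomorphic_on S"
    by blast+
qed

lemma holomorphic_on_P:
  assumes "z holomorphic_on S" "s holomorphic_on S"
  shows "(\<lambda>t. P (z t) (s t) $ l) holomorphic_on S" "(\<lambda>t. Pz (z t) (s t) $ l) holomorphic_on S"
    "(\<lambda>t. Ps (z t) (s t) $ l) holomorphic_on S"
proof -
  note * = holomorphic_on_compose[OF assms(1) holomorphic_on_p(1), unfolded o_def]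
    holomorphic_on_compose[OF assms(1) holomorphic_on_p(2), unfolded o_def]
    holomorphic_on_compose[OF assms(1) holomorphic_on_p(3), unfolded o_def]
    holomorphic_on_compose[OF assms(1) holomorphic_on_p(4), unfolded o_def]
    holomorphic_on_compose[OF assms(1) holomorphic_on_p(5), unfolded o_def]
    holomorphic_on_compose[OF assms(1) holomorphic_on_p(6), unfolded o_def]
  show "(\<lambda>t. P (z t) (s t) $ l) holomorphic_on S" "(\<lambda>t. Pz (z t) (s t) $ l) holomorphic_on S"
    "(\<lambda>t. Ps (z t) (s t) $ l) holomorphic_on S"
    unfolding P_def Pz_def Ps_def vec_lambda_beta
    by (intro holomorphic_intros * assms)+
qed

text \<open>In the complexified equation the field is evaluated at points \<open>v + c P(z, s)\<close>; as \<open>P\<close> vanishes at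
  the origin, they stay in its domain when \<open>z\<close>, \<open>s\<close> and \<open>v\<close> are small.\<close>

lemma shift_small:
  assumes "e > 0"
  shows "\<exists>r>0. \<forall>z s v. norm z < r \<longrightarrow> norm s < r \<longrightarrow> norm v < r \<longrightarrow> norm (v + c *s P z s) < e"
proof -
  have f: "((\<lambda>x. fst x) \<longlongrightarrow> 0) (nhds (0::complex \<times> complex \<times> (complex ^ 8)))"
    "((\<lambda>x. fst (snd x)) \<longlongrightarrow> 0) (nhds (0::complex \<times> complex \<times> (complex ^ 8)))"
    "((\<lambda>x. snd (snd x)) \<longlongrightarrow> 0) (nhds (0::complex \<times> complex \<times> (complex ^ 8)))"
    using tendsto_fst[OF filterlim_ident[of "nhds (0::complex \<times> complex \<times> (complex ^ 8))"]]
      tendsto_fst[OF tendsto_snd[OF filterlim_ident[of "nhds (0::complex \<times> complex \<times> (complex ^ 8))"]]]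
      tendsto_snd[OF tendsto_snd[OF filterlim_ident[of "nhds (0::complex \<times> complex \<times> (complex ^ 8))"]]]
    by (simp_all only: fst_zero snd_zero)
  have p: "((\<lambda>x. p1 (fst x) $ l) \<longlongrightarrow> 0) (nhds (0::complex \<times> complex \<times> (complex ^ 8)))"
    "((\<lambda>x. p2 (fst x) $ l) \<longlongrightarrow> 0) (nhds (0::complex \<times> complex \<times> (complex ^ 8)))"
    "((\<lambda>x. p3 (fst x) $ l) \<longlongrightarrow> 0) (nhds (0::complex \<times> complex \<times> (complex ^ 8)))" for l
  proof -
    have "\<forall>l. p1 0 $ l = 0" "\<forall>l. p2 0 $ l = 0" "\<forall>l. p3 0 $ l = 0"
      by (simp_all add: forall_8 p_defs vector_8)
    then show "((\<lambda>x. p1 (fst x) $ l) \<longlongrightarrow> 0) (nhds (0::complex \<times> complex \<times> (complex ^ 8)))"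
      "((\<lambda>x. p2 (fst x) $ l) \<longlongrightarrow> 0) (nhds (0::complex \<times> complex \<times> (complex ^ 8)))"
      "((\<lambda>x. p3 (fst x) $ l) \<longlongrightarrow> 0) (nhds (0::complex \<times> complex \<times> (complex ^ 8)))"
      using isCont_tendsto_compose[OF DERIV_isCont[OF DERIV_p(1)] f(1), of l]
        isCont_tendsto_compose[OF DERIV_isCont[OF DERIV_p(2)] f(1), of l]
        isCont_tendsto_compose[OF DERIV_isCont[OF DERIV_p(3)] f(1), of l] by simp_all
  qed
  have v: "((\<lambda>x. snd (snd x) $ l) \<longlongrightarrow> 0) (nhds (0::complex \<times> complex \<times> (complex ^ 8)))" for l
    using tendsto_vec_nth[OF f(3), of l] by simp
  have "((\<lambda>x. snd (snd x) + c *s P (fst x) (fst (snd x))) \<longlongrightarrow> 0) (nhds (0::complex \<times> complex \<times> (complex ^ 8)))"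
  proof (rule vec_tendstoI)
    fix i
    have "((\<lambda>x. snd (snd x) $ i + c * (fst (snd x) * p1 (fst x) $ i + fst (snd x)^2 * p2 (fst x) $ i
        + fst (snd x)^3 * p3 (fst x) $ i)) \<longlongrightarrow> 0 + c * (0 * 0 + 0^2 * 0 + 0^3 * 0))
        (nhds (0::complex \<times> complex \<times> (complex ^ 8)))"
      by (intro tendsto_add tendsto_mult tendsto_power tendsto_const f p v)
    then show "((\<lambda>x. (snd (snd x) + c *s P (fst x) (fst (snd x))) $ i) \<longlongrightarrow> 0 $ i)
        (nhds (0::complex \<times> complex \<times> (complex ^ 8)))"
      by (simp add: P_def)
  qed
  from tendstoD[OF this assms] obtain d where d: "d > 0"
    "\<And>x::complex \<times> complex \<times> (complex ^ 8). dist x 0 < d \<Longrightarrow> norm (snd (snd x) + c *s P (fst x) (fst (snd x))) < e"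
    by (auto simp: eventually_nhds_metric)
  show ?thesis
  proof (intro exI[of _ "d / 3"] conjI allI impI)
    fix z s :: complex and v :: "complex ^ 8"
    assume *: "norm z < d / 3" "norm s < d / 3" "norm v < d / 3"
    have "norm (z, s, v) \<le> norm z + norm (s, v)" by (rule norm_Pair_le)
    also have "\<dots> \<le> norm z + (norm s + norm v)" by (intro add_left_mono norm_Pair_le)
    finally have "dist (z, s, v) 0 < d" using * by simp
    from d(2)[OF this] show "norm (v + c *s P z s) < e" by simp
  qed (use d in auto)
qed

text \<open>The identity theorem in the shape needed to pass from real to complex parameters: a complex point
  \<open>a + \<i> b\<close> is the value at \<open>t = \<i>\<close> of the complex line \<open>a + t b\<close> whose points with real \<open>t\<close> are real.\<close>

lemma vanishes_on_totally_real:
  assumes "F holomorphic_on ball 0 2" "\<And>t::real. \<bar>t\<bar> < 1 \<Longrightarrow> F (of_real t) = 0"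
  shows "F \<i> = 0"
proof (rule analytic_continuation[of F "ball 0 2" "of_real ` {-1<..<1}" 0])
  show "(0::complex) islimpt of_real ` {- 1<..<1}"
    unfolding islimpt_approachable
  proof (intro allI impI)
    fix e :: real assume "e > 0"
    then show "\<exists>x'\<in>complex_of_real ` {- 1<..<1}. x' \<noteq> 0 \<and> dist x' 0 < e"
      by (intro bexI[of _ "of_real (min (e / 2) (1 / 2))"] imageI) auto
  qed
qed (use assms in \<open>auto simp: dist_norm\<close>)

text \<open>Along the submanifold \<open>(cnj z, cnj w) = (s, w - 2 \<i> P(z, s))\<close> with \<open>s = cnj z\<close>, so both sides of the
  tangency equation extend holomorphically to independent \<open>z\<close>, \<open>s\<close>, \<open>w\<close>. Symmetric coordinates
  \<open>(z, s, v)\<close> with \<open>w = v + \<i> P(z, s)\<close> are used for the extension, because in them the submanifold is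
  the set of points with \<open>s = cnj z\<close> and \<open>v\<close> real. One complex line through each point suffices.\<close>

lemma complexified_tangency:
  assumes "inf_CR_automorphism M2 V"
  obtains \<delta> where "\<delta> > 0"
    "\<And>z w. norm z < \<delta> \<Longrightarrow> norm w < \<delta> \<Longrightarrow> complex_differentiable_at (\<lambda>q. fst (V q)) (z, w)"
    "\<And>z w l. norm z < \<delta> \<Longrightarrow> norm w < \<delta> \<Longrightarrow> complex_differentiable_at (\<lambda>q. snd (V q) $ l) (z, w)"
    "\<And>z s w l. norm z < \<delta> \<Longrightarrow> norm s < \<delta> \<Longrightarrow> norm w < \<delta> \<Longrightarrow>
       snd (V (z, w)) $ l - bar (\<lambda>q. snd (V q) $ l) (s, w - (2 * \<i>) *s P z s) =
       2 * \<i> * (Pz z s $ l * fst (V (z, w)) + Ps z s $ l * bar (\<lambda>q. fst (V q)) (s, w - (2 * \<i>) *s P z s))"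
proof -
  obtain U where U: "open U" "0 \<in> U" "holomorphic_field_on U V" "\<And>p. p \<in> M2 \<Longrightarrow> p \<in> U \<Longrightarrow> V p \<in> tangent_space M2 p"
    using assms unfolding inf_CR_automorphism_def by auto
  obtain \<rho> where \<rho>: "\<rho> > 0" "ball 0 \<rho> \<subseteq> U"
    using U(1,2) openE by blast
  have small: "(x, y) \<in> U" if "norm x < \<rho> / 2" "norm y < \<rho> / 2" for x y
    using that norm_Pair_le[of x y] \<rho> by (auto simp: subset_eq)
  have dZ: "complex_differentiable_at (\<lambda>q. fst (V q)) (x, y)"
    and dW: "complex_differentiable_at (\<lambda>q. snd (V q) $ l) (x, y)"
    if "norm x < \<rho> / 2" "norm y < \<rho> / 2" for x y l
    using small[OF that] U(3) unfolding holomorphic_field_on_def by auto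
  have dZ': "complex_differentiable_at (bar (\<lambda>q. fst (V q))) (x, y)"
    and dW': "complex_differentiable_at (bar (\<lambda>q. snd (V q) $ l)) (x, y)"
    if "norm x < \<rho> / 2" "norm y < \<rho> / 2" for x y l
    using dZ[of "cnj x" "cnjv y"] dW[of "cnj x" "cnjv y"] that
    by (auto intro!: complex_differentiable_at_bar simp: cnjp_def)
  obtain r1 where r1: "r1 > 0" "\<And>z s v. norm z < r1 \<Longrightarrow> norm s < r1 \<Longrightarrow> norm v < r1 \<Longrightarrow> norm (v + \<i> *s P z s) < \<rho> / 2"
    using shift_small[of "\<rho> / 2" \<i>] \<rho>(1) by auto
  obtain r2 where r2: "r2 > 0" "\<And>z s v. norm z < r2 \<Longrightarrow> norm s < r2 \<Longrightarrow> norm v < r2 \<Longrightarrow> norm (v + (- \<i>) *s P z s) < \<rho> / 2"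
    using shift_small[of "\<rho> / 2" "- \<i>"] \<rho>(1) by auto
  define r where "r = min (\<rho> / 2) (min r1 r2)"
  have r: "r > 0" "r \<le> \<rho> / 2" "r \<le> r1" "r \<le> r2" using \<rho> r1(1) r2(1) by (auto simp: r_def)
  define F where "F l z s v = snd (V (z, v + \<i> *s P z s)) $ l - bar (\<lambda>q. snd (V q) $ l) (s, v - \<i> *s P z s) -
       2 * \<i> * (Pz z s $ l * fst (V (z, v + \<i> *s P z s)) + Ps z s $ l * bar (\<lambda>q. fst (V q)) (s, v - \<i> *s P z s))" for l z s v
  have real_pts: "F l z (cnj z) v = 0" if "norm z < r" "norm v < r" "\<And>l. v $ l \<in> \<real>" for l z v
  proof -
    have v: "v $ l = of_real (Re (v $ l))" for l using that(3)[of l] by simp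
    let ?w = "v + \<i> *s P z (cnj z)"
    have "?w = (\<chi> l. complex_of_real (Re (v $ l)) + \<i> * P z (cnj z) $ l)"
      by (simp add: vec_eq_iff flip: v)
    then have M: "(z, ?w) \<in> M2" using graph_in_M2 by simp
    have "(z, ?w) \<in> U" using that r r1(2)[of z "cnj z" v] by (intro small) auto
    with U(4)[OF M] tangent_space_M2_iff[OF M, of "fst (V (z, ?w))" "snd (V (z, ?w))"]
    have T: "tangency z (fst (V (z, ?w))) (snd (V (z, ?w)))" by simp
    have "cnj (v $ l) = v $ l" for l using that(3)[of l] by (simp add: Reals_cnj_iff)
    then have c: "cnjp (cnj z, v - \<i> *s P z (cnj z)) = (z, ?w)"
      by (simp add: cnjp_def vec_eq_iff cnj_P)
    show ?thesis using T unfolding tangency_def F_def bar_def c by simp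
  qed
  have complexified: "F l z s v = 0" if "norm z < r / 3" "norm s < r / 3" "norm v < r / 3" for l z s v
  proof -
    \<comment> \<open>The real points of this line have \<open>s = cnj z\<close>, and \<open>t = \<i>\<close> gives the prescribed \<open>z\<close> and \<open>s\<close>.\<close>
    define a where "a = (z + cnj s) / 2"
    define b where "b = (z - cnj s) / (2 * \<i>)"
    let ?z = "\<lambda>t. a + t * b" and ?s = "\<lambda>t. cnj a + t * cnj b"
    let ?v = "\<lambda>t. \<chi> l. complex_of_real (Re (v $ l)) + t * of_real (Im (v $ l))"
    have ab: "norm a < r / 3" "norm b < r / 3"
      using that norm_triangle_ineq[of z "cnj s"] norm_triangle_ineq4[of z "cnj s"]
      by (auto simp: a_def b_def norm_divide norm_mult)
    have nz: "norm (?z t) < r" "norm (?s t) < r" if "norm t < 2" for t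
    proof -
      have "norm (t * b) \<le> 2 * norm b" "norm (t * cnj b) \<le> 2 * norm b" using that
        by (auto simp: norm_mult intro!: mult_right_mono)
      then show "norm (?z t) < r" "norm (?s t) < r"
        using ab norm_triangle_ineq[of a "t * b"] norm_triangle_ineq[of "cnj a" "t * cnj b"] by auto
    qed
    have nv: "norm (?v t) < r" if "norm t < 2" for t
    proof -
      have "norm (?v t) \<le> norm (3 *\<^sub>R v)"
      proof (rule norm_le_componentwise_cart)
        fix i
        have "norm (t * of_real (Im (v $ i))) \<le> 2 * norm (v $ i)"
          unfolding norm_mult by (rule mult_mono) (use that abs_Im_le_cmod in auto)
        then show "norm (?v t $ i) \<le> norm ((3 *\<^sub>R v) $ i)"
          using norm_triangle_ineq[of "complex_of_real (Re (v $ i))" "t * of_real (Im (v $ i))"]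
            abs_Re_le_cmod[of "v $ i"] by simp
      qed
      then show ?thesis using \<open>norm v < r / 3\<close> by simp
    qed
    have z: "?z holomorphic_on ball 0 2" "?s holomorphic_on ball 0 2"
      by (intro holomorphic_intros)+
    have w: "(\<lambda>t. ?v t $ l + c * P (?z t) (?s t) $ l) holomorphic_on ball 0 2" for l c
      unfolding vec_lambda_beta by (intro holomorphic_intros holomorphic_on_P)
    have rw: "?v t + \<i> *s P (?z t) (?s t) = (\<chi> l. ?v t $ l + \<i> * P (?z t) (?s t) $ l)"
      "?v t - \<i> *s P (?z t) (?s t) = (\<chi> l. ?v t $ l + (- \<i>) * P (?z t) (?s t) $ l)" for t
      by (simp_all add: vec_eq_iff)
    have d1: "norm (\<chi> l. ?v t $ l + \<i> * P (?z t) (?s t) $ l) < \<rho> / 2"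
      "norm (\<chi> l. ?v t $ l + (- \<i>) * P (?z t) (?s t) $ l) < \<rho> / 2"
      "norm (?z t) < \<rho> / 2" "norm (?s t) < \<rho> / 2" if "t \<in> ball 0 2" for t
    proof -
      have t: "norm t < 2" using that by (simp add: dist_norm)
      show "norm (?z t) < \<rho> / 2" "norm (?s t) < \<rho> / 2" using nz[OF t] r by auto
      show "norm (\<chi> l. ?v t $ l + \<i> * P (?z t) (?s t) $ l) < \<rho> / 2"
        using r1(2)[of "?z t" "?s t" "?v t"] nz[OF t] nv[OF t] r(3) unfolding rw by linarith
      show "norm (\<chi> l. ?v t $ l + (- \<i>) * P (?z t) (?s t) $ l) < \<rho> / 2"
        using r2(2)[of "?z t" "?s t" "?v t"] nz[OF t] nv[OF t] r(4)
        unfolding rw(2)[symmetric] by (simp add: vector_smult_lneg)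
    qed
    have hol: "(\<lambda>t. F l (?z t) (?s t) (?v t)) holomorphic_on ball 0 2"
      unfolding F_def rw
      by (intro holomorphic_intros holomorphic_on_P z
          holomorphic_on_chain[of _ ?z, OF open_ball z(1) w]
          holomorphic_on_chain[of _ ?s, OF open_ball z(2) w] dZ dW dZ' dW' d1)
    have "F l (?z \<i>) (?s \<i>) (?v \<i>) = 0"
    proof (rule vanishes_on_totally_real[OF hol])
      fix t :: real assume t: "\<bar>t\<bar> < 1"
      have "?s (of_real t) = cnj (?z (of_real t))" by simp
      then show "F l (?z (of_real t)) (?s (of_real t)) (?v (of_real t)) = 0"
        using t by (simp only:) (rule real_pts; (rule nz nv)?; simp)
    qed
    moreover have "?z \<i> = z" "?s \<i> = s" "?v \<i> = v"
      by (auto simp: a_def b_def field_simps vec_eq_iff complex_eq_iff)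
    ultimately show ?thesis by simp
  qed
  obtain r3 where r3: "r3 > 0" "\<And>z s v. norm z < r3 \<Longrightarrow> norm s < r3 \<Longrightarrow> norm v < r3 \<Longrightarrow> norm (v + (- \<i>) *s P z s) < r / 3"
    using shift_small[of "r / 3" "- \<i>"] r(1) by auto
  show ?thesis
  proof (rule that[of "min r3 (r / 3)"])
    fix z s :: complex and w :: "complex ^ 8" and l
    assume *: "norm z < min r3 (r / 3)" "norm s < min r3 (r / 3)" "norm w < min r3 (r / 3)"
    have e: "w + (- \<i>) *s P z s + \<i> *s P z s = w" "w + (- \<i>) *s P z s - \<i> *s P z s = w - (2 * \<i>) *s P z s"
      by (simp_all add: vec_eq_iff)
    have "F l z s (w + (- \<i>) *s P z s) = 0"
      by (rule complexified) (use * r3(2)[of z s w] in auto)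
    then show "snd (V (z, w)) $ l - bar (\<lambda>q. snd (V q) $ l) (s, w - (2 * \<i>) *s P z s) =
       2 * \<i> * (Pz z s $ l * fst (V (z, w)) + Ps z s $ l * bar (\<lambda>q. fst (V q)) (s, w - (2 * \<i>) *s P z s))"
      unfolding F_def e by simp
  qed (use r r3(1) dZ dW in auto)
qed

section \<open>Holomorphic functions of the transversal variables\<close>

definition holo :: "(complex ^ 8 \<Rightarrow> complex) \<Rightarrow> complex ^ 8 \<Rightarrow> bool" where
  "holo f w \<longleftrightarrow> (\<exists>L. (f has_derivative L) (at w) \<and> (\<forall>c v. L (c *s v) = c * L v))"

definition pd :: "(complex ^ 8 \<Rightarrow> complex) \<Rightarrow> 8 \<Rightarrow> complex ^ 8 \<Rightarrow> complex" where
  "pd f m w = frechet_derivative f (at w) (axis m 1)"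

lemma sum_axis_mult [simp]: "(\<Sum>m\<in>UNIV. (axis u 1 :: complex ^ 8) $ m * g m) = g u"
proof -
  have "(axis u 1 :: complex ^ 8) $ m * g m = (if m = u then g m else 0)" for m
    by (simp add: axis_def)
  then show ?thesis by simp
qed

lemma holo_has_derivative:
  assumes "holo f w"
  shows "(f has_derivative (\<lambda>h. \<Sum>m\<in>UNIV. h $ m * pd f m w)) (at w)"
proof -
  obtain L where L: "(f has_derivative L) (at w)" "\<And>c v. L (c *s v) = c * L v"
    using assms unfolding holo_def by blast
  have lin: "linear L" using L(1) has_derivative_linear by blast
  have "L h = (\<Sum>m\<in>UNIV. h $ m * pd f m w)" for h
  proof -
    have "h = (\<Sum>m\<in>UNIV. h $ m *s axis m 1)"
      by (simp add: basis_expansion)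
    then have "L h = (\<Sum>m\<in>UNIV. L (h $ m *s axis m 1))"
      by (metis linear_sum[OF lin])
    then show ?thesis
      by (simp add: L(2) pd_def frechet_derivative_at[OF L(1), symmetric])
  qed
  then have "L = (\<lambda>h. \<Sum>m\<in>UNIV. h $ m * pd f m w)" by blast
  then show ?thesis using L(1) by simp
qed

text \<open>A derivative in coordinate form exhibits holomorphy and the partial derivatives at once; the
  differentiation rules below are obtained by inspecting the derivative of the composite.\<close>

lemma holoI:
  assumes "(f has_derivative (\<lambda>h. \<Sum>m\<in>UNIV. h $ m * d m)) (at w)"
  shows "holo f w" "pd f m w = d m"
proof -
  show "holo f w" unfolding holo_def
    using assms by (intro exI conjI) (auto simp: sum_distrib_left mult.assoc)
  show "pd f m w = d m"
    unfolding pd_def frechet_derivative_at[OF assms, symmetric] by simp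
qed

lemma holo_const [simp]: "holo (\<lambda>_. c) w" "pd (\<lambda>_. c) m w = 0"
proof -
  have "((\<lambda>_. c) has_derivative (\<lambda>h. \<Sum>m\<in>UNIV. h $ m * 0)) (at w)" by simp
  from holoI[OF this] show "holo (\<lambda>_. c) w" "pd (\<lambda>_. c) m w = 0" by auto
qed

lemma holo_add:
  assumes "holo f w" "holo g w"
  shows "holo (\<lambda>w. f w + g w) w" "pd (\<lambda>w. f w + g w) m w = pd f m w + pd g m w"
proof -
  have "((\<lambda>w. f w + g w) has_derivative (\<lambda>h. \<Sum>m\<in>UNIV. h $ m * (pd f m w + pd g m w))) (at w)"
    by (rule has_derivative_eq_rhs[OF has_derivative_add[OF holo_has_derivative[OF assms(1)] holo_has_derivative[OF assms(2)]]])
       (simp add: algebra_simps sum.distrib fun_eq_iff)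
  from holoI[OF this] show "holo (\<lambda>w. f w + g w) w" "pd (\<lambda>w. f w + g w) m w = pd f m w + pd g m w"
    by auto
qed

lemma holo_cmult:
  assumes "holo f w"
  shows "holo (\<lambda>w. c * f w) w" "pd (\<lambda>w. c * f w) m w = c * pd f m w"
proof -
  have "((\<lambda>w. c * f w) has_derivative (\<lambda>h. \<Sum>m\<in>UNIV. h $ m * (c * pd f m w))) (at w)"
    by (rule has_derivative_eq_rhs[OF has_derivative_mult_right[OF holo_has_derivative[OF assms(1)]]])
       (simp add: algebra_simps sum_distrib_left fun_eq_iff)
  from holoI[OF this] show "holo (\<lambda>w. c * f w) w" "pd (\<lambda>w. c * f w) m w = c * pd f m w"
    by auto
qed

lemma holo_bar:
  assumes "holo f (cnjv w)"
  shows "holo (\<lambda>w. cnj (f (cnjv w))) w" "pd (\<lambda>w. cnj (f (cnjv w))) m w = cnj (pd f m (cnjv w))"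
proof -
  have "((\<lambda>w. cnj (f (cnjv w))) has_derivative (\<lambda>h. cnj (\<Sum>m\<in>UNIV. cnjv h $ m * pd f m (cnjv w)))) (at w)"
    by (rule bounded_linear.has_derivative[OF bounded_linear_cnj])
       (rule has_derivative_compose[OF bounded_linear_imp_has_derivative[OF bounded_linear_cnjv]
          holo_has_derivative[OF assms]])
  then have "((\<lambda>w. cnj (f (cnjv w))) has_derivative (\<lambda>h. \<Sum>m\<in>UNIV. h $ m * cnj (pd f m (cnjv w)))) (at w)"
    by simp
  from holoI[OF this] show "holo (\<lambda>w. cnj (f (cnjv w))) w"
    "pd (\<lambda>w. cnj (f (cnjv w))) m w = cnj (pd f m (cnjv w))" by auto
qed

lemma holo_cong:
  assumes "open S" "w \<in> S" "\<And>v. v \<in> S \<Longrightarrow> f v = g v" "holo f w"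
  shows "holo g w" "pd g m w = pd f m w"
proof -
  have "(g has_derivative (\<lambda>h. \<Sum>m\<in>UNIV. h $ m * pd f m w)) (at w)"
    by (rule has_derivative_transform_within_open[OF holo_has_derivative[OF assms(4)] assms(1,2)])
       (use assms in auto)
  from holoI[OF this] show "holo g w" "pd g m w = pd f m w" by auto
qed

lemma holo_chain:
  assumes f: "holo f (\<chi> l. w l t)" and w: "\<And>l. (w l has_field_derivative w' l) (at t)"
  shows "((\<lambda>t. f (\<chi> l. w l t)) has_field_derivative (\<Sum>m\<in>UNIV. w' m * pd f m (\<chi> l. w l t))) (at t)"
proof -
  have "((\<lambda>t. \<chi> l. w l t) has_derivative (\<lambda>h. \<chi> l. w' l * h)) (at t)"
    by (rule has_derivative_vecI) (use w in \<open>simp add: has_field_derivative_def\<close>)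
  from has_derivative_compose[OF this holo_has_derivative[OF f]]
  show ?thesis
    unfolding has_field_derivative_def
    by (rule has_derivative_eq_rhs) (simp add: fun_eq_iff sum_distrib_left mult_ac)
qed

lemma holo_line:
  assumes "holo f (x + t *s h)"
  shows "((\<lambda>t. f (x + t *s h)) has_field_derivative (\<Sum>m\<in>UNIV. h $ m * pd f m (x + t *s h))) (at t)"
proof -
  have e: "x + t *s h = (\<chi> l. x $ l + t * h $ l)" for t by (simp add: vec_eq_iff)
  show ?thesis
    using assms unfolding e by (intro holo_chain) (auto intro!: derivative_eq_intros)
qed

text \<open>A constant directional derivative integrates along the complex line: subtracting the linear part
  leaves a function of one complex variable with derivative zero on a convex set.\<close>

lemma shift_along_line:
  assumes N: "convex N" "x \<in> N" "x + t *s h \<in> N"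
    and f: "\<And>v. v \<in> N \<Longrightarrow> holo f v"
    and c: "\<And>\<tau>. x + \<tau> *s h \<in> N \<Longrightarrow> (\<Sum>m\<in>UNIV. h $ m * pd f m (x + \<tau> *s h)) = c"
  shows "f (x + t *s h) = f x + t * c"
proof -
  let ?T = "{\<tau>. x + \<tau> *s h \<in> N}"
  have "convex ?T"
  proof (rule convexI)
    fix a b :: complex and u v :: real
    assume *: "a \<in> ?T" "b \<in> ?T" "0 \<le> u" "0 \<le> v" "u + v = 1"
    have "u *\<^sub>R (x + a *s h) + v *\<^sub>R (x + b *s h) \<in> N"
      using * N(1) by (auto intro: convexD)
    moreover have "u *\<^sub>R (x + a *s h) + v *\<^sub>R (x + b *s h) = x + (u *\<^sub>R a + v *\<^sub>R b) *s h"
    proof -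
      have "u *\<^sub>R x $ i + v *\<^sub>R x $ i = x $ i" for i
        using *(5) by (simp flip: scaleR_left_distrib)
      then show ?thesis by (simp add: vec_eq_iff algebra_simps scaleR_right_distrib)
    qed
    ultimately show "u *\<^sub>R a + v *\<^sub>R b \<in> ?T" by simp
  qed
  then have "\<exists>k. \<forall>\<tau>\<in>?T. f (x + \<tau> *s h) - \<tau> * c = k"
  proof (rule has_field_derivative_zero_constant)
    fix \<tau> assume that: "\<tau> \<in> ?T"
    have "((\<lambda>\<tau>. f (x + \<tau> *s h) - \<tau> * c) has_field_derivative
        (\<Sum>m\<in>UNIV. h $ m * pd f m (x + \<tau> *s h)) - 1 * c) (at \<tau>)"
      by (rule DERIV_diff[OF holo_line[of f x \<tau> h, OF f] DERIV_cmult_right[OF DERIV_ident]])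
        (use that in simp)
    then have D: "((\<lambda>\<tau>. f (x + \<tau> *s h) - \<tau> * c) has_field_derivative
        (\<Sum>m\<in>UNIV. h $ m * pd f m (x + \<tau> *s h)) - 1 * c) (at \<tau> within ?T)"
      by (rule has_field_derivative_at_within)
    have *: "(\<Sum>m\<in>UNIV. h $ m * pd f m (x + \<tau> *s h)) - 1 * c = 0"
      using c[of \<tau>] that by (simp only: mem_Collect_eq mult_1_left diff_self)
    show "((\<lambda>\<tau>. f (x + \<tau> *s h) - \<tau> * c) has_field_derivative 0) (at \<tau> within ?T)"
      using D unfolding * .
  qed
  then obtain k where k: "\<forall>\<tau>\<in>?T. f (x + \<tau> *s h) - \<tau> * c = k" ..
  have "f (x + 0 *s h) - 0 * c = k" "f (x + t *s h) - t * c = k"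
    by (rule bspec[OF k]; use N in simp)+
  then show ?thesis by (simp add: algebra_simps)
qed

lemma eventually_line_in:
  assumes "open N" "w \<in> N"
  shows "eventually (\<lambda>t::complex. w + t *s h \<in> N) (nhds 0)"
proof -
  have "((\<lambda>t. w + t *s h) \<longlongrightarrow> w) (nhds 0)"
  proof (rule vec_tendstoI)
    fix i
    have "((\<lambda>t. w $ i + t * h $ i) \<longlongrightarrow> w $ i + 0 * h $ i) (nhds (0::complex))"
      by (intro tendsto_add tendsto_mult tendsto_const filterlim_ident)
    then show "((\<lambda>t. (w + t *s h) $ i) \<longlongrightarrow> w $ i) (nhds 0)" by simp
  qed
  then show ?thesis using assms by (rule topological_tendstoD)
qed

text \<open>Independence of the coordinate \<open>u\<close> is phrased by translations and not by a vanishing derivative, since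
  it will be asserted of derivatives, whose own differentiability is not known.\<close>

definition indep_of :: "(complex ^ 8) set \<Rightarrow> 8 \<Rightarrow> (complex ^ 8 \<Rightarrow> complex) \<Rightarrow> bool" where
  "indep_of N u g \<longleftrightarrow> (\<forall>w\<in>N. \<forall>t. w + t *s axis u 1 \<in> N \<longrightarrow> g (w + t *s axis u 1) = g w)"

lemma indep_of_const [simp]: "indep_of N u (\<lambda>_. c)"
  by (simp add: indep_of_def)

lemma indep_of_pd_zero:
  assumes "convex N" "\<And>v. v \<in> N \<Longrightarrow> holo f v" "\<And>v. v \<in> N \<Longrightarrow> pd f u v = 0"
  shows "indep_of N u f"
  unfolding indep_of_def
proof (intro ballI allI impI)
  fix w t assume "w \<in> N" "w + t *s axis u 1 \<in> N"
  from shift_along_line[OF assms(1) this assms(2), of 0] assms(3)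
  show "f (w + t *s axis u 1) = f w" by simp
qed

lemma pd_zero_of_indep:
  assumes "open N" "w \<in> N" "holo f w" "indep_of N u f"
  shows "pd f u w = 0"
proof -
  have "((\<lambda>t. f (w + t *s axis u 1)) has_field_derivative pd f u w) (at 0)"
    using holo_line[of f w 0 "axis u 1"] assms(3) by simp
  moreover have "((\<lambda>t. f (w + t *s axis u 1)) has_field_derivative 0) (at 0)"
  proof -
    have "eventually (\<lambda>t. w + t *s axis u 1 \<in> N) (nhds 0)"
      by (rule eventually_line_in) (use assms in auto)
    then have ev: "eventually (\<lambda>t. f (w + t *s axis u 1) = f w) (nhds 0)"
      by eventually_elim (use assms(2,4) in \<open>auto simp: indep_of_def\<close>)
    have "((\<lambda>t::complex. f w) has_field_derivative 0) (at 0)" by simp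
    with DERIV_cong_ev[OF refl ev refl] show ?thesis by blast
  qed
  ultimately show ?thesis by (rule DERIV_unique)
qed


text \<open>Equality of mixed derivatives by difference quotients: the increment \<open>f(x + t e\<^sub>u) - f(x) = t g(x)\<close> is
  constant when \<open>x\<close> moves in direction \<open>v\<close>, hence \<open>\<partial>\<^sub>v f\<close> takes the same value at \<open>x\<close> and at \<open>x + t e\<^sub>u\<close>.\<close>

lemma indep_of_pd:
  assumes N: "open N" "convex N" and f: "\<And>x. x \<in> N \<Longrightarrow> holo f x"
    and g: "\<And>x. x \<in> N \<Longrightarrow> pd f u x = g x" "indep_of N u g" "indep_of N v g"
  shows "indep_of N u (pd f v)"
  unfolding indep_of_def
proof (intro ballI allI impI)
  fix w t assume w: "w \<in> N" "w + t *s axis u 1 \<in> N"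
  let ?w' = "w + t *s axis u 1"
  have ev: "eventually (\<lambda>\<tau>. f (?w' + \<tau> *s axis v 1) - f (w + \<tau> *s axis v 1) = t * g w) (nhds 0)"
    using eventually_line_in[OF N(1) w(1), of "axis v 1"] eventually_line_in[OF N(1) w(2), of "axis v 1"]
  proof eventually_elim
    fix \<tau>
    let ?x = "w + \<tau> *s axis v 1"
    assume x: "?x \<in> N" "?w' + \<tau> *s axis v 1 \<in> N"
    have c: "?w' + \<tau> *s axis v 1 = ?x + t *s axis u 1" by (simp add: algebra_simps)
    have "f (?x + t *s axis u 1) = f ?x + t * g w"
    proof (rule shift_along_line[OF N(2) x(1) _ f])
      show "?x + t *s axis u 1 \<in> N" using x(2) unfolding c .
      fix \<sigma> assume "?x + \<sigma> *s axis u 1 \<in> N"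
      then have "pd f u (?x + \<sigma> *s axis u 1) = g ?x" using g x(1) by (simp add: indep_of_def)
      also have "\<dots> = g w" using g(3) w(1) x(1) by (simp add: indep_of_def)
      finally show "(\<Sum>m\<in>UNIV. axis u 1 $ m * pd f m (?x + \<sigma> *s axis u 1)) = g w" by simp
    qed
    then show "f (?w' + \<tau> *s axis v 1) - f ?x = t * g w" unfolding c by simp
  qed
  have "((\<lambda>\<tau>. f (?w' + \<tau> *s axis v 1) - f (w + \<tau> *s axis v 1)) has_field_derivative
      (pd f v ?w' - pd f v w)) (at 0)"
    using DERIV_diff[OF holo_line[of f ?w' 0 "axis v 1"] holo_line[of f w 0 "axis v 1"]] f w by simp
  with DERIV_cong_ev[OF refl ev refl]
  have "((\<lambda>\<tau>::complex. t * g w) has_field_derivative (pd f v ?w' - pd f v w)) (at 0)" by blast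
  moreover have "((\<lambda>\<tau>::complex. t * g w) has_field_derivative 0) (at 0)" by simp
  ultimately have "pd f v ?w' - pd f v w = 0" by (rule DERIV_unique)
  then show "pd f v ?w' = pd f v w" by simp
qed

text \<open>Integration along the segment from \<open>x\<close> to \<open>x + h\<close>, on which each of the derivatives \<open>g m\<close> is constant.\<close>

lemma shift_affine:
  assumes N: "convex N" "x \<in> N" "x + h \<in> N"
    and f: "\<And>v. v \<in> N \<Longrightarrow> holo f v"
    and D: "\<And>m. m \<notin> D \<Longrightarrow> h $ m = 0"
    and g: "\<And>m v. m \<in> D \<Longrightarrow> v \<in> N \<Longrightarrow> pd f m v = g m v"
    and g': "\<And>m v. m \<in> D \<Longrightarrow> v \<in> N \<Longrightarrow> holo (g m) v"
    and dg: "\<And>m k v. m \<in> D \<Longrightarrow> k \<in> D \<Longrightarrow> v \<in> N \<Longrightarrow> pd (g m) k v = 0"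
  shows "f (x + h) = f x + (\<Sum>m\<in>UNIV. h $ m * g m x)"
proof -
  have gc: "g m (x + \<tau> *s h) = g m x" if "m \<in> D" "x + \<tau> *s h \<in> N" for m \<tau>
  proof -
    have "g m (x + \<tau> *s h) = g m x + \<tau> * 0"
    proof (rule shift_along_line[OF N(1,2) that(2) g'[OF that(1)]])
      fix \<sigma> assume *: "x + \<sigma> *s h \<in> N"
      show "(\<Sum>k\<in>UNIV. h $ k * pd (g m) k (x + \<sigma> *s h)) = 0"
      proof (rule sum.neutral, rule ballI)
        fix k show "h $ k * pd (g m) k (x + \<sigma> *s h) = 0"
          using D[of k] dg[OF that(1) _ *, of k] by (cases "k \<in> D") simp_all
      qed
    qed
    then show ?thesis by simp
  qed
  have "f (x + 1 *s h) = f x + 1 * (\<Sum>m\<in>UNIV. h $ m * g m x)"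
  proof (rule shift_along_line[OF N(1,2) _ f])
    show "x + 1 *s h \<in> N" using N(3) by simp
    fix \<sigma> assume *: "x + \<sigma> *s h \<in> N"
    show "(\<Sum>m\<in>UNIV. h $ m * pd f m (x + \<sigma> *s h)) = (\<Sum>m\<in>UNIV. h $ m * g m x)"
    proof (rule sum.cong[OF refl])
      fix m show "h $ m * pd f m (x + \<sigma> *s h) = h $ m * g m x"
        using D[of m] g[OF _ *, of m] gc[OF _ *, of m] by (cases "m \<in> D") simp_all
    qed
  qed
  then show ?thesis by simp
qed

section \<open>Second order expansions in one complex variable\<close>

text \<open>\<open>F(s) = a + b s + c s\<^sup>2 + o(s\<^sup>2)\<close> as \<open>s\<close> tends to 0.\<close>

definition jet2 :: "(complex \<Rightarrow> complex) \<Rightarrow> complex \<Rightarrow> complex \<Rightarrow> complex \<Rightarrow> bool" where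
  "jet2 F a b c \<longleftrightarrow> ((\<lambda>s. (F s - a - b * s) / s\<^sup>2) \<longlongrightarrow> c) (at 0)"

lemma eventually_nz: "eventually (\<lambda>s::complex. s \<noteq> 0) (at 0)"
  by (simp add: eventually_at_filter)

lemma jet2_transform:
  assumes "((\<lambda>s. R s) \<longlongrightarrow> c) (at 0)" "\<And>s. s \<noteq> 0 \<Longrightarrow> R s = (F s - a - b * s) / s\<^sup>2"
  shows "jet2 F a b c"
  unfolding jet2_def
  by (rule Lim_transform_eventually[OF assms(1)])
     (use eventually_nz in \<open>eventually_elim; simp add: assms(2)\<close>)

lemma jet2_const: "jet2 (\<lambda>_. k) k 0 0"
  by (simp add: jet2_def)

lemma jet2_poly:
  "jet2 (\<lambda>s. s * p + s\<^sup>2 * q + s ^ 3 * r) 0 p q"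
  "jet2 (\<lambda>s. p + 2 * s * q + 3 * s\<^sup>2 * r) p (2 * q) (3 * r)"
  "jet2 (\<lambda>s. s) 0 1 0"
proof -
  have "((\<lambda>s. q + s * r) \<longlongrightarrow> q + 0 * r) (at 0)" by (intro tendsto_intros)
  then show "jet2 (\<lambda>s. s * p + s\<^sup>2 * q + s ^ 3 * r) 0 p q"
    by (intro jet2_transform[of "\<lambda>s. q + s * r"]) (auto simp: field_simps power2_eq_square power3_eq_cube)
  show "jet2 (\<lambda>s. p + 2 * s * q + 3 * s\<^sup>2 * r) p (2 * q) (3 * r)"
    by (intro jet2_transform[of "\<lambda>s. 3 * r"]) (auto simp: field_simps power2_eq_square)
  show "jet2 (\<lambda>s. s) 0 1 0" by (simp add: jet2_def)
qed

lemma jet2_add: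
  assumes "jet2 F a b c" "jet2 G a' b' c'"
  shows "jet2 (\<lambda>s. F s + G s) (a + a') (b + b') (c + c')"
  by (rule jet2_transform[OF tendsto_add[OF assms[unfolded jet2_def]]])
     (simp add: algebra_simps flip: add_divide_distrib)

lemma jet2_mult:
  assumes "jet2 F a b c" "jet2 G a' b' c'"
  shows "jet2 (\<lambda>s. F s * G s) (a * a') (a * b' + b * a') (a * c' + b * b' + c * a')"
proof -
  define R where "R s = (F s - a - b * s) / s\<^sup>2" for s
  define R' where "R' s = (G s - a' - b' * s) / s\<^sup>2" for s
  have R: "(R \<longlongrightarrow> c) (at 0)" "(R' \<longlongrightarrow> c') (at 0)"
    using assms by (simp_all add: jet2_def R_def[abs_def] R'_def[abs_def])
  have F: "F s = a + b * s + s\<^sup>2 * R s" "G s = a' + b' * s + s\<^sup>2 * R' s" if "s \<noteq> 0" for s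
    using that by (simp_all add: R_def R'_def)
  have "((\<lambda>s. a * R' s + b * b' + R s * a' + s * (b * R' s + R s * b') + s\<^sup>2 * R s * R' s) \<longlongrightarrow>
      a * c' + b * b' + c * a' + 0 * (b * c' + c * b') + 0\<^sup>2 * c * c') (at 0)"
    by (intro tendsto_intros R)
  then have L: "((\<lambda>s. a * R' s + b * b' + R s * a' + s * (b * R' s + R s * b') + s\<^sup>2 * R s * R' s) \<longlongrightarrow>
      a * c' + b * b' + c * a') (at 0)" by simp
  show ?thesis
  proof (rule jet2_transform[OF L])
    fix s :: complex assume s: "s \<noteq> 0"
    have "F s * G s - a * a' - (a * b' + b * a') * s =
      s\<^sup>2 * (a * R' s + b * b' + R s * a' + s * (b * R' s + R s * b') + s\<^sup>2 * R s * R' s)"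
      unfolding F[OF s] by (simp add: algebra_simps power2_eq_square)
    then show "a * R' s + b * b' + R s * a' + s * (b * R' s + R s * b') + s\<^sup>2 * R s * R' s =
        (F s * G s - a * a' - (a * b' + b * a') * s) / s\<^sup>2"
      using s by simp
  qed
qed

lemma jet2_cmult: "jet2 F a b c \<Longrightarrow> jet2 (\<lambda>s. k * F s) (k * a) (k * b) (k * c)"
  using jet2_mult[OF jet2_const[of k], of F a b c] by simp

lemma jet2_diff:
  assumes "jet2 F a b c" "jet2 G a' b' c'"
  shows "jet2 (\<lambda>s. F s - G s) (a - a') (b - b') (c - c')"
  using jet2_add[OF assms(1) jet2_cmult[OF assms(2), of "- 1"]] by simp

lemma jet2_sum:
  assumes "finite I" "\<And>i. i \<in> I \<Longrightarrow> jet2 (F i) (a i) (b i) (c i)"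
  shows "jet2 (\<lambda>s. \<Sum>i\<in>I. F i s) (\<Sum>i\<in>I. a i) (\<Sum>i\<in>I. b i) (\<Sum>i\<in>I. c i)"
  using assms by (induction I) (auto intro: jet2_add jet2_const)

lemma jet2_cong:
  assumes "eventually (\<lambda>s. F s = G s) (at 0)" "jet2 F a b c"
  shows "jet2 G a b c"
  unfolding jet2_def
  by (rule Lim_transform_eventually[OF assms(2)[unfolded jet2_def]])
     (use assms(1) in \<open>eventually_elim; simp\<close>)

lemma jet2_zero:
  assumes "jet2 (\<lambda>_. 0) a b c"
  shows "a = 0" "b = 0" "c = 0"
proof -
  define R where "R s = (0 - a - b * s) / s\<^sup>2" for s
  have R: "(R \<longlongrightarrow> c) (at 0)" using assms by (simp add: jet2_def R_def[abs_def])
  have "((\<lambda>s. - b * s - s\<^sup>2 * R s) \<longlongrightarrow> - b * 0 - 0\<^sup>2 * c) (at 0)" by (intro tendsto_intros R)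
  moreover have "eventually (\<lambda>s. - b * s - s\<^sup>2 * R s = a) (at 0)"
    using eventually_nz by eventually_elim (simp add: R_def)
  ultimately have "((\<lambda>s. a) \<longlongrightarrow> 0) (at (0::complex))"
    using Lim_transform_eventually by fastforce
  then show a: "a = 0" by (simp add: tendsto_const_iff)
  have "((\<lambda>s. - s * R s) \<longlongrightarrow> - 0 * c) (at 0)" by (intro tendsto_intros R)
  moreover have "eventually (\<lambda>s. - s * R s = b) (at 0)"
    using eventually_nz by eventually_elim (simp add: R_def a power2_eq_square)
  ultimately have "((\<lambda>s. b) \<longlongrightarrow> 0) (at (0::complex))"
    using Lim_transform_eventually by fastforce
  then show b: "b = 0" by (simp add: tendsto_const_iff)
  have "R = (\<lambda>s. 0)" by (simp add: R_def[abs_def] a b)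
  then show "c = 0" using R by (simp add: tendsto_const_iff)
qed

lemma jet2_unique:
  assumes "eventually (\<lambda>s. F s = G s) (at 0)" "jet2 F a b c" "jet2 G a' b' c'"
  shows "a = a'" "b = b'" "c = c'"
proof -
  have "jet2 (\<lambda>_. 0) (a - a') (b - b') (c - c')"
    by (rule jet2_cong[OF _ jet2_diff[OF assms(2,3)]]) (use assms(1) in \<open>eventually_elim; simp\<close>)
  from jet2_zero[OF this] show "a = a'" "b = b'" "c = c'" by simp_all
qed

text \<open>A displacement of order \<open>s\<^sup>2\<close> is seen in the second coefficient through the first derivative of \<open>f\<close>
  alone, so a single complex derivative of \<open>f\<close> at one point is enough.\<close>

lemma jet2_quadratic_shift:
  fixes k :: "complex \<Rightarrow> complex ^ 8"
  assumes f: "holo f w" and k: "(k \<longlongrightarrow> k0) (at 0)"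
  shows "jet2 (\<lambda>s. f (w + s\<^sup>2 *s k s)) (f w) 0 (\<Sum>m\<in>UNIV. k0 $ m * pd f m w)"
proof -
  define L where "L h = (\<Sum>m\<in>UNIV. h $ m * pd f m w)" for h
  have L: "(f has_derivative L) (at w)" using holo_has_derivative[OF f] by (simp add: L_def[abs_def])
  have Lk: "((\<lambda>s. L (k s)) \<longlongrightarrow> L k0) (at 0)"
    unfolding L_def by (intro tendsto_intros k)
  have "((\<lambda>s. (f (w + s\<^sup>2 *s k s) - f w) / s\<^sup>2 - L (k s)) \<longlongrightarrow> 0) (at 0)"
  proof (rule tendstoI)
    fix e :: real assume e: "e > 0"
    define K where "K = norm k0 + 1"
    have K: "K > 0" by (simp add: K_def add_nonneg_pos)
    have kK: "eventually (\<lambda>s. norm (k s) < K) (at 0)"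
      using order_tendstoD(2)[OF tendsto_norm[OF k], of K] by (simp add: K_def)
    have norm_smult: "norm (c *s v) = norm c * norm v" for c :: complex and v :: "complex ^ 8"
      by (simp add: norm_vec_def norm_mult L2_set_left_distrib[symmetric] L2_set_right_distrib)
    obtain d where d: "d > 0" "\<And>y. norm (y - w) < d \<Longrightarrow> norm (f y - f w - L (y - w)) \<le> e / (2 * K) * norm (y - w)"
      using L e K unfolding has_derivative_at_alt by (metis divide_pos_pos mult_pos_pos zero_less_numeral)
    have "((\<lambda>s::complex. norm (s\<^sup>2) * K) \<longlongrightarrow> norm ((0::complex)\<^sup>2) * K) (at 0)" by (intro tendsto_intros)
    then have sd: "eventually (\<lambda>s::complex. norm (s\<^sup>2) * K < d) (at 0)"
      using d(1) by (auto dest: order_tendstoD(2))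
    show "eventually (\<lambda>s. dist ((f (w + s\<^sup>2 *s k s) - f w) / s\<^sup>2 - L (k s)) 0 < e) (at 0)"
      using kK sd eventually_nz
    proof eventually_elim
      fix s :: complex assume s: "norm (k s) < K" "norm (s\<^sup>2) * K < d" "s \<noteq> 0"
      have n: "norm (s\<^sup>2 *s k s) \<le> norm (s\<^sup>2) * K"
        unfolding norm_smult using s(1) by (intro mult_left_mono) auto
      have "L (s\<^sup>2 *s k s) = s\<^sup>2 * L (k s)" by (simp add: L_def sum_distrib_left mult.assoc)
      then have "(f (w + s\<^sup>2 *s k s) - f w) / s\<^sup>2 - L (k s) = (f (w + s\<^sup>2 *s k s) - f w - L (s\<^sup>2 *s k s)) / s\<^sup>2"
        using s(3) by (simp add: diff_divide_distrib)
      also have "norm \<dots> \<le> (e / (2 * K) * norm (s\<^sup>2 *s k s)) / norm (s\<^sup>2)"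
        unfolding norm_divide using d(2)[of "w + s\<^sup>2 *s k s"] n s(2) by (intro divide_right_mono) auto
      also have "\<dots> \<le> (e / (2 * K) * (norm (s\<^sup>2) * K)) / norm (s\<^sup>2)"
        using n e K by (intro divide_right_mono mult_left_mono) auto
      also have "\<dots> = e / 2" using s(3) K by simp
      finally show "dist ((f (w + s\<^sup>2 *s k s) - f w) / s\<^sup>2 - L (k s)) 0 < e" using e by simp
    qed
  qed
  from tendsto_add[OF this Lk]
  have "((\<lambda>s. (f (w + s\<^sup>2 *s k s) - f w) / s\<^sup>2) \<longlongrightarrow> L k0) (at 0)" by simp
  then show ?thesis by (simp add: jet2_def L_def)
qed

section \<open>Coefficients of a field satisfying the complexified equation\<close>

lemma holo_slice:
  assumes "complex_differentiable_at f (z, w)"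
  shows "holo (\<lambda>w. f (z, w)) w"
proof -
  obtain L where L: "(f has_derivative L) (at (z, w))" "\<And>c v. L (cscale c v) = c * L v"
    using assms unfolding complex_differentiable_at_def by blast
  have "((\<lambda>w. (z, w)) has_derivative (\<lambda>h. (0, h))) (at w)"
    by (intro has_derivative_Pair has_derivative_const has_derivative_ident)
  from has_derivative_compose[OF this L(1)]
  have "((\<lambda>w. f (z, w)) has_derivative (\<lambda>h. L (0, h))) (at w)" .
  moreover have "L (0, c *s v) = c * L (0, v)" for c v
    using L(2)[of c "(0, v)"] by (simp add: cscale_def)
  ultimately show ?thesis unfolding holo_def by blast
qed

text \<open>Coefficient comparison; degree five is the largest that occurs below.\<close>

lemma quintic_coeffs_zero:
  fixes c0 c1 c2 c3 c4 c5 :: complex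
  assumes "\<delta> > 0" "\<And>z. norm z < \<delta> \<Longrightarrow> c0 + c1 * z + c2 * z^2 + c3 * z^3 + c4 * z^4 + c5 * z^5 = 0"
  shows "c0 = 0" "c1 = 0" "c2 = 0" "c3 = 0" "c4 = 0" "c5 = 0"
proof -
  define c where "c = (\<lambda>i. [c0, c1, c2, c3, c4, c5] ! i)"
  have "ball 0 \<delta> \<subseteq> {z. (\<Sum>i\<le>5. c i * z ^ i) = 0}"
    using assms(2) by (auto simp: c_def numeral_eq_Suc)
  moreover have "infinite (ball (0::complex) \<delta>)"
    using assms(1) by (simp add: uncountable_infinite uncountable_ball)
  ultimately have "infinite {z. (\<Sum>i\<le>5. c i * z ^ i) = 0}" using infinite_super by blast
  then have "\<forall>i\<le>5. c i = 0" using polyfun_finite_roots[of c 5] by auto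
  then have "c 0 = 0" "c 1 = 0" "c 2 = 0" "c 3 = 0" "c 4 = 0" "c 5 = 0" by auto
  then show "c0 = 0" "c1 = 0" "c2 = 0" "c3 = 0" "c4 = 0" "c5 = 0"
    by (simp_all add: c_def numeral_eq_Suc)
qed

lemma indep_of_cong:
  assumes "\<And>w. w \<in> N \<Longrightarrow> f w = c * g w" "c \<noteq> 0" "indep_of N u f"
  shows "indep_of N u g"
  using assms unfolding indep_of_def by fastforce

lemma indep_of_cmult:
  assumes "\<And>w. w \<in> N \<Longrightarrow> f w = c * g w" "indep_of N u g"
  shows "indep_of N u f"
  using assms unfolding indep_of_def by fastforce

lemma indep_of_add_sub:
  assumes "indep_of N u (\<lambda>w. F w + G w)" "indep_of N u (\<lambda>w. F w - G w)"
  shows "indep_of N u F" "indep_of N u G"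
proof -
  have *: "F x = F y \<and> G x = G y" if "F x + G x = F y + G y" "F x - G x = F y - G y" for x y
  proof -
    have "2 * F x = 2 * F y" "2 * G x = 2 * G y"
      using arg_cong2[OF that, of "(+)"] arg_cong2[OF that, of "(-)"] by (simp_all add: algebra_simps)
    then show ?thesis by simp
  qed
  show "indep_of N u F" "indep_of N u G"
    using assms * unfolding indep_of_def by blast+
qed

lemma P_at_0:
  "P z 0 = 0" "Pz z 0 $ l = 0" "Ps z 0 $ l = p1 z $ l" "p1 0 $ l = 0"
proof -
  show "P z 0 = 0" "Pz z 0 $ l = 0" "Ps z 0 $ l = p1 z $ l"
    by (simp_all add: P_def Pz_def Ps_def vec_eq_iff)
  have "\<forall>l. p1 0 $ l = 0" by (simp add: forall_8 p_defs vector_8)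
  then show "p1 0 $ l = 0" ..
qed

lemma cnj_p1: "cnj (p1 (cnj s) $ l) = Pz 0 s $ l"
proof -
  have "\<forall>l. cnj (p1 (cnj s) $ l) = Pz 0 s $ l"
    unfolding forall_8 by (simp add: Pz_def p_defs vector_8)
  then show ?thesis ..
qed

text \<open>What the coefficient comparison needs to know of the field: the conclusion of \<open>complexified_tangency\<close>.\<close>

locale cr_field =
  fixes Z :: "pt \<Rightarrow> complex" and W :: "8 \<Rightarrow> pt \<Rightarrow> complex" and \<delta> :: real
  assumes \<delta>: "\<delta> > 0"
    and dZ: "norm z < \<delta> \<Longrightarrow> norm w < \<delta> \<Longrightarrow> complex_differentiable_at Z (z, w)"
    and dW: "norm z < \<delta> \<Longrightarrow> norm w < \<delta> \<Longrightarrow> complex_differentiable_at (W l) (z, w)"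
    and segre_identity: "norm z < \<delta> \<Longrightarrow> norm s < \<delta> \<Longrightarrow> norm w < \<delta> \<Longrightarrow>
       W l (z, w) - bar (W l) (s, w - (2 * \<i>) *s P z s) =
       2 * \<i> * (Pz z s $ l * Z (z, w) + Ps z s $ l * bar Z (s, w - (2 * \<i>) *s P z s))"
begin

text \<open>\<open>Z1b\<close> is the \<open>s\<close>-derivative of the conjugated \<open>Z\<close>. The value of \<open>Z1\<close> is chosen as the coefficient
  of \<open>z\<close> that the first component of \<open>order1\<close> prescribes for \<open>Z\<close>; only later does it turn out that
  \<open>Z = B + z Z1\<close> and that \<open>Z1b\<close> is the conjugate \<open>Zb\<close> of \<open>Z1\<close>.\<close>

definition "N = ball (0 :: complex ^ 8) \<delta>"
definition "A l w = W l (0, w)" for l w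
definition "B w = Z (0, w)" for w
definition "Bb w = cnj (B (cnjv w))" for w
definition "D l m w = pd (A l) m w" for l m w
definition "Z1b w = deriv (\<lambda>s. bar Z (s, w)) 0" for w
definition "Z1 w = D 1 1 w - Z1b w" for w
definition "Zb w = cnj (Z1 (cnjv w))" for w

lemma N: "open N" "convex N" "w \<in> N \<longleftrightarrow> norm w < \<delta>" "cnjv w \<in> N \<longleftrightarrow> w \<in> N" "0 \<in> N"
  using \<delta> by (auto simp: N_def)

lemma bar_0: "bar Z (0, w) = Bb w"
  by (simp add: bar_def cnjp_def Bb_def B_def)

lemma holo_A: "w \<in> N \<Longrightarrow> holo (A l) w"
  unfolding A_def[abs_def] by (intro holo_slice dW) (auto simp: N \<delta>)

lemma holo_B: "w \<in> N \<Longrightarrow> holo B w"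
  unfolding B_def[abs_def] by (intro holo_slice dZ) (auto simp: N \<delta>)

lemma holo_Bb: "w \<in> N \<Longrightarrow> holo Bb w"
  unfolding Bb_def[abs_def] by (rule holo_bar, rule holo_B) (simp add: N)

text \<open>The complexified equation at \<open>z = s = 0\<close>.\<close>

lemma A_real: "w \<in> N \<Longrightarrow> cnj (A l (cnjv w)) = A l w"
  using segre_identity[of 0 0 w l] \<delta> by (simp add: P_at_0 bar_def cnjp_def A_def N)

text \<open>The complexified equation at \<open>s = 0\<close>, where \<open>P\<close> and \<open>P\<^sub>z\<close> vanish: the dependence of \<open>W\<close> on \<open>z\<close> is
  explicit, and the unknowns are reduced to \<open>Z\<close> and functions of \<open>w\<close> alone.\<close>

lemma W_eq:
  assumes "norm z < \<delta>" "w \<in> N"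
  shows "W l (z, w) = A l w + 2 * \<i> * p1 z $ l * Bb w"
proof -
  have "bar (W l) (0, w) = A l w" using A_real[OF assms(2)] by (simp add: bar_def cnjp_def A_def)
  then show ?thesis
    using segre_identity[of z 0 w l] assms \<delta> by (simp add: P_at_0 bar_0 N algebra_simps)
qed

lemma bar_W_eq:
  assumes "norm s < \<delta>" "w \<in> N"
  shows "bar (W l) (s, w) = A l w - 2 * \<i> * Pz 0 s $ l * B w"
proof -
  have "bar (W l) (s, w) = cnj (W l (cnj s, cnjv w))" by (simp add: bar_def cnjp_def)
  also have "\<dots> = cnj (A l (cnjv w) + 2 * \<i> * p1 (cnj s) $ l * Bb (cnjv w))"
    using assms by (subst W_eq) (auto simp: N)
  also have "\<dots> = A l w - 2 * \<i> * Pz 0 s $ l * B w"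
    using assms(2) by (simp add: A_real cnj_p1 Bb_def)
  finally show ?thesis .
qed

lemma segre_identity_A:
  assumes "norm z < \<delta>" "norm s < \<delta>" "w \<in> N" "w - (2 * \<i>) *s P z s \<in> N"
  shows "A l w + 2 * \<i> * p1 z $ l * Bb w - (A l (w - (2 * \<i>) *s P z s) - 2 * \<i> * Pz 0 s $ l * B (w - (2 * \<i>) *s P z s)) =
     2 * \<i> * (Pz z s $ l * Z (z, w) + Ps z s $ l * bar Z (s, w - (2 * \<i>) *s P z s))"
  using segre_identity[of z s w l] assms by (simp add: W_eq bar_W_eq N)

lemma eventually_shift_in:
  assumes "w \<in> N"
  shows "eventually (\<lambda>s. norm s < \<delta> \<and> w - (2 * \<i>) *s P z s \<in> N) (nhds 0)"
proof (rule eventually_conj)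
  have "((\<lambda>s::complex. norm s) \<longlongrightarrow> norm (0::complex)) (nhds 0)" by (rule tendsto_norm[OF filterlim_ident])
  then show "eventually (\<lambda>s::complex. norm s < \<delta>) (nhds 0)"
    using \<delta> by (auto dest: order_tendstoD(2))
  have "((\<lambda>s. w - (2 * \<i>) *s P z s) \<longlongrightarrow> w) (nhds 0)"
  proof (rule vec_tendstoI)
    fix i
    have "((\<lambda>s. w $ i - (2 * \<i>) * (s * p1 z $ i + s^2 * p2 z $ i + s^3 * p3 z $ i)) \<longlongrightarrow>
        w $ i - (2 * \<i>) * (0 * p1 z $ i + 0^2 * p2 z $ i + 0^3 * p3 z $ i)) (nhds (0::complex))"
      by (intro tendsto_diff tendsto_add tendsto_mult tendsto_power tendsto_const filterlim_ident)
    then show "((\<lambda>s. (w - (2 * \<i>) *s P z s) $ i) \<longlongrightarrow> w $ i) (nhds 0)" by (simp add: P_def)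
  qed
  then show "eventually (\<lambda>s. w - (2 * \<i>) *s P z s \<in> N) (nhds 0)"
    using N(1) assms by (rule topological_tendstoD)
qed

lemma DERIV_bar_Z:
  assumes "w \<in> N" and \<omega>: "\<And>m. (\<omega> m has_field_derivative \<omega>' m) (at 0)" "\<And>m. \<omega> m 0 = w $ m"
  shows "((\<lambda>s. bar Z (s, \<chi> m. \<omega> m s)) has_field_derivative Z1b w + (\<Sum>m\<in>UNIV. \<omega>' m * pd Bb m w)) (at 0)"
proof -
  have w: "(\<chi> m. w $ m) = w" "(\<chi> m. \<omega> m 0) = w" by (simp_all add: vec_eq_iff \<omega>(2))
  have "complex_differentiable_at (bar Z) (0, w)"
    by (rule complex_differentiable_at_bar) (use assms(1) \<delta> in \<open>simp add: cnjp_def dZ N\<close>)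
  then obtain L where L: "(bar Z has_derivative L) (at (0, w))" "\<And>c v. L (cscale c v) = c * L v"
    unfolding complex_differentiable_at_def by blast
  have lin: "linear L" using L(1) has_derivative_linear by blast
  have 1: "((\<lambda>s. bar Z (s, \<chi> m. \<omega> m s)) has_field_derivative L (1, \<chi> m. \<omega>' m)) (at 0)"
    using complex_differentiable_at_chain[where z = "\<lambda>s. s" and t = 0 and w = \<omega>, OF _ L(2) DERIV_ident \<omega>(1)] L(1)
    by (simp add: w)
  have "((\<lambda>s. bar Z (s, \<chi> m. w $ m)) has_field_derivative L (1, \<chi> m. 0)) (at 0)"
    by (rule complex_differentiable_at_chain[where z = "\<lambda>s. s" and t = 0 and w = "\<lambda>m s. w $ m", OF _ L(2)])
       (use L(1) in \<open>simp_all add: w\<close>)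
  then have 2: "Z1b w = L (1, 0)"
    unfolding Z1b_def by (intro DERIV_imp_deriv) (simp add: w zero_vec_def)
  have "((\<lambda>w. (0::complex, w)) has_derivative (\<lambda>h. (0, h))) (at w)"
    by (intro has_derivative_Pair has_derivative_const has_derivative_ident)
  from has_derivative_compose[OF this L(1)]
  have "(Bb has_derivative (\<lambda>h. L (0, h))) (at w)" by (simp add: bar_0)
  from has_derivative_unique[OF this holo_has_derivative[OF holo_Bb[OF assms(1)]]]
  have 3: "L (0, h) = (\<Sum>m\<in>UNIV. h $ m * pd Bb m w)" for h by (rule fun_cong)
  have "L (1, \<chi> m. \<omega>' m) = L (1, 0) + L (0, \<chi> m. \<omega>' m)"
    using linear_add[OF lin, of "(1, 0)" "(0, \<chi> m. \<omega>' m)"] by simp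
  with 1 show ?thesis by (simp add: 2 3)
qed

section \<open>The coefficient of \<open>s\<close>\<close>

text \<open>The derivative of \<open>segre_identity_A\<close> in \<open>s\<close> at \<open>s = 0\<close>, divided by \<open>2 \<i>\<close>. The argument
  \<open>w - 2 \<i> P(z, s)\<close> starts with velocity \<open>- 2 \<i> p1(z)\<close>.\<close>

lemma order1:
  assumes "w \<in> N" "norm z < \<delta>"
  shows "(\<Sum>m\<in>UNIV. p1 z $ m * D l m w) + dp1 0 $ l * B w =
    dp1 z $ l * Z (z, w) + 2 * p2 z $ l * Bb w + p1 z $ l * (Z1b w - 2 * \<i> * (\<Sum>m\<in>UNIV. p1 z $ m * pd Bb m w))"
proof -
  define \<omega> where "\<omega> = (\<lambda>m s. w $ m - 2 * \<i> * P z s $ m)"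
  have \<omega>: "w - (2 * \<i>) *s P z s = (\<chi> m. \<omega> m s)" for s by (simp add: \<omega>_def vec_eq_iff)
  have P': "((\<lambda>s. P z s $ m) has_field_derivative p1 z $ m) (at 0)" for m
    unfolding P_def by (auto intro!: derivative_eq_intros)
  have \<omega>': "(\<omega> m has_field_derivative - 2 * \<i> * p1 z $ m) (at 0)" for m
    unfolding \<omega>_def by (rule derivative_eq_intros P' refl)+ simp
  have \<omega>0: "\<omega> m 0 = w $ m" for m by (simp add: \<omega>_def P_at_0)
  have w: "(\<chi> m. \<omega> m 0) = w" by (simp add: \<omega>0 vec_eq_iff)
  have 1: "((\<lambda>s. A l (\<chi> m. \<omega> m s)) has_field_derivative (\<Sum>m\<in>UNIV. (- 2 * \<i> * p1 z $ m) * D l m w)) (at 0)"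
    using holo_chain[where w = \<omega> and t = 0 and f = "A l", OF _ \<omega>'] holo_A[OF assms(1)] by (simp add: w D_def)
  have 2: "((\<lambda>s. B (\<chi> m. \<omega> m s)) has_field_derivative (\<Sum>m\<in>UNIV. (- 2 * \<i> * p1 z $ m) * pd B m w)) (at 0)"
    using holo_chain[where w = \<omega> and t = 0 and f = B, OF _ \<omega>'] holo_B[OF assms(1)] by (simp add: w)
  have 3: "((\<lambda>s. bar Z (s, \<chi> m. \<omega> m s)) has_field_derivative
      Z1b w + (\<Sum>m\<in>UNIV. (- 2 * \<i> * p1 z $ m) * pd Bb m w)) (at 0)"
    by (rule DERIV_bar_Z[OF assms(1) \<omega>' \<omega>0])
  have 4: "((\<lambda>s. Pz a s $ l) has_field_derivative dp1 a $ l) (at 0)" for a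
    unfolding Pz_def by (auto intro!: derivative_eq_intros)
  have 5: "((\<lambda>s. Ps z s $ l) has_field_derivative 2 * p2 z $ l) (at 0)"
    unfolding Ps_def by (auto intro!: derivative_eq_intros)
  have ev: "eventually (\<lambda>s. A l w + 2 * \<i> * p1 z $ l * Bb w - (A l (\<chi> m. \<omega> m s) - 2 * \<i> * (Pz 0 s $ l * B (\<chi> m. \<omega> m s))) =
     2 * \<i> * (Pz z s $ l * Z (z, w) + Ps z s $ l * bar Z (s, \<chi> m. \<omega> m s))) (nhds 0)"
    using eventually_shift_in[OF assms(1), of z]
    by eventually_elim (use segre_identity_A[OF assms(2) _ assms(1)] in \<open>simp add: \<omega> mult.assoc\<close>)
  have L: "((\<lambda>s. A l w + 2 * \<i> * p1 z $ l * Bb w - (A l (\<chi> m. \<omega> m s) - 2 * \<i> * (Pz 0 s $ l * B (\<chi> m. \<omega> m s))))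
     has_field_derivative 0 - ((\<Sum>m\<in>UNIV. (- 2 * \<i> * p1 z $ m) * D l m w) - 2 * \<i> *
       (dp1 0 $ l * B (\<chi> m. \<omega> m 0) + (\<Sum>m\<in>UNIV. (- 2 * \<i> * p1 z $ m) * pd B m w) * Pz 0 0 $ l))) (at 0)"
    by (intro DERIV_diff DERIV_const DERIV_cmult DERIV_mult 1 2 4)
  have R: "((\<lambda>s. 2 * \<i> * (Pz z s $ l * Z (z, w) + Ps z s $ l * bar Z (s, \<chi> m. \<omega> m s))) has_field_derivative
     2 * \<i> * (dp1 z $ l * Z (z, w) + (2 * p2 z $ l * bar Z (0, \<chi> m. \<omega> m 0)
       + (Z1b w + (\<Sum>m\<in>UNIV. (- 2 * \<i> * p1 z $ m) * pd Bb m w)) * Ps z 0 $ l))) (at 0)"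
    by (intro DERIV_add DERIV_cmult DERIV_cmult_right DERIV_mult 3 4 5)
  have "((\<lambda>s. 2 * \<i> * (Pz z s $ l * Z (z, w) + Ps z s $ l * bar Z (s, \<chi> m. \<omega> m s))) has_field_derivative
      0 - ((\<Sum>m\<in>UNIV. (- 2 * \<i> * p1 z $ m) * D l m w) - 2 * \<i> *
       (dp1 0 $ l * B (\<chi> m. \<omega> m 0) + (\<Sum>m\<in>UNIV. (- 2 * \<i> * p1 z $ m) * pd B m w) * Pz 0 0 $ l))) (at 0)"
    using L DERIV_cong_ev[OF refl ev refl] by blast
  from DERIV_unique[OF this R]
  have e: "- ((\<Sum>m\<in>UNIV. (- 2 * \<i> * p1 z $ m) * D l m w) - 2 * \<i> * (dp1 0 $ l * B w)) =
    2 * \<i> * (dp1 z $ l * Z (z, w) + (2 * p2 z $ l * Bb w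
       + (Z1b w + (\<Sum>m\<in>UNIV. (- 2 * \<i> * p1 z $ m) * pd Bb m w)) * p1 z $ l))"
    unfolding w by (simp add: P_at_0 bar_0)
  have pull: "(\<Sum>m\<in>UNIV. (- 2 * \<i> * p1 z $ m) * f m) = - 2 * \<i> * (\<Sum>m\<in>UNIV. p1 z $ m * f m)" for f
    by (simp add: sum_distrib_left mult.assoc)
  have "2 * \<i> * ((\<Sum>m\<in>UNIV. p1 z $ m * D l m w) + dp1 0 $ l * B w) =
    2 * \<i> * (dp1 z $ l * Z (z, w) + 2 * p2 z $ l * Bb w + p1 z $ l * (Z1b w - 2 * \<i> * (\<Sum>m\<in>UNIV. p1 z $ m * pd Bb m w)))"
    using e unfolding pull by (simp add: algebra_simps)
  then show ?thesis by simp
qed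

lemma D_bar: "w \<in> N \<Longrightarrow> D l m (cnjv w) = cnj (D l m w)"
proof -
  assume w: "w \<in> N"
  have h: "holo (\<lambda>w. cnj (A l (cnjv w))) (cnjv w)"
    by (rule holo_bar, rule holo_A) (simp add: w)
  have "pd (A l) m (cnjv w) = pd (\<lambda>w. cnj (A l (cnjv w))) m (cnjv w)"
    by (rule holo_cong(2)[OF N(1) _ _ h]) (use w A_real in \<open>auto simp: N(4)\<close>)
  also have "\<dots> = cnj (pd (A l) m (cnjv (cnjv w)))"
    by (rule holo_bar(2), rule holo_A) (simp add: w)
  finally show ?thesis by (simp add: D_def)
qed

text \<open>Since \<open>A\<close> is real, conjugating the value at \<open>cnjv w\<close> turns \<open>\<partial>\<^sub>m A - \<i> \<partial>\<^sub>n A\<close> into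
  \<open>\<partial>\<^sub>m A + \<i> \<partial>\<^sub>n A\<close> and exchanges \<open>B\<close> with \<open>Bb\<close> and \<open>Z1\<close> with \<open>Zb\<close>; half the sum and half the difference
  are the two derivatives.\<close>

lemma real_imag_split:
  assumes "\<And>w. w \<in> N \<Longrightarrow> D l m w - \<i> * D l n w = x * B w + y * Bb w + u * Z1 w + v * Zb w" "w \<in> N"
  shows "D l m w = ((x + cnj y) * B w + (y + cnj x) * Bb w + (u + cnj v) * Z1 w + (v + cnj u) * Zb w) / 2"
    "D l n w = \<i> * ((x - cnj y) * B w + (y - cnj x) * Bb w + (u - cnj v) * Z1 w + (v - cnj u) * Zb w) / 2"
proof -
  have bb: "cnj (B (cnjv w)) = Bb w" "cnj (Bb (cnjv w)) = B w"
    "cnj (Z1 (cnjv w)) = Zb w" "cnj (Zb (cnjv w)) = Z1 w" by (simp_all add: Bb_def Zb_def)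
  have "cnj (D l m (cnjv w) - \<i> * D l n (cnjv w)) = cnj (x * B (cnjv w) + y * Bb (cnjv w) + u * Z1 (cnjv w) + v * Zb (cnjv w))"
    using assms(1)[of "cnjv w"] assms(2) by (simp add: N(4))
  then have 2: "D l m w + \<i> * D l n w = cnj x * Bb w + cnj y * B w + cnj u * Zb w + cnj v * Z1 w"
    using assms(2) by (simp add: D_bar bb)
  note 1 = assms(1)[OF assms(2)]
  have "2 * D l m w = (D l m w - \<i> * D l n w) + (D l m w + \<i> * D l n w)" by simp
  then show "D l m w = ((x + cnj y) * B w + (y + cnj x) * Bb w + (u + cnj v) * Z1 w + (v + cnj u) * Zb w) / 2"
    unfolding 1 2 by (simp add: algebra_simps)
  have "2 * D l n w = \<i> * ((D l m w - \<i> * D l n w) - (D l m w + \<i> * D l n w))" by (simp add: algebra_simps)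
  then show "D l n w = \<i> * ((x - cnj y) * B w + (y - cnj x) * Bb w + (u - cnj v) * Z1 w + (v - cnj u) * Zb w) / 2"
    unfolding 1 2 by (simp add: algebra_simps)
qed

text \<open>For \<open>l = 6, 7, 8\<close> the polynomial \<open>p1\<^sup>l\<close> and its derivative vanish, so that \<open>Z\<close> drops out of \<open>order1\<close>.\<close>

lemma order1_678:
  assumes "w \<in> N"
  shows "D 6 1 w = 0" "D 6 2 w - \<i> * D 6 3 w = 2 * Bb w" "D 6 4 w - \<i> * D 6 5 w = 0"
    "D 7 1 w = 0" "D 7 2 w - \<i> * D 7 3 w = 0" "D 7 4 w - \<i> * D 7 5 w = 2 * Bb w"
    "D 8 1 w = 0" "D 8 2 w - \<i> * D 8 3 w = 0" "D 8 4 w - \<i> * D 8 5 w = - 2 * \<i> * Bb w"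
proof -
  have 6: "0 + D 6 1 w * z + (D 6 2 w - \<i> * D 6 3 w - 2 * Bb w) * z^2 + (D 6 4 w - \<i> * D 6 5 w) * z^3 + 0 * z^4 + 0 * z^5 = 0"
    if "norm z < \<delta>" for z
    using order1[OF assms that, of 6] by (simp add: sum_8 p_defs vector_8 algebra_simps)
  from quintic_coeffs_zero[OF \<delta> 6]
  show "D 6 1 w = 0" "D 6 2 w - \<i> * D 6 3 w = 2 * Bb w" "D 6 4 w - \<i> * D 6 5 w = 0" by simp_all
  have 7: "0 + D 7 1 w * z + (D 7 2 w - \<i> * D 7 3 w) * z^2 + (D 7 4 w - \<i> * D 7 5 w - 2 * Bb w) * z^3 + 0 * z^4 + 0 * z^5 = 0"
    if "norm z < \<delta>" for z
    using order1[OF assms that, of 7] by (simp add: sum_8 p_defs vector_8 algebra_simps)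
  from quintic_coeffs_zero[OF \<delta> 7]
  show "D 7 1 w = 0" "D 7 2 w - \<i> * D 7 3 w = 0" "D 7 4 w - \<i> * D 7 5 w = 2 * Bb w" by simp_all
  have 8: "0 + D 8 1 w * z + (D 8 2 w - \<i> * D 8 3 w) * z^2 + (D 8 4 w - \<i> * D 8 5 w + 2 * \<i> * Bb w) * z^3 + 0 * z^4 + 0 * z^5 = 0"
    if "norm z < \<delta>" for z
    using order1[OF assms that, of 8] by (simp add: sum_8 p_defs vector_8 algebra_simps)
  from quintic_coeffs_zero[OF \<delta> 8]
  show "D 8 1 w = 0" "D 8 2 w - \<i> * D 8 3 w = 0" "D 8 4 w - \<i> * D 8 5 w = - 2 * \<i> * Bb w"
    by (simp_all add: eq_neg_iff_add_eq_0)
qed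

lemma D_678:
  assumes "w \<in> N"
  shows "D 6 2 w = B w + Bb w" "D 6 3 w = - \<i> * (B w - Bb w)" "D 6 4 w = 0" "D 6 5 w = 0"
    "D 7 2 w = 0" "D 7 3 w = 0" "D 7 4 w = B w + Bb w" "D 7 5 w = - \<i> * (B w - Bb w)"
    "D 8 2 w = 0" "D 8 3 w = 0" "D 8 4 w = \<i> * (B w - Bb w)" "D 8 5 w = B w + Bb w"
proof -
  have "D 6 2 w - \<i> * D 6 3 w = 0 * B w + 2 * Bb w + 0 * Z1 w + 0 * Zb w" if "w \<in> N" for w
    using order1_678(2)[OF that] by simp
  from real_imag_split[OF this assms]
  show "D 6 2 w = B w + Bb w" "D 6 3 w = - \<i> * (B w - Bb w)" by (simp_all only:) (simp_all add: field_simps)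
  have "D 6 4 w - \<i> * D 6 5 w = 0 * B w + 0 * Bb w + 0 * Z1 w + 0 * Zb w" if "w \<in> N" for w
    using order1_678(3)[OF that] by simp
  from real_imag_split[OF this assms]
  show "D 6 4 w = 0" "D 6 5 w = 0" by (simp_all only:) (simp_all add: field_simps)
  have "D 7 2 w - \<i> * D 7 3 w = 0 * B w + 0 * Bb w + 0 * Z1 w + 0 * Zb w" if "w \<in> N" for w
    using order1_678(5)[OF that] by simp
  from real_imag_split[OF this assms]
  show "D 7 2 w = 0" "D 7 3 w = 0" by (simp_all only:) (simp_all add: field_simps)
  have "D 7 4 w - \<i> * D 7 5 w = 0 * B w + 2 * Bb w + 0 * Z1 w + 0 * Zb w" if "w \<in> N" for w
    using order1_678(6)[OF that] by simp
  from real_imag_split[OF this assms]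
  show "D 7 4 w = B w + Bb w" "D 7 5 w = - \<i> * (B w - Bb w)" by (simp_all only:) (simp_all add: field_simps)
  have "D 8 2 w - \<i> * D 8 3 w = 0 * B w + 0 * Bb w + 0 * Z1 w + 0 * Zb w" if "w \<in> N" for w
    using order1_678(8)[OF that] by simp
  from real_imag_split[OF this assms]
  show "D 8 2 w = 0" "D 8 3 w = 0" by (simp_all only:) (simp_all add: field_simps)
  have "D 8 4 w - \<i> * D 8 5 w = 0 * B w + (- 2 * \<i>) * Bb w + 0 * Z1 w + 0 * Zb w" if "w \<in> N" for w
    using order1_678(9)[OF that] by simp
  from real_imag_split[OF this assms]
  show "D 8 4 w = \<i> * (B w - Bb w)" "D 8 5 w = B w + Bb w" by (simp_all only:) (simp_all add: field_simps)
qed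

text \<open>\<open>indep_of_pd\<close> with \<open>g = 0\<close>, the case that is used most often below.\<close>

lemma A_indep:
  assumes "\<And>w. w \<in> N \<Longrightarrow> D l u w = 0"
  shows "indep_of N u (A l)" "indep_of N u (D l v)"
proof -
  have z: "pd (A l) u w = 0" if "w \<in> N" for w using assms[OF that] by (simp add: D_def)
  show "indep_of N u (A l)" by (rule indep_of_pd_zero[OF N(2) holo_A z])
  show "indep_of N u (D l v)"
    unfolding D_def[abs_def] by (rule indep_of_pd[OF N(1,2) holo_A z]) auto
qed

lemma D_indep:
  assumes "\<And>w. w \<in> N \<Longrightarrow> D l u w = g w" "indep_of N u g" "indep_of N v g"
  shows "indep_of N u (D l v)"
  unfolding D_def[abs_def]
  by (rule indep_of_pd[OF N(1,2) holo_A _ assms(2,3)]) (use assms(1) in \<open>simp_all add: D_def\<close>)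

lemma indep_B_of:
  assumes "indep_of N u (D l m)" "indep_of N u (D l n)"
    and "\<And>w. w \<in> N \<Longrightarrow> D l m w = B w + Bb w" "\<And>w. w \<in> N \<Longrightarrow> D l n w = - \<i> * (B w - Bb w)"
  shows "indep_of N u B" "indep_of N u Bb"
proof -
  have 1: "indep_of N u (\<lambda>w. B w + Bb w)"
    by (rule indep_of_cong[OF _ _ assms(1), where c = 1]) (use assms(3) in auto)
  have 2: "indep_of N u (\<lambda>w. B w - Bb w)"
    by (rule indep_of_cong[OF _ _ assms(2), where c = "- \<i>"]) (use assms(4) in auto)
  show "indep_of N u B" "indep_of N u Bb" using indep_of_add_sub[OF 1 2] by auto
qed

text \<open>\<open>B\<close> and \<open>Bb\<close> are combinations of \<open>\<partial>\<^sub>2 A\<^sup>6\<close> and \<open>\<partial>\<^sub>3 A\<^sup>6\<close>, where \<open>A\<^sup>6\<close> does not depend on \<open>w\<^sup>1, w\<^sup>4, w\<^sup>5\<close>,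
  and also of \<open>\<partial>\<^sub>4 A\<^sup>7\<close> and \<open>\<partial>\<^sub>5 A\<^sup>7\<close>, where \<open>A\<^sup>7\<close> does not depend on \<open>w\<^sup>2, w\<^sup>3\<close>.\<close>

lemma B_indep_5:
  assumes "u \<in> {1, 2, 3, 4, 5}"
  shows "indep_of N u B" "indep_of N u Bb"
proof -
  have "indep_of N u B \<and> indep_of N u Bb" if "u \<in> {1, 4, 5}"
    using that order1_678(1) D_678(1-4)
      indep_B_of[of u 6 2 3, OF A_indep(2) A_indep(2)] by auto
  moreover have "indep_of N u B \<and> indep_of N u Bb" if "u \<in> {2, 3}"
    using that D_678(5-8)
      indep_B_of[of u 7 4 5, OF A_indep(2) A_indep(2)] by auto
  ultimately show "indep_of N u B" "indep_of N u Bb" using assms by auto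
qed

lemma pd_B_5:
  assumes "w \<in> N" "u \<in> {1, 2, 3, 4, 5}"
  shows "pd B u w = 0" "pd Bb u w = 0"
  by (rule pd_zero_of_indep[OF N(1) assms(1) holo_B[OF assms(1)] B_indep_5(1)[OF assms(2)]],
      rule pd_zero_of_indep[OF N(1) assms(1) holo_Bb[OF assms(1)] B_indep_5(2)[OF assms(2)]])

lemma order1':
  assumes "w \<in> N" "norm z < \<delta>"
  shows "(\<Sum>m\<in>UNIV. p1 z $ m * D l m w) + dp1 0 $ l * B w =
    dp1 z $ l * Z (z, w) + 2 * p2 z $ l * Bb w + p1 z $ l * Z1b w"
  using order1[OF assms, of l] by (simp add: sum_8 p_defs vector_8 pd_B_5[OF assms(1)])

lemma Z_cubic:
  assumes "w \<in> N" "norm z < \<delta>"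
  shows "Z (z, w) = B w + Z1 w * z + (D 1 2 w - \<i> * D 1 3 w) * z^2 + (D 1 4 w - \<i> * D 1 5 w) * z^3"
  using order1'[OF assms, of 1] by (simp add: sum_8 p_defs vector_8 Z1_def algebra_simps)

text \<open>In the component \<open>l = 4\<close> the left-hand side of \<open>order1'\<close> has degree 3 in \<open>z\<close>, but \<open>Z\<close> is multiplied by
  \<open>3 z\<^sup>2\<close>: the quadratic and cubic coefficients of \<open>Z\<close> have to vanish.\<close>

lemma order1_4:
  assumes "w \<in> N"
  shows "D 4 1 w = 0" "D 4 2 w - \<i> * D 4 3 w = 3 * B w" "D 4 4 w - \<i> * D 4 5 w = 3 * Z1 w + Z1b w"
    "D 1 2 w - \<i> * D 1 3 w = 0" "D 1 4 w - \<i> * D 1 5 w = 0"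
proof -
  have 4: "0 + D 4 1 w * z + (D 4 2 w - \<i> * D 4 3 w - 3 * B w) * z^2
      + (D 4 4 w - \<i> * D 4 5 w - (3 * Z1 w + Z1b w)) * z^3
      + (- 3 * (D 1 2 w - \<i> * D 1 3 w)) * z^4 + (- 3 * (D 1 4 w - \<i> * D 1 5 w)) * z^5 = 0"
    if "norm z < \<delta>" for z
    using order1'[OF assms that, of 4]
    by (simp add: sum_8 p_defs vector_8 Z_cubic[OF assms that] algebra_simps numeral_eq_Suc)
  from quintic_coeffs_zero[OF \<delta> 4] show "D 4 1 w = 0" "D 4 2 w - \<i> * D 4 3 w = 3 * B w"
    "D 4 4 w - \<i> * D 4 5 w = 3 * Z1 w + Z1b w"
    "D 1 2 w - \<i> * D 1 3 w = 0" "D 1 4 w - \<i> * D 1 5 w = 0" by simp_all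
qed

lemma Z_affine:
  assumes "w \<in> N" "norm z < \<delta>"
  shows "Z (z, w) = B w + z * Z1 w"
  using Z_cubic[OF assms] order1_4(4,5)[OF assms(1)] by simp

lemma bar_Z_affine:
  assumes "w \<in> N" "norm s < \<delta>"
  shows "bar Z (s, w) = Bb w + s * Zb w"
  using Z_affine[of "cnjv w" "cnj s"] assms by (simp add: bar_def cnjp_def Bb_def Zb_def N)

lemma Z1b_eq: "w \<in> N \<Longrightarrow> Z1b w = Zb w"
proof -
  assume w: "w \<in> N"
  have "eventually (\<lambda>s. bar Z (s, w) = Bb w + s * Zb w) (nhds 0)"
    using eventually_shift_in[OF w, of 0] by eventually_elim (use bar_Z_affine[OF w] in auto)
  moreover have "((\<lambda>s. Bb w + s * Zb w) has_field_derivative Zb w) (at 0)"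
    by (auto intro!: derivative_eq_intros)
  ultimately have "((\<lambda>s. bar Z (s, w)) has_field_derivative Zb w) (at 0)"
    using DERIV_cong_ev[OF refl _ refl, of "\<lambda>s. bar Z (s, w)" "\<lambda>s. Bb w + s * Zb w" 0 "Zb w"] by blast
  then show ?thesis unfolding Z1b_def by (rule DERIV_imp_deriv)
qed

lemma D_1:
  assumes "w \<in> N"
  shows "D 1 1 w = Z1 w + Zb w" "D 1 2 w = 0" "D 1 3 w = 0" "D 1 4 w = 0" "D 1 5 w = 0"
proof -
  show "D 1 1 w = Z1 w + Zb w" using Z1b_eq[OF assms] by (simp add: Z1_def)
  have "D 1 2 w - \<i> * D 1 3 w = 0 * B w + 0 * Bb w + 0 * Z1 w + 0 * Zb w" if "w \<in> N" for w
    using order1_4(4)[OF that] by simp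
  from real_imag_split[OF this assms]
  show "D 1 2 w = 0" "D 1 3 w = 0" by (simp_all only:) (simp_all add: field_simps)
  have "D 1 4 w - \<i> * D 1 5 w = 0 * B w + 0 * Bb w + 0 * Z1 w + 0 * Zb w" if "w \<in> N" for w
    using order1_4(5)[OF that] by simp
  from real_imag_split[OF this assms]
  show "D 1 4 w = 0" "D 1 5 w = 0" by (simp_all only:) (simp_all add: field_simps)
qed

lemma order1_23:
  assumes "w \<in> N"
  shows "D 2 1 w = 2 * B w + 2 * Bb w" "D 2 2 w - \<i> * D 2 3 w = 2 * Z1 w + Zb w" "D 2 4 w - \<i> * D 2 5 w = 0"
    "D 3 1 w = - 2 * \<i> * B w + 2 * \<i> * Bb w" "D 3 2 w - \<i> * D 3 3 w = - 2 * \<i> * Z1 w - \<i> * Zb w"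
    "D 3 4 w - \<i> * D 3 5 w = 0"
    "D 5 1 w = 0" "D 5 2 w - \<i> * D 5 3 w = - 3 * \<i> * B w" "D 5 4 w - \<i> * D 5 5 w = - 3 * \<i> * Z1 w - \<i> * Zb w"
proof -
  have 2: "0 + (D 2 1 w - (2 * B w + 2 * Bb w)) * z + (D 2 2 w - \<i> * D 2 3 w - (2 * Z1 w + Zb w)) * z^2
      + (D 2 4 w - \<i> * D 2 5 w) * z^3 + 0 * z^4 + 0 * z^5 = 0"
    if "norm z < \<delta>" for z
    using order1'[OF assms that, of 2]
    by (simp add: sum_8 p_defs vector_8 Z_affine[OF assms that] Z1b_eq[OF assms] algebra_simps power2_eq_square)
  from quintic_coeffs_zero[OF \<delta> 2] show "D 2 1 w = 2 * B w + 2 * Bb w" "D 2 2 w - \<i> * D 2 3 w = 2 * Z1 w + Zb w"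
    "D 2 4 w - \<i> * D 2 5 w = 0" by simp_all
  have 3: "0 + (D 3 1 w - (- 2 * \<i> * B w + 2 * \<i> * Bb w)) * z + (D 3 2 w - \<i> * D 3 3 w - (- 2 * \<i> * Z1 w - \<i> * Zb w)) * z^2
      + (D 3 4 w - \<i> * D 3 5 w) * z^3 + 0 * z^4 + 0 * z^5 = 0"
    if "norm z < \<delta>" for z
    using order1'[OF assms that, of 3]
    by (simp add: sum_8 p_defs vector_8 Z_affine[OF assms that] Z1b_eq[OF assms] algebra_simps power2_eq_square)
  from quintic_coeffs_zero[OF \<delta> 3] show "D 3 1 w = - 2 * \<i> * B w + 2 * \<i> * Bb w"
    "D 3 2 w - \<i> * D 3 3 w = - 2 * \<i> * Z1 w - \<i> * Zb w" "D 3 4 w - \<i> * D 3 5 w = 0"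
    by (simp_all only: right_minus_eq)
  have 5: "0 + D 5 1 w * z + (D 5 2 w - \<i> * D 5 3 w - (- 3 * \<i> * B w)) * z^2
      + (D 5 4 w - \<i> * D 5 5 w - (- 3 * \<i> * Z1 w - \<i> * Zb w)) * z^3 + 0 * z^4 + 0 * z^5 = 0"
    if "norm z < \<delta>" for z
    using order1'[OF assms that, of 5]
    by (simp add: sum_8 p_defs vector_8 Z_affine[OF assms that] Z1b_eq[OF assms] algebra_simps power2_eq_square power3_eq_cube)
  from quintic_coeffs_zero[OF \<delta> 5] show "D 5 1 w = 0" "D 5 2 w - \<i> * D 5 3 w = - 3 * \<i> * B w"
    "D 5 4 w - \<i> * D 5 5 w = - 3 * \<i> * Z1 w - \<i> * Zb w"
    by (simp_all only: right_minus_eq)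
qed

text \<open>Together with \<open>D_1\<close>, \<open>D_678\<close>, \<open>order1_4\<close>, \<open>order1_23\<close> and \<open>order1_678\<close> this expresses every derivative
  of every \<open>A\<^sup>l\<close> in the directions \<open>1, \<dots>, 5\<close> by \<open>B\<close>, \<open>Z1\<close> and their conjugates.\<close>

lemma D_2345:
  assumes "w \<in> N"
  shows "D 2 2 w = 3 / 2 * (Z1 w + Zb w)" "D 2 3 w = \<i> / 2 * (Z1 w - Zb w)" "D 2 4 w = 0" "D 2 5 w = 0"
    "D 3 2 w = - \<i> / 2 * (Z1 w - Zb w)" "D 3 3 w = 3 / 2 * (Z1 w + Zb w)" "D 3 4 w = 0" "D 3 5 w = 0"
    "D 4 2 w = 3 / 2 * (B w + Bb w)" "D 4 3 w = 3 * \<i> / 2 * (B w - Bb w)"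
    "D 4 4 w = 2 * (Z1 w + Zb w)" "D 4 5 w = \<i> * (Z1 w - Zb w)"
    "D 5 2 w = - 3 * \<i> / 2 * (B w - Bb w)" "D 5 3 w = 3 / 2 * (B w + Bb w)"
    "D 5 4 w = - \<i> * (Z1 w - Zb w)" "D 5 5 w = 2 * (Z1 w + Zb w)"
proof -
  have "D 2 2 w - \<i> * D 2 3 w = 0 * B w + 0 * Bb w + 2 * Z1 w + 1 * Zb w" if "w \<in> N" for w
    using order1_23(2)[OF that] by simp
  from real_imag_split[OF this assms]
  show "D 2 2 w = 3 / 2 * (Z1 w + Zb w)" "D 2 3 w = \<i> / 2 * (Z1 w - Zb w)" by (simp_all only:) (simp_all add: field_simps)
  have "D 2 4 w - \<i> * D 2 5 w = 0 * B w + 0 * Bb w + 0 * Z1 w + 0 * Zb w" if "w \<in> N" for w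
    using order1_23(3)[OF that] by simp
  from real_imag_split[OF this assms]
  show "D 2 4 w = 0" "D 2 5 w = 0" by (simp_all only:) (simp_all add: field_simps)
  have "D 3 2 w - \<i> * D 3 3 w = 0 * B w + 0 * Bb w + (- 2 * \<i>) * Z1 w + (- \<i>) * Zb w" if "w \<in> N" for w
    using order1_23(5)[OF that] by simp
  from real_imag_split[OF this assms]
  show "D 3 2 w = - \<i> / 2 * (Z1 w - Zb w)" "D 3 3 w = 3 / 2 * (Z1 w + Zb w)" by (simp_all only:) (simp_all add: field_simps)
  have "D 3 4 w - \<i> * D 3 5 w = 0 * B w + 0 * Bb w + 0 * Z1 w + 0 * Zb w" if "w \<in> N" for w
    using order1_23(6)[OF that] by simp
  from real_imag_split[OF this assms]
  show "D 3 4 w = 0" "D 3 5 w = 0" by (simp_all only:) (simp_all add: field_simps)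
  have "D 4 2 w - \<i> * D 4 3 w = 3 * B w + 0 * Bb w + 0 * Z1 w + 0 * Zb w" if "w \<in> N" for w
    using order1_4(2)[OF that] by simp
  from real_imag_split[OF this assms]
  show "D 4 2 w = 3 / 2 * (B w + Bb w)" "D 4 3 w = 3 * \<i> / 2 * (B w - Bb w)" by (simp_all only:) (simp_all add: field_simps)
  have "D 4 4 w - \<i> * D 4 5 w = 0 * B w + 0 * Bb w + 3 * Z1 w + 1 * Zb w" if "w \<in> N" for w
    using order1_4(3)[OF that] Z1b_eq[OF that] by simp
  from real_imag_split[OF this assms]
  show "D 4 4 w = 2 * (Z1 w + Zb w)" "D 4 5 w = \<i> * (Z1 w - Zb w)" by (simp_all only:) (simp_all add: field_simps)
  have "D 5 2 w - \<i> * D 5 3 w = (- 3 * \<i>) * B w + 0 * Bb w + 0 * Z1 w + 0 * Zb w" if "w \<in> N" for w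
    using order1_23(8)[OF that] by simp
  from real_imag_split[OF this assms]
  show "D 5 2 w = - 3 * \<i> / 2 * (B w - Bb w)" "D 5 3 w = 3 / 2 * (B w + Bb w)" by (simp_all only:) (simp_all add: field_simps)
  have "D 5 4 w - \<i> * D 5 5 w = 0 * B w + 0 * Bb w + (- 3 * \<i>) * Z1 w + (- \<i>) * Zb w" if "w \<in> N" for w
    using order1_23(9)[OF that] by simp
  from real_imag_split[OF this assms]
  show "D 5 4 w = - \<i> * (Z1 w - Zb w)" "D 5 5 w = 2 * (Z1 w + Zb w)" by (simp_all only:) (simp_all add: field_simps)
qed

text \<open>As \<open>Z\<close> is affine in \<open>z\<close>, \<open>Z1\<close> is a difference quotient of \<open>Z\<close> at a fixed \<open>z \<noteq> 0\<close> and inherits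
  holomorphy from \<open>Z\<close>.\<close>

lemma holo_Z1: "w \<in> N \<Longrightarrow> holo Z1 w"
proof -
  assume w: "w \<in> N"
  obtain z :: complex where z: "norm z < \<delta>" "z \<noteq> 0"
    using \<delta> by (intro that[of "of_real (\<delta> / 2)"]) auto
  have h: "holo (\<lambda>w. inverse z * (Z (z, w) + (- 1) * B w)) w"
    by (intro holo_cmult holo_add holo_B w holo_slice dZ z) (use w N in auto)
  show ?thesis
    by (rule holo_cong(1)[OF N(1) w _ h]) (simp add: Z_affine[OF _ z(1)] z(2))
qed

lemma holo_Zb: "w \<in> N \<Longrightarrow> holo Zb w"
  unfolding Zb_def[abs_def] by (rule holo_bar, rule holo_Z1) (simp add: N)

text \<open>The sum \<open>Z1 + Zb = \<partial>\<^sub>1 A\<^sup>1\<close> is independent of \<open>w\<^sup>2, \<dots>, w\<^sup>5\<close> because \<open>A\<^sup>1\<close> is. Up to a constant factor the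
  difference \<open>Z1 - Zb\<close> is \<open>\<partial>\<^sub>3 A\<^sup>2\<close> and also \<open>\<partial>\<^sub>2 A\<^sup>3\<close>; the known derivatives \<open>\<partial>\<^sub>1 A\<^sup>2\<close>, \<open>\<partial>\<^sub>2 A\<^sup>2\<close> and
  \<open>\<partial>\<^sub>3 A\<^sup>3\<close> then give independence in the directions 1, 2 and 3, in direction 1 also of the sum, and
  \<open>A\<^sup>2\<close> does not depend on \<open>w\<^sup>4, w\<^sup>5\<close>.\<close>

lemma Z1_indep_5:
  assumes "u \<in> {1, 2, 3, 4, 5}"
  shows "indep_of N u Z1" "indep_of N u Zb"
proof -
  \<comment> \<open>The factor makes this the function \<open>\<partial>\<^sub>2 A\<^sup>2 = \<partial>\<^sub>3 A\<^sup>3\<close>.\<close>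
  have sum_23: "indep_of N u (\<lambda>w. 3 / 2 * (Z1 w + Zb w))" if "u \<in> {2, 3, 4, 5}" for u
  proof (rule indep_of_cmult[where c = "3 / 2" and g = "D 1 1"])
    show "indep_of N u (D 1 1)"
      using that D_1(2-5) by (auto intro: A_indep(2))
  qed (simp add: D_1)
  have B: "indep_of N u (\<lambda>w. 2 * B w + 2 * Bb w)" if "u \<in> {1, 2, 3, 4, 5}" for u
    using B_indep_5[OF that] by (simp add: indep_of_def)
  have D1: "indep_of N 1 (D 2 2)" "indep_of N 1 (D 2 3)"
    by (rule D_indep[OF order1_23(1) B B]; simp)+
  have D22: "indep_of N u (D 2 2)"
  proof (cases "u = 1")
    case False
    have "indep_of N u (\<lambda>w. 3 / 2 * (Z1 w + Zb w))" using sum_23 assms False by auto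
    then show ?thesis by (rule indep_of_cmult[where c = 1, rotated]) (simp add: D_2345)
  qed (use D1 in simp)
  have D23: "indep_of N u (D 2 3)"
  proof -
    have 2: "indep_of N 2 (D 2 3)"
      by (rule D_indep[OF D_2345(1) sum_23 sum_23]) auto
    have 3: "indep_of N 3 (D 3 2)"
      by (rule D_indep[OF D_2345(6) sum_23 sum_23]) auto
    have "indep_of N 3 (D 2 3)"
      by (rule indep_of_cmult[OF _ 3, where c = "- 1"]) (simp add: D_2345)
    then show ?thesis using assms 2 D1 A_indep(2)[OF D_2345(3), of 3] A_indep(2)[OF D_2345(4), of 3] by auto
  qed
  have 1: "indep_of N u (\<lambda>w. Z1 w + Zb w)"
    by (rule indep_of_cong[OF _ _ D22, where c = "3 / 2"]) (simp_all add: D_2345)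
  have 2: "indep_of N u (\<lambda>w. Z1 w - Zb w)"
    by (rule indep_of_cong[OF _ _ D23, where c = "\<i> / 2"]) (simp_all add: D_2345)
  show "indep_of N u Z1" "indep_of N u Zb" using indep_of_add_sub[OF 1 2] by auto
qed

lemma pd_Z1_5:
  assumes "w \<in> N" "u \<in> {1, 2, 3, 4, 5}"
  shows "pd Z1 u w = 0" "pd Zb u w = 0"
  by (rule pd_zero_of_indep[OF N(1) assms(1) holo_Z1[OF assms(1)] Z1_indep_5(1)[OF assms(2)]],
      rule pd_zero_of_indep[OF N(1) assms(1) holo_Zb[OF assms(1)] Z1_indep_5(2)[OF assms(2)]])

section \<open>The coefficient of \<open>s\<^sup>2\<close>\<close>

text \<open>Holomorphic functions of \<open>w\<^sup>6, w\<^sup>7, w\<^sup>8\<close> alone.\<close>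

definition on_678 :: "(complex ^ 8 \<Rightarrow> complex) \<Rightarrow> bool" where
  "on_678 g \<longleftrightarrow> (\<forall>w\<in>N. holo g w \<and> (\<forall>k\<in>{1, 2, 3, 4, 5}. pd g k w = 0))"

lemma on_678I: "(\<And>w. w \<in> N \<Longrightarrow> holo g w) \<Longrightarrow>
    (\<And>w k. w \<in> N \<Longrightarrow> k \<in> {1, 2, 3, 4, 5} \<Longrightarrow> pd g k w = 0) \<Longrightarrow> on_678 g"
  unfolding on_678_def by (intro ballI conjI)

lemma on_678D: "on_678 g \<Longrightarrow> w \<in> N \<Longrightarrow> holo g w"
  "on_678 g \<Longrightarrow> w \<in> N \<Longrightarrow> k \<in> {1, 2, 3, 4, 5} \<Longrightarrow> pd g k w = 0"
  unfolding on_678_def by (drule bspec, assumption, erule conjE, assumption)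
    (drule bspec, assumption, erule conjE, drule (1) bspec)

lemma on_678_base: "on_678 B" "on_678 Bb" "on_678 Z1" "on_678 Zb" "on_678 (\<lambda>_. 0)"
  by (rule on_678I; rule holo_B holo_Bb holo_Z1 holo_Zb pd_B_5 pd_Z1_5 holo_const; assumption)+

lemma on_678_add: "on_678 f \<Longrightarrow> on_678 g \<Longrightarrow> on_678 (\<lambda>w. f w + g w)"
  by (rule on_678I) (simp_all only: holo_add on_678D add_0)

lemma on_678_cmult: "on_678 f \<Longrightarrow> on_678 (\<lambda>w. c * f w)"
  by (rule on_678I) (simp_all only: holo_cmult on_678D mult_zero_right)

lemma on_678_diff: "on_678 f \<Longrightarrow> on_678 g \<Longrightarrow> on_678 (\<lambda>w. f w - g w)"
  using on_678_add[OF _ on_678_cmult[of g "- 1"], of f] by simp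

lemma on_678_cong:
  assumes "\<And>w. w \<in> N \<Longrightarrow> f w = g w" "on_678 g"
  shows "on_678 f"
  unfolding on_678_def
proof (intro ballI conjI)
  fix w assume w: "w \<in> N"
  have g: "holo g w" "\<And>k. k \<in> {1, 2, 3, 4, 5} \<Longrightarrow> pd g k w = 0"
    using assms(2) w by (auto simp: on_678_def)
  have e: "g v = f v" if "v \<in> N" for v using assms(1)[OF that] by simp
  show "holo f w" using holo_cong(1)[OF N(1) w e g(1)] by simp
  show "pd f k w = 0" if "k \<in> {1, 2, 3, 4, 5}" for k
    using holo_cong(2)[OF N(1) w e g(1), of k] g(2)[OF that] by simp
qed

lemma D_on_678:
  assumes "m \<in> {1, 2, 3, 4, 5}"
  shows "on_678 (D l m)"
proof -
  have "\<forall>l. on_678 (D l 1) \<and> on_678 (D l 2) \<and> on_678 (D l 3) \<and> on_678 (D l 4) \<and> on_678 (D l 5)"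
    unfolding forall_8
    by (intro conjI; rule on_678_cong, erule D_1 D_2345 D_678 order1_23 order1_4 order1_678;
        intro on_678_base on_678_add on_678_diff on_678_cmult)
  then show ?thesis using assms by auto
qed

text \<open>The displacement \<open>- 2 \<i> P(z, s)\<close> is of order \<open>s\<close> only in the coordinates \<open>1, \<dots>, 5\<close>, and along
  these every \<open>A\<^sup>l\<close> is affine. What remains is a displacement of order \<open>s\<^sup>2\<close>, so no second derivatives
  enter the coefficient of \<open>s\<^sup>2\<close>.\<close>

lemma on_678_shift:
  assumes "x \<in> N" "x + h \<in> N" "\<And>m. m \<notin> {1, 2, 3, 4, 5} \<Longrightarrow> h $ m = 0"
  shows "on_678 g \<Longrightarrow> g (x + h) = g x" "A l (x + h) = A l x + (\<Sum>m\<in>UNIV. h $ m * D l m x)"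
proof -
  show "g (x + h) = g x" if "on_678 g"
  proof -
    have "g (x + h) = g x + (\<Sum>m\<in>UNIV. h $ m * 0)"
      by (rule shift_affine[where D = "{1, 2, 3, 4, 5}", OF N(2) assms(1,2) on_678D(1)[OF that] assms(3) on_678D(2)[OF that]])
        simp_all
    then show ?thesis by simp
  qed
  show "A l (x + h) = A l x + (\<Sum>m\<in>UNIV. h $ m * D l m x)"
  proof (rule shift_affine[OF N(2) assms(1,2) holo_A assms(3)])
    show "pd (A l) m v = D l m v" for m v by (simp add: D_def)
    show "holo (D l m) v" if "m \<in> {1, 2, 3, 4, 5}" "v \<in> N" for m v
      by (rule on_678D(1)[OF D_on_678[OF that(1)] that(2)])
    show "pd (D l m) k v = 0" if "m \<in> {1, 2, 3, 4, 5}" "k \<in> {1, 2, 3, 4, 5}" "v \<in> N" for m k v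
      by (rule on_678D(2)[OF D_on_678[OF that(1)] that(3,2)])
  qed
qed

text \<open>The coefficient of \<open>s\<^sup>2\<close> in \<open>segre_identity_A\<close>, divided by \<open>2 \<i>\<close>.\<close>

lemma order2:
  assumes "w \<in> N" "norm z < \<delta>"
  shows "(\<Sum>m\<in>UNIV. p2 z $ m * D l m w) + dp2 0 $ l * B w =
    dp2 z $ l * Z (z, w) + 3 * p3 z $ l * Bb w + 2 * p2 z $ l * Zb w
      - 2 * \<i> * p1 z $ l * (\<Sum>m\<in>UNIV. p2 z $ m * pd Bb m w)"
proof -
  let ?D = "{1, 2, 3, 4, 5} :: 8 set"
  \<comment> \<open>The displacement is split into its first five coordinates \<open>h\<close> and the remaining three, \<open>s\<^sup>2 k\<close>.\<close>
  define h where "h s = (\<chi> m. if m \<in> ?D then - 2 * \<i> * P z s $ m else 0)" for s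
  define k where "k s = (\<chi> m. if m \<in> ?D then 0 else - 2 * \<i> * (p2 z $ m + s * p3 z $ m))" for s
  define y where "y s = w + s\<^sup>2 *s k s" for s
  have p1_0: "p1 z $ m = 0" if "m \<notin> ?D" for m
    using exhaust_8[of m] that by (auto simp: p_defs vector_8)
  have \<omega>: "w - (2 * \<i>) *s P z s = y s + h s" for s
    by (auto simp: vec_eq_iff y_def h_def k_def P_def p1_0 algebra_simps power2_eq_square power3_eq_cube)
  have h0: "h s $ m = 0" if "m \<notin> ?D" for m s using that by (simp add: h_def)
  have k_lim: "(k \<longlongrightarrow> k 0) (at 0)"
  proof (rule vec_tendstoI)
    fix i
    have "((\<lambda>s. - 2 * \<i> * (p2 z $ i + s * p3 z $ i)) \<longlongrightarrow> - 2 * \<i> * (p2 z $ i + 0 * p3 z $ i)) (at (0::complex))"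
      by (intro tendsto_intros)
    then show "((\<lambda>s. k s $ i) \<longlongrightarrow> k 0 $ i) (at 0)" by (simp add: k_def)
  qed
  have y_lim: "(y \<longlongrightarrow> w) (at 0)"
  proof (rule vec_tendstoI)
    fix i
    have "((\<lambda>s. w $ i + s\<^sup>2 * k s $ i) \<longlongrightarrow> w $ i + 0\<^sup>2 * k 0 $ i) (at 0)"
      by (intro tendsto_intros k_lim)
    then show "((\<lambda>s. y s $ i) \<longlongrightarrow> w $ i) (at 0)" by (simp add: y_def)
  qed
  have evN: "eventually (\<lambda>s. norm s < \<delta> \<and> y s \<in> N \<and> y s + h s \<in> N) (at 0)"
  proof -
    have "eventually (\<lambda>s. y s \<in> N) (at 0)" using y_lim N(1) assms(1) by (rule topological_tendstoD)
    moreover have "eventually (\<lambda>s. norm s < \<delta> \<and> y s + h s \<in> N) (at 0)"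
      using eventually_shift_in[OF assms(1), of z] unfolding \<omega> eventually_nhds_conv_at by blast
    ultimately show ?thesis by eventually_elim auto
  qed
  have ev: "eventually (\<lambda>s. A l w + 2 * \<i> * p1 z $ l * Bb w
      - (A l (y s) + (\<Sum>m\<in>UNIV. h s $ m * D l m (y s)) - 2 * \<i> * (Pz 0 s $ l * B (y s))) =
     2 * \<i> * (Pz z s $ l * Z (z, w) + Ps z s $ l * (Bb (y s) + s * Zb (y s)))) (at 0)"
    using evN
  proof eventually_elim
    fix s assume s: "norm s < \<delta> \<and> y s \<in> N \<and> y s + h s \<in> N"
    have sh: "on_678 g \<Longrightarrow> g (y s + h s) = g (y s)" "A l (y s + h s) = A l (y s) + (\<Sum>m\<in>UNIV. h s $ m * D l m (y s))" for g
      using s h0 by (auto intro!: on_678_shift)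
    have "A l (y s + h s) = A l (y s) + (\<Sum>m\<in>UNIV. h s $ m * D l m (y s))"
      "B (y s + h s) = B (y s)" "Bb (y s + h s) = Bb (y s)" "Zb (y s + h s) = Zb (y s)"
      using sh(2) sh(1)[OF on_678_base(1)] sh(1)[OF on_678_base(2)] sh(1)[OF on_678_base(4)] by auto
    then show "A l w + 2 * \<i> * p1 z $ l * Bb w
      - (A l (y s) + (\<Sum>m\<in>UNIV. h s $ m * D l m (y s)) - 2 * \<i> * (Pz 0 s $ l * B (y s))) =
     2 * \<i> * (Pz z s $ l * Z (z, w) + Ps z s $ l * (Bb (y s) + s * Zb (y s)))"
      using segre_identity_A[OF assms(2) _ assms(1), of s l] bar_Z_affine[of "y s + h s" s] s unfolding \<omega> by (simp add: mult.assoc)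
  qed
  have jF: "jet2 (\<lambda>s. f (y s)) (f w) 0 (\<Sum>m\<in>UNIV. k 0 $ m * pd f m w)" if "holo f w" for f
    unfolding y_def by (rule jet2_quadratic_shift[OF that k_lim])
  have jh: "jet2 (\<lambda>s. h s $ m) 0 (if m \<in> ?D then - 2 * \<i> * p1 z $ m else 0) (if m \<in> ?D then - 2 * \<i> * p2 z $ m else 0)" for m
    using jet2_cmult[OF jet2_poly(1), of "- 2 * \<i>" "p1 z $ m" "p2 z $ m" "p3 z $ m"] jet2_const[of 0]
    by (auto simp: h_def P_def)
  have jD: "jet2 (\<lambda>s. h s $ m * D l m (y s)) 0 (if m \<in> ?D then - 2 * \<i> * p1 z $ m * D l m w else 0)
      (if m \<in> ?D then - 2 * \<i> * p2 z $ m * D l m w else 0)" for m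
  proof (cases "m \<in> ?D")
    case True
    then have "holo (D l m) w" using D_on_678 assms(1) by (simp add: on_678_def)
    from jet2_mult[OF jh[of m] jF[OF this]] True show ?thesis by simp
  next
    case False
    then show ?thesis using jet2_const[of 0] by (simp add: h0)
  qed
  have jP: "jet2 (\<lambda>s. Pz a s $ l) 0 (dp1 a $ l) (dp2 a $ l)"
    "jet2 (\<lambda>s. Ps z s $ l) (p1 z $ l) (2 * p2 z $ l) (3 * p3 z $ l)" for a
    unfolding Pz_def Ps_def vec_lambda_beta by (rule jet2_poly)+
  note L = jet2_diff[OF jet2_const[of "A l w + 2 * \<i> * p1 z $ l * Bb w"]
      jet2_diff[OF jet2_add[OF jF[OF holo_A[OF assms(1), of l]] jet2_sum[OF finite[of "UNIV :: 8 set"] jD]]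
        jet2_cmult[OF jet2_mult[OF jP(1)[of 0] jF[OF holo_B[OF assms(1)]]], of "2 * \<i>"]]]
  note R = jet2_cmult[OF jet2_add[OF jet2_mult[OF jP(1)[of z] jet2_const[of "Z (z, w)"]]
      jet2_mult[OF jP(2) jet2_add[OF jF[OF holo_Bb[OF assms(1)]]
        jet2_mult[OF jet2_poly(3) jF[OF holo_Zb[OF assms(1)]]]]]], of "2 * \<i>"]
  have c: "0 - ((\<Sum>m\<in>UNIV. k 0 $ m * D l m w) + (\<Sum>m\<in>UNIV. if m \<in> ?D then - 2 * \<i> * p2 z $ m * D l m w else 0)
       - 2 * \<i> * (dp2 0 $ l * B w)) =
     2 * \<i> * (dp2 z $ l * Z (z, w) + (p1 z $ l * (\<Sum>m\<in>UNIV. k 0 $ m * pd Bb m w) + 2 * p2 z $ l * Zb w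
       + 3 * p3 z $ l * Bb w))"
    using jet2_unique(3)[OF ev L R] by (simp add: D_def)
  have s1: "(\<Sum>m\<in>UNIV. k 0 $ m * D l m w) + (\<Sum>m\<in>UNIV. if m \<in> ?D then - 2 * \<i> * p2 z $ m * D l m w else 0)
      = - 2 * \<i> * (\<Sum>m\<in>UNIV. p2 z $ m * D l m w)"
    unfolding sum_distrib_left sum.distrib[symmetric]
    by (rule sum.cong[OF refl]) (auto simp: k_def)
  have s2: "(\<Sum>m\<in>UNIV. k 0 $ m * pd Bb m w) = - 2 * \<i> * (\<Sum>m\<in>UNIV. p2 z $ m * pd Bb m w)"
    unfolding sum_distrib_left
    by (rule sum.cong[OF refl]) (use pd_B_5(2)[OF assms(1)] in \<open>auto simp: k_def\<close>)
  have "2 * \<i> * ((\<Sum>m\<in>UNIV. p2 z $ m * D l m w) + dp2 0 $ l * B w) =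
    2 * \<i> * (dp2 z $ l * Z (z, w) + 3 * p3 z $ l * Bb w + 2 * p2 z $ l * Zb w
      - 2 * \<i> * p1 z $ l * (\<Sum>m\<in>UNIV. p2 z $ m * pd Bb m w))"
    using c unfolding s1 s2 by (simp add: algebra_simps)
  then show ?thesis by simp
qed

text \<open>The components 6 and 1. In the latter the unknown derivatives of \<open>Bb\<close> only meet the powers \<open>z\<^sup>3\<close> and
  \<open>z\<^sup>4\<close>, so the coefficient of \<open>z\<^sup>2\<close> is usable before these derivatives are known to vanish.\<close>

lemma order2_6:
  assumes "w \<in> N"
  shows "D 6 6 w = 2 * (Z1 w + Zb w)" "D 6 7 w - \<i> * D 6 8 w = 0" "D 1 6 w = 0"
proof -
  have 6: "0 + 0 * z + (D 6 6 w - 2 * (Z1 w + Zb w)) * z^2 + (D 6 7 w - \<i> * D 6 8 w) * z^3 + 0 * z^4 + 0 * z^5 = 0"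
    if "norm z < \<delta>" for z
    using order2[OF assms that, of 6]
    by (simp add: sum_8 p_defs vector_8 D_678[OF assms] order1_678[OF assms] Z_affine[OF assms that] algebra_simps power2_eq_square)
  from quintic_coeffs_zero[OF \<delta> 6] show "D 6 6 w = 2 * (Z1 w + Zb w)" "D 6 7 w - \<i> * D 6 8 w = 0"
    by (simp_all only: right_minus_eq)
  have 1: "0 + 0 * z + D 1 6 w * z^2 + (D 1 7 w - \<i> * D 1 8 w + 2 * \<i> * pd Bb 6 w) * z^3
      + 2 * \<i> * (pd Bb 7 w - \<i> * pd Bb 8 w) * z^4 + 0 * z^5 = 0"
    if "norm z < \<delta>" for z
    using order2[OF assms that, of 1]
    by (simp add: sum_8 p_defs vector_8 D_1[OF assms] pd_B_5[OF assms] algebra_simps numeral_eq_Suc)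
  from quintic_coeffs_zero(3)[OF \<delta> 1] show "D 1 6 w = 0" .
qed

lemma D_6_78:
  assumes "w \<in> N"
  shows "D 6 7 w = 0" "D 6 8 w = 0"
proof -
  have "D 6 7 w - \<i> * D 6 8 w = 0 * B w + 0 * Bb w + 0 * Z1 w + 0 * Zb w" if "w \<in> N" for w
    using order2_6(2)[OF that] by simp
  from real_imag_split[OF this assms]
  show "D 6 7 w = 0" "D 6 8 w = 0" by (simp_all only:) (simp_all add: field_simps)
qed

text \<open>\<open>Z1 + Zb\<close> is both \<open>\<partial>\<^sub>1 A\<^sup>1\<close> and half of \<open>\<partial>\<^sub>6 A\<^sup>6\<close>, where \<open>A\<^sup>1\<close> does not depend on \<open>w\<^sup>6\<close> and \<open>A\<^sup>6\<close> does
  not depend on \<open>w\<^sup>7, w\<^sup>8\<close>.\<close>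

lemma Z1_Zb_sum_indep: "indep_of N u (\<lambda>w. 2 * (Z1 w + Zb w))"
proof -
  have "indep_of N u (\<lambda>w. 2 * (Z1 w + Zb w))" if "u \<in> {1, 2, 3, 4, 5}"
    using Z1_indep_5[OF that] by (simp add: indep_of_def)
  moreover have "indep_of N 6 (\<lambda>w. 2 * (Z1 w + Zb w))"
    by (rule indep_of_cmult[OF _ A_indep(2)[OF order2_6(3), of 1], where c = 2]) (simp_all add: D_1)
  moreover have "indep_of N 7 (\<lambda>w. 2 * (Z1 w + Zb w))"
    by (rule indep_of_cmult[OF _ A_indep(2)[OF D_6_78(1), of 6], where c = 1]) (simp_all add: order2_6)
  moreover have "indep_of N 8 (\<lambda>w. 2 * (Z1 w + Zb w))"
    by (rule indep_of_cmult[OF _ A_indep(2)[OF D_6_78(2), of 6], where c = 1]) (simp_all add: order2_6)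
  ultimately show ?thesis using exhaust_8[of u] by auto
qed

lemma B_indep: "indep_of N u B" "indep_of N u Bb"
proof -
  have 6: "indep_of N 6 (D 6 v)" for v
    by (rule D_indep[OF order2_6(1) Z1_Zb_sum_indep Z1_Zb_sum_indep])
  have "indep_of N u B \<and> indep_of N u Bb" if "u \<in> {6, 7, 8}"
    using that indep_B_of[OF _ _ D_678(1,2), of u] 6 A_indep(2)[OF D_6_78(1)] A_indep(2)[OF D_6_78(2)]
    by blast
  then show "indep_of N u B" "indep_of N u Bb" using B_indep_5[of u] exhaust_8[of u] by auto
qed

lemma pd_Bb: "w \<in> N \<Longrightarrow> pd Bb m w = 0"
  by (rule pd_zero_of_indep[OF N(1) _ holo_Bb B_indep(2)])

lemma order2':
  assumes "w \<in> N" "norm z < \<delta>"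
  shows "(\<Sum>m\<in>UNIV. p2 z $ m * D l m w) + dp2 0 $ l * B w =
    dp2 z $ l * (B w + z * Z1 w) + 3 * p3 z $ l * Bb w + 2 * p2 z $ l * Zb w"
  using order2[OF assms, of l] Z_affine[OF assms] by (simp add: pd_Bb[OF assms(1)])

lemma order2_rest:
  assumes "w \<in> N"
  shows "D 1 7 w - \<i> * D 1 8 w = 0"
    "D 2 6 w = 0" "D 2 7 w - \<i> * D 2 8 w = 0"
    "D 3 6 w = 0" "D 3 7 w - \<i> * D 3 8 w = 0"
    "D 4 6 w = 0" "D 4 7 w - \<i> * D 4 8 w = 0"
    "D 5 6 w = 0" "D 5 7 w - \<i> * D 5 8 w = 0"
    "D 7 6 w = 3 * (B w + Bb w)" "D 7 7 w - \<i> * D 7 8 w = 3 * Z1 w + 2 * Zb w"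
    "D 8 6 w = - 3 * \<i> * (B w - Bb w)" "D 8 7 w - \<i> * D 8 8 w = - 3 * \<i> * Z1 w - 2 * \<i> * Zb w"
proof -
  \<comment> \<open>The coefficient of \<open>z\<close> holds automatically; in this form it cancels from the identities below.\<close>
  have q: "D 2 2 w = Z1 w + 2 * Zb w - \<i> * D 2 3 w" "D 3 2 w = \<i> * (Z1 w + 2 * Zb w) - \<i> * D 3 3 w"
    "D 4 2 w = 3 * Bb w - \<i> * D 4 3 w" "D 5 2 w = 3 * \<i> * Bb w - \<i> * D 5 3 w"
    "D 7 2 w = 0" "D 7 3 w = 0" "D 8 2 w = 0" "D 8 3 w = 0"
    by (simp_all only: D_2345[OF assms] D_678[OF assms]) (simp_all add: field_simps)
  have 1: "0 + 0 * z + 0 * z^2 + (D 1 7 w - \<i> * D 1 8 w - 0) * z^3 + 0 * z^4 + 0 * z^5 = 0"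
    if "norm z < \<delta>" for z
    using order2'[OF assms that, of 1]
    by (simp add: sum_8 p_defs vector_8 D_1[OF assms] q order2_6(3)[OF assms]
        algebra_simps power2_eq_square power3_eq_cube)
  from quintic_coeffs_zero[OF \<delta> 1] show "D 1 7 w - \<i> * D 1 8 w = 0" by (simp_all only: right_minus_eq)
  have 2: "0 + 0 * z + (D 2 6 w - 0) * z^2 + (D 2 7 w - \<i> * D 2 8 w - 0) * z^3 + 0 * z^4 + 0 * z^5 = 0"
    if "norm z < \<delta>" for z
    using order2'[OF assms that, of 2]
    by (simp add: sum_8 p_defs vector_8 D_1[OF assms] q order2_6(3)[OF assms]
        algebra_simps power2_eq_square power3_eq_cube)
  from quintic_coeffs_zero[OF \<delta> 2] show "D 2 6 w = 0" "D 2 7 w - \<i> * D 2 8 w = 0" by (simp_all only: right_minus_eq)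
  have 3: "0 + 0 * z + (D 3 6 w - 0) * z^2 + (D 3 7 w - \<i> * D 3 8 w - 0) * z^3 + 0 * z^4 + 0 * z^5 = 0"
    if "norm z < \<delta>" for z
    using order2'[OF assms that, of 3]
    by (simp add: sum_8 p_defs vector_8 D_1[OF assms] q order2_6(3)[OF assms]
        algebra_simps power2_eq_square power3_eq_cube)
  from quintic_coeffs_zero[OF \<delta> 3] show "D 3 6 w = 0" "D 3 7 w - \<i> * D 3 8 w = 0" by (simp_all only: right_minus_eq)
  have 4: "0 + 0 * z + (D 4 6 w - 0) * z^2 + (D 4 7 w - \<i> * D 4 8 w - 0) * z^3 + 0 * z^4 + 0 * z^5 = 0"
    if "norm z < \<delta>" for z
    using order2'[OF assms that, of 4]
    by (simp add: sum_8 p_defs vector_8 D_1[OF assms] q order2_6(3)[OF assms]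
        algebra_simps power2_eq_square power3_eq_cube)
  from quintic_coeffs_zero[OF \<delta> 4] show "D 4 6 w = 0" "D 4 7 w - \<i> * D 4 8 w = 0" by (simp_all only: right_minus_eq)
  have 5: "0 + 0 * z + (D 5 6 w - 0) * z^2 + (D 5 7 w - \<i> * D 5 8 w - 0) * z^3 + 0 * z^4 + 0 * z^5 = 0"
    if "norm z < \<delta>" for z
    using order2'[OF assms that, of 5]
    by (simp add: sum_8 p_defs vector_8 D_1[OF assms] q order2_6(3)[OF assms]
        algebra_simps power2_eq_square power3_eq_cube)
  from quintic_coeffs_zero[OF \<delta> 5] show "D 5 6 w = 0" "D 5 7 w - \<i> * D 5 8 w = 0" by (simp_all only: right_minus_eq)
  have 7: "0 + 0 * z + (D 7 6 w - (3 * (B w + Bb w))) * z^2 + (D 7 7 w - \<i> * D 7 8 w - (3 * Z1 w + 2 * Zb w)) * z^3 + 0 * z^4 + 0 * z^5 = 0"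
    if "norm z < \<delta>" for z
    using order2'[OF assms that, of 7]
    by (simp add: sum_8 p_defs vector_8 D_1[OF assms] q order2_6(3)[OF assms]
        algebra_simps power2_eq_square power3_eq_cube)
  from quintic_coeffs_zero[OF \<delta> 7] show "D 7 6 w = 3 * (B w + Bb w)" "D 7 7 w - \<i> * D 7 8 w = 3 * Z1 w + 2 * Zb w" by (simp_all only: right_minus_eq)
  have 8: "0 + 0 * z + (D 8 6 w - (- 3 * \<i> * (B w - Bb w))) * z^2 + (D 8 7 w - \<i> * D 8 8 w - (- 3 * \<i> * Z1 w - 2 * \<i> * Zb w)) * z^3 + 0 * z^4 + 0 * z^5 = 0"
    if "norm z < \<delta>" for z
    using order2'[OF assms that, of 8]
    by (simp add: sum_8 p_defs vector_8 D_1[OF assms] q order2_6(3)[OF assms]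
        algebra_simps power2_eq_square power3_eq_cube)
  from quintic_coeffs_zero[OF \<delta> 8] show "D 8 6 w = - 3 * \<i> * (B w - Bb w)" "D 8 7 w - \<i> * D 8 8 w = - 3 * \<i> * Z1 w - 2 * \<i> * Zb w" by (simp_all only: right_minus_eq)
qed

lemma D_78:
  assumes "w \<in> N"
  shows "D 1 7 w = 0" "D 1 8 w = 0" "D 2 7 w = 0" "D 2 8 w = 0" "D 3 7 w = 0" "D 3 8 w = 0"
    "D 4 7 w = 0" "D 4 8 w = 0" "D 5 7 w = 0" "D 5 8 w = 0"
    "D 7 7 w = 5 / 2 * (Z1 w + Zb w)" "D 7 8 w = \<i> / 2 * (Z1 w - Zb w)"
    "D 8 7 w = - \<i> / 2 * (Z1 w - Zb w)" "D 8 8 w = 5 / 2 * (Z1 w + Zb w)"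
proof -
  have "D 1 7 w - \<i> * D 1 8 w = 0 * B w + 0 * Bb w + 0 * Z1 w + 0 * Zb w" if "w \<in> N" for w
    using order2_rest(1)[OF that] by simp
  from real_imag_split[OF this assms]
  show "D 1 7 w = 0" "D 1 8 w = 0" by (simp_all only:) (simp_all add: field_simps)
  have "D 2 7 w - \<i> * D 2 8 w = 0 * B w + 0 * Bb w + 0 * Z1 w + 0 * Zb w" if "w \<in> N" for w
    using order2_rest(3)[OF that] by simp
  from real_imag_split[OF this assms]
  show "D 2 7 w = 0" "D 2 8 w = 0" by (simp_all only:) (simp_all add: field_simps)
  have "D 3 7 w - \<i> * D 3 8 w = 0 * B w + 0 * Bb w + 0 * Z1 w + 0 * Zb w" if "w \<in> N" for w
    using order2_rest(5)[OF that] by simp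
  from real_imag_split[OF this assms]
  show "D 3 7 w = 0" "D 3 8 w = 0" by (simp_all only:) (simp_all add: field_simps)
  have "D 4 7 w - \<i> * D 4 8 w = 0 * B w + 0 * Bb w + 0 * Z1 w + 0 * Zb w" if "w \<in> N" for w
    using order2_rest(7)[OF that] by simp
  from real_imag_split[OF this assms]
  show "D 4 7 w = 0" "D 4 8 w = 0" by (simp_all only:) (simp_all add: field_simps)
  have "D 5 7 w - \<i> * D 5 8 w = 0 * B w + 0 * Bb w + 0 * Z1 w + 0 * Zb w" if "w \<in> N" for w
    using order2_rest(9)[OF that] by simp
  from real_imag_split[OF this assms]
  show "D 5 7 w = 0" "D 5 8 w = 0" by (simp_all only:) (simp_all add: field_simps)
  have "D 7 7 w - \<i> * D 7 8 w = 0 * B w + 0 * Bb w + 3 * Z1 w + 2 * Zb w" if "w \<in> N" for w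
    using order2_rest(11)[OF that] by simp
  from real_imag_split[OF this assms]
  show "D 7 7 w = 5 / 2 * (Z1 w + Zb w)" "D 7 8 w = \<i> / 2 * (Z1 w - Zb w)" by (simp_all only:) (simp_all add: field_simps)
  have "D 8 7 w - \<i> * D 8 8 w = 0 * B w + 0 * Bb w + (- 3 * \<i>) * Z1 w + (- 2 * \<i>) * Zb w" if "w \<in> N" for w
    using order2_rest(13)[OF that] by simp
  from real_imag_split[OF this assms]
  show "D 8 7 w = - \<i> / 2 * (Z1 w - Zb w)" "D 8 8 w = 5 / 2 * (Z1 w + Zb w)" by (simp_all only:) (simp_all add: field_simps)
qed

lemma Z1_indep: "indep_of N u Z1" "indep_of N u Zb"
proof -
  have "indep_of N u Z1 \<and> indep_of N u Zb" if "u \<in> {6, 7, 8}"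
  proof -
    have d: "indep_of N u (D 2 3)"
      using that A_indep(2)[OF order2_rest(2)] A_indep(2)[OF D_78(3)] A_indep(2)[OF D_78(4)] by blast
    have 1: "indep_of N u (\<lambda>w. Z1 w + Zb w)"
      by (rule indep_of_cong[OF _ _ Z1_Zb_sum_indep[of u], where c = 2]) auto
    have 2: "indep_of N u (\<lambda>w. Z1 w - Zb w)"
      by (rule indep_of_cong[OF _ _ d, where c = "\<i> / 2"]) (simp_all add: D_2345)
    show ?thesis using indep_of_add_sub[OF 1 2] by blast
  qed
  then show "indep_of N u Z1" "indep_of N u Zb" using Z1_indep_5[of u] exhaust_8[of u] by auto
qed

lemma const_of_indep:
  assumes "\<And>w. w \<in> N \<Longrightarrow> holo f w" "\<And>u. indep_of N u f" "w \<in> N"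
  shows "f w = f 0"
proof -
  have "f (0 + 1 *s w) = f 0 + 1 * 0"
  proof (rule shift_along_line[OF N(2,5) _ assms(1)])
    fix \<tau> assume \<tau>: "0 + \<tau> *s w \<in> N"
    have "pd f m (0 + \<tau> *s w) = 0" for m
      by (rule pd_zero_of_indep[OF N(1) \<tau> assms(1)[OF \<tau>] assms(2)])
    then show "(\<Sum>m\<in>UNIV. w $ m * pd f m (0 + \<tau> *s w)) = 0" by simp
  qed (use assms(3) in simp_all)
  then show ?thesis by simp
qed

text \<open>With \<open>B\<close> and \<open>Z1\<close> constant, all first derivatives of \<open>A\<close> are constant and \<open>A\<close> is affine. The parameters
  are the real and imaginary parts of \<open>B(0)\<close> and \<open>Z1(0)\<close> and the real numbers \<open>A\<^sup>l(0)\<close>.\<close>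

lemma field_is_aut_field:
  "\<exists>cs a b c d. \<forall>z w. norm z < \<delta> \<longrightarrow> norm w < \<delta> \<longrightarrow> (Z (z, w), \<chi> l. W l (z, w)) = aut_field cs a b c d (z, w)"
proof -
  define c d a b where "c = Re (B 0)" and "d = Im (B 0)" and "a = Re (Z1 0)" and "b = Im (Z1 0)"
  define cs where "cs = (\<chi> l. Re (A l 0))"
  have B: "B w = of_real c + \<i> * of_real d" "Bb w = of_real c - \<i> * of_real d" if "w \<in> N" for w
  proof -
    have *: "B w = of_real c + \<i> * of_real d" if "w \<in> N" for w
      using const_of_indep[OF holo_B B_indep(1) that] by (simp add: c_def d_def complex_eq_iff)
    show "B w = of_real c + \<i> * of_real d" using *[OF that] .
    show "Bb w = of_real c - \<i> * of_real d" using *[of "cnjv w"] that by (simp add: Bb_def N(4))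
  qed
  have Z1: "Z1 w = of_real a + \<i> * of_real b" "Zb w = of_real a - \<i> * of_real b" if "w \<in> N" for w
  proof -
    have *: "Z1 w = of_real a + \<i> * of_real b" if "w \<in> N" for w
      using const_of_indep[OF holo_Z1 Z1_indep(1) that] by (simp add: a_def b_def complex_eq_iff)
    show "Z1 w = of_real a + \<i> * of_real b" using *[OF that] .
    show "Zb w = of_real a - \<i> * of_real b" using *[of "cnjv w"] that by (simp add: Zb_def N(4))
  qed
  have A0: "A l 0 = of_real (cs $ l)" for l
    using A_real[OF N(5), of l] by (simp add: cs_def complex_eq_iff)
  have A: "A l w = of_real (cs $ l) + k" if w: "w \<in> N" and k: "\<And>v. v \<in> N \<Longrightarrow> (\<Sum>m\<in>UNIV. w $ m * D l m v) = k" for l w k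
  proof -
    have "A l (0 + 1 *s w) = A l 0 + 1 * k"
      by (rule shift_along_line[OF N(2,5) _ holo_A]) (use w k in \<open>simp_all add: D_def\<close>)
    then show ?thesis by (simp add: A0)
  qed
  note D_all = D_1 D_2345 D_678 D_6_78 D_78 order1_678(1,4,7) order1_4(1) order1_23(1,4,7) order2_6(1,3)
    order2_rest(2,4,6,8,10,12)
  show ?thesis
  proof (intro exI allI impI)
    fix z :: complex and w :: "complex ^ 8"
    assume zw: "norm z < \<delta>" "norm w < \<delta>"
    then have w: "w \<in> N" by (simp add: N)
    have A1: "A 1 w = of_real (cs $ 1) + 2 * of_real a * w $ 1"
      by (rule A[OF w]) (simp add: sum_8 D_all B Z1 algebra_simps)
    have A2: "A 2 w = of_real (cs $ 2) + (4 * of_real c * w $ 1 + 3 * of_real a * w $ 2 - of_real b * w $ 3)"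
      by (rule A[OF w]) (simp add: sum_8 D_all B Z1 algebra_simps)
    have A3: "A 3 w = of_real (cs $ 3) + (4 * of_real d * w $ 1 + of_real b * w $ 2 + 3 * of_real a * w $ 3)"
      by (rule A[OF w]) (simp add: sum_8 D_all B Z1 algebra_simps)
    have A4: "A 4 w = of_real (cs $ 4) + (3 * of_real c * w $ 2 - 3 * of_real d * w $ 3 + 4 * of_real a * w $ 4 - 2 * of_real b * w $ 5)"
      by (rule A[OF w]) (simp add: sum_8 D_all B Z1 algebra_simps)
    have A5: "A 5 w = of_real (cs $ 5) + (3 * of_real d * w $ 2 + 3 * of_real c * w $ 3 + 2 * of_real b * w $ 4 + 4 * of_real a * w $ 5)"
      by (rule A[OF w]) (simp add: sum_8 D_all B Z1 algebra_simps)
    have A6: "A 6 w = of_real (cs $ 6) + (2 * of_real c * w $ 2 + 2 * of_real d * w $ 3 + 4 * of_real a * w $ 6)"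
      by (rule A[OF w]) (simp add: sum_8 D_all B Z1 algebra_simps)
    have A7: "A 7 w = of_real (cs $ 7) + (2 * of_real c * w $ 4 + 2 * of_real d * w $ 5 + 6 * of_real c * w $ 6
        + 5 * of_real a * w $ 7 - of_real b * w $ 8)"
      by (rule A[OF w]) (simp add: sum_8 D_all B Z1 algebra_simps)
    have A8: "A 8 w = of_real (cs $ 8) + (- 2 * of_real d * w $ 4 + 2 * of_real c * w $ 5 + 6 * of_real d * w $ 6
        + of_real b * w $ 7 + 5 * of_real a * w $ 8)"
      by (rule A[OF w]) (simp add: sum_8 D_all B Z1 algebra_simps)
    show "(Z (z, w), \<chi> l. W l (z, w)) = aut_field cs a b c d (z, w)"
      by (simp add: aut_field_def vec_eq_8 vector_8 W_eq[OF zw(1) w] Z_affine[OF w zw(1)] B[OF w] Z1[OF w]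
          A1 A2 A3 A4 A5 A6 A7 A8 p_defs algebra_simps)
  qed
qed

end

section \<open>The infinitesimal automorphisms\<close>

text \<open>The derivative of \<open>aut_field\<close> at a point with first coordinate \<open>z\<close>; the field is affine in \<open>w\<close>.\<close>

definition aut_deriv :: "real \<Rightarrow> real \<Rightarrow> real \<Rightarrow> real \<Rightarrow> complex \<Rightarrow> pt \<Rightarrow> pt" where
  "aut_deriv a b c d z = (\<lambda>(x, h).
     ((of_real a + \<i> * of_real b) * x,
      vector [
        2 * of_real a * h $ 1 + 2 * (of_real d + \<i> * of_real c) * x,
        4 * of_real c * h $ 1 + 3 * of_real a * h $ 2 - of_real b * h $ 3
          + 4 * (of_real d + \<i> * of_real c) * z * x,
        4 * of_real d * h $ 1 + of_real b * h $ 2 + 3 * of_real a * h $ 3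
          + 4 * (of_real c - \<i> * of_real d) * z * x,
        3 * of_real c * h $ 2 - 3 * of_real d * h $ 3 + 4 * of_real a * h $ 4
          - 2 * of_real b * h $ 5 + 6 * (of_real d + \<i> * of_real c) * z^2 * x,
        3 * of_real d * h $ 2 + 3 * of_real c * h $ 3 + 2 * of_real b * h $ 4
          + 4 * of_real a * h $ 5 + 6 * (of_real c - \<i> * of_real d) * z^2 * x,
        2 * of_real c * h $ 2 + 2 * of_real d * h $ 3 + 4 * of_real a * h $ 6,
        2 * of_real c * h $ 4 + 2 * of_real d * h $ 5 + 6 * of_real c * h $ 6
          + 5 * of_real a * h $ 7 - of_real b * h $ 8,
        - 2 * of_real d * h $ 4 + 2 * of_real c * h $ 5 + 6 * of_real d * h $ 6
          + of_real b * h $ 7 + 5 * of_real a * h $ 8]))"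

lemma aut_field_has_derivative:
  "(aut_field cs a b c d has_derivative aut_deriv a b c d (fst p)) (at p)"
proof -
  have z: "((\<lambda>p::pt. fst p) has_derivative fst) (at p)"
    by (rule bounded_linear_imp_has_derivative[OF bounded_linear_fst])
  have w: "((\<lambda>p::pt. snd p $ l) has_derivative (\<lambda>h. snd h $ l)) (at p)" for l
    by (intro bounded_linear_imp_has_derivative bounded_linear_compose[OF bounded_linear_vec_nth] bounded_linear_snd)
  have z2: "((\<lambda>p::pt. (fst p)\<^sup>2) has_derivative (\<lambda>h. 2 * fst p * fst h)) (at p)"
    by (rule has_derivative_eq_rhs, rule has_derivative_power[OF z]) (simp add: fun_eq_iff)
  have z3: "((\<lambda>p::pt. (fst p) ^ 3) has_derivative (\<lambda>h. 3 * (fst p)\<^sup>2 * fst h)) (at p)"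
    by (rule has_derivative_eq_rhs, rule has_derivative_power[OF z]) (simp add: fun_eq_iff)
  have 1: "((\<lambda>p. fst (aut_field cs a b c d p)) has_derivative (\<lambda>h. fst (aut_deriv a b c d (fst p) h))) (at p)"
    unfolding aut_field_def aut_deriv_def case_prod_beta fst_conv
    by (rule derivative_eq_intros z refl)+ simp
  have "\<forall>l. ((\<lambda>p. snd (aut_field cs a b c d p) $ l) has_derivative (\<lambda>h. snd (aut_deriv a b c d (fst p) h) $ l)) (at p)"
    unfolding forall_8 aut_field_def aut_deriv_def case_prod_beta snd_conv vector_8
    by (intro conjI; (rule has_derivative_eq_rhs,
        (rule has_derivative_add has_derivative_diff has_derivative_mult_right has_derivative_const z w z2 z3)+,
        simp add: fun_eq_iff))
  then have 2: "((\<lambda>p. snd (aut_field cs a b c d p)) has_derivative (\<lambda>h. snd (aut_deriv a b c d (fst p) h))) (at p)"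
    by (intro has_derivative_vecI) simp
  show ?thesis using has_derivative_Pair[OF 1 2] by simp
qed

lemma aut_deriv_cscale: "aut_deriv a b c d z (cscale k v) = cscale k (aut_deriv a b c d z v)"
  by (simp add: aut_deriv_def cscale_def case_prod_beta vec_eq_8 vector_8 algebra_simps)

lemma aut_field_holomorphic: "holomorphic_field_on U (aut_field cs a b c d)"
  unfolding holomorphic_field_on_def complex_differentiable_at_def
proof (intro ballI conjI allI exI)
  fix p l
  show "((\<lambda>q. fst (aut_field cs a b c d q)) has_derivative (\<lambda>h. fst (aut_deriv a b c d (fst p) h))) (at p)"
    by (rule has_derivative_fst[OF aut_field_has_derivative])
  show "((\<lambda>q. snd (aut_field cs a b c d q) $ l) has_derivative (\<lambda>h. snd (aut_deriv a b c d (fst p) h) $ l)) (at p)"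
    by (rule bounded_linear.has_derivative[OF bounded_linear_vec_nth has_derivative_snd[OF aut_field_has_derivative]])
qed (simp_all add: aut_deriv_cscale, simp_all add: cscale_def)

text \<open>A polynomial identity in \<open>z\<close>, \<open>cnj z\<close> and \<open>w\<close> once \<open>cnj w\<close> has been eliminated by the defining equations.\<close>

lemma aut_field_tangent:
  assumes "p \<in> M2"
  shows "aut_field cs a b c d p \<in> tangent_space M2 p"
proof -
  obtain z w where p: "p = (z, w)" by (cases p)
  let ?Z = "fst (aut_field cs a b c d (z, w))" and ?W = "snd (aut_field cs a b c d (z, w))"
  have "\<forall>l. w $ l - cnj (w $ l) = 2 * \<i> * P z (cnj z) $ l" using assms by (simp add: p M2_iff)
  then have w: "cnj (w $ l) = w $ l - 2 * \<i> * P z (cnj z) $ l" for l by (simp add: algebra_simps)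
  have wl: "cnj (w $ 1) = w $ 1 - 2 * \<i> * (z * cnj z)"
    "cnj (w $ 2) = w $ 2 - 2 * \<i> * (z^2 * cnj z + z * cnj z ^ 2)"
    "cnj (w $ 3) = w $ 3 - 2 * (z^2 * cnj z - z * cnj z ^ 2)"
    "cnj (w $ 4) = w $ 4 - 2 * \<i> * (z^3 * cnj z + z * cnj z ^ 3)"
    "cnj (w $ 5) = w $ 5 - 2 * (z^3 * cnj z - z * cnj z ^ 3)"
    "cnj (w $ 6) = w $ 6 - 2 * \<i> * (z^2 * cnj z ^ 2)"
    "cnj (w $ 7) = w $ 7 - 2 * \<i> * (z^3 * cnj z ^ 2 + z^2 * cnj z ^ 3)"
    "cnj (w $ 8) = w $ 8 - 2 * (z^3 * cnj z ^ 2 - z^2 * cnj z ^ 3)"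
    unfolding w by (simp_all add: P_def p_defs vector_8 algebra_simps)
  have "tangency z ?Z ?W"
    unfolding tangency_def forall_8
    by (intro conjI; simp add: aut_field_def vector_8 wl Pz_def Ps_def p_defs algebra_simps power2_eq_square power3_eq_cube)
  with tangent_space_M2_iff[of z w ?Z ?W] assms show ?thesis by (simp add: p)
qed

lemma aut_field_inf_CR: "inf_CR_automorphism M2 (aut_field cs a b c d)"
  unfolding inf_CR_automorphism_def
  using aut_field_holomorphic aut_field_tangent by (intro exI[of _ UNIV]) auto

lemma inf_CR_imp_aut_field:
  assumes "inf_CR_automorphism M2 V"
  shows "\<exists>cs a b c d. germ V = germ (aut_field cs a b c d)"
proof -
  obtain \<delta> where \<delta>: "\<delta> > 0"
    "\<And>z w. norm z < \<delta> \<Longrightarrow> norm w < \<delta> \<Longrightarrow> complex_differentiable_at (\<lambda>q. fst (V q)) (z, w)"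
    "\<And>z w l. norm z < \<delta> \<Longrightarrow> norm w < \<delta> \<Longrightarrow> complex_differentiable_at (\<lambda>q. snd (V q) $ l) (z, w)"
    "\<And>z s w l. norm z < \<delta> \<Longrightarrow> norm s < \<delta> \<Longrightarrow> norm w < \<delta> \<Longrightarrow>
       snd (V (z, w)) $ l - bar (\<lambda>q. snd (V q) $ l) (s, w - (2 * \<i>) *s P z s) =
       2 * \<i> * (Pz z s $ l * fst (V (z, w)) + Ps z s $ l * bar (\<lambda>q. fst (V q)) (s, w - (2 * \<i>) *s P z s))"
    using complexified_tangency[OF assms] by blast
  interpret cr_field "\<lambda>q. fst (V q)" "\<lambda>l q. snd (V q) $ l" \<delta>
    by (rule cr_field.intro) (fact \<delta>)+
  obtain cs a b c d where V: "\<And>z w. norm z < \<delta> \<Longrightarrow> norm w < \<delta> \<Longrightarrow>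
      (fst (V (z, w)), \<chi> l. snd (V (z, w)) $ l) = aut_field cs a b c d (z, w)"
    using field_is_aut_field by blast
  have "V p = aut_field cs a b c d p" if "p \<in> ball 0 \<delta>" for p
  proof -
    have "norm (fst p) < \<delta>" "norm (snd p) < \<delta>"
      using that norm_fst_le[of "fst p" "snd p"] norm_snd_le[of "snd p" "fst p"] by auto
    from V[OF this] show ?thesis by simp
  qed
  moreover have "eventually (\<lambda>p::pt. p \<in> ball 0 \<delta>) (nhds 0)"
    using \<delta>(1) by (intro eventually_nhds_in_open) auto
  ultimately have "eventually (\<lambda>p. V p = aut_field cs a b c d p) (nhds 0)"
    by (auto elim: eventually_mono)
  then show ?thesis unfolding vf_germ.abs_eq_iff by blast
qed

lemma aut_CR_M2: "aut_CR M2 = {germ (aut_field cs a b c d) | cs a b c d. True}"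
  using aut_field_inf_CR inf_CR_imp_aut_field unfolding aut_CR_def by fast

section \<open>The Lie algebra in terms of its parameters\<close>

type_synonym aut_param = "(real ^ 8) \<times> real \<times> real \<times> real \<times> real"

definition aut_germ :: "aut_param \<Rightarrow> vf_germ" where
  "aut_germ = (\<lambda>(cs, a, b, c, d). germ (aut_field cs a b c d))"

lemma aut_CR_M2_range: "aut_CR M2 = range aut_germ"
  unfolding aut_CR_M2 aut_germ_def by (auto simp: image_def split_beta)

lemma linear_aut_germ: "linear aut_germ"
proof (rule linearI)
  fix q q' :: aut_param and r :: real
  show "aut_germ (q + q') = aut_germ q + aut_germ q'"
    by (cases q; cases q')
      (auto simp: aut_germ_def plus_vf_germ.abs_eq vec_eq_8 vector_8 aut_field_def fun_eq_iff algebra_simps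
        intro!: arg_cong[of _ _ germ])
  show "aut_germ (r *\<^sub>R q) = r *\<^sub>R aut_germ q"
    by (cases q)
      (auto simp: aut_germ_def scaleR_vf_germ.abs_eq vec_eq_8 vector_8 aut_field_def fun_eq_iff scaleR_conv_of_real[where 'a = complex] algebra_simps
        intro!: arg_cong[of _ _ germ])
qed

text \<open>The values of the field at the origin and at one other point of the \<open>z\<close>-axis determine all parameters.\<close>

lemma aut_germ_eq_0:
  assumes "aut_germ q = 0"
  shows "q = 0"
proof -
  obtain cs a b c d where q: "q = (cs, a, b, c, d)" by (cases q)
  have "eventually (\<lambda>p. aut_field cs a b c d p = 0) (nhds 0)"
    using assms by (simp add: q aut_germ_def zero_vf_germ_def vf_germ.abs_eq_iff)
  then obtain e where e: "e > 0" "\<And>p. dist p 0 < e \<Longrightarrow> aut_field cs a b c d p = 0"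
    unfolding eventually_nhds_metric by blast
  have 0: "aut_field cs a b c d (0, 0) = 0" using e by (simp add: zero_prod_def)
  have 1: "aut_field cs a b c d (of_real (e / 2), 0) = 0"
    using e(1) by (intro e(2)) (simp add: dist_prod_def norm_prod_def)
  have "complex_of_real c + \<i> * of_real d = 0" "cs = 0"
    using 0 by (simp_all add: aut_field_def zero_prod_def vec_eq_8 vector_8)
  then have cd: "c = 0" "d = 0" "cs = 0" by (simp_all add: complex_eq_iff)
  have "(complex_of_real a + \<i> * of_real b) * of_real (e / 2) = 0"
    using 1 cd by (simp add: aut_field_def zero_prod_def)
  then have "complex_of_real a + \<i> * of_real b = 0" using e(1) by simp
  then have "a = 0" "b = 0" by (simp_all add: complex_eq_iff)
  with cd show ?thesis by (simp add: q zero_prod_def)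
qed

lemma inj_aut_germ: "inj aut_germ"
  using linear_injective_0[OF linear_aut_germ] aut_germ_eq_0 by blast

definition aut_basis :: "nat \<Rightarrow> aut_param" where
  "aut_basis i = (if i = 9 then (0, 1, 0, 0, 0) else if i = 10 then (0, 0, 1, 0, 0)
    else if i = 11 then (0, 0, 0, 1, 0) else if i = 12 then (0, 0, 0, 0, 1)
    else (axis (of_nat i) 1, 0, 0, 0, 0))"

lemma X_eq: "X i = aut_germ (aut_basis i)"
proof -
  have "aut_field (axis l 1) 0 0 0 0 = (\<lambda>_. (0, axis l 1))" for l
    by (auto simp: fun_eq_iff aut_field_def vec_eq_8 vector_8 axis_def)
  moreover have "aut_field 0 1 0 0 0 = X9_field" "aut_field 0 0 1 0 0 = X10_field"
    "aut_field 0 0 0 1 0 = X11_field" "aut_field 0 0 0 0 1 = X12_field"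
    by (auto simp: fun_eq_iff aut_field_def X9_field_def X10_field_def X11_field_def X12_field_def vec_eq_8 vector_8)
  ultimately show ?thesis by (simp add: X_def aut_germ_def aut_basis_def)
qed

lemma aut_basis_expansion:
  "(cs, a, b, c, d) = cs $ 1 *\<^sub>R aut_basis 1 + cs $ 2 *\<^sub>R aut_basis 2 + cs $ 3 *\<^sub>R aut_basis 3
    + cs $ 4 *\<^sub>R aut_basis 4 + cs $ 5 *\<^sub>R aut_basis 5 + cs $ 6 *\<^sub>R aut_basis 6
    + cs $ 7 *\<^sub>R aut_basis 7 + cs $ 8 *\<^sub>R aut_basis 8
    + a *\<^sub>R aut_basis 9 + b *\<^sub>R aut_basis 10 + c *\<^sub>R aut_basis 11 + d *\<^sub>R aut_basis 12"
  by (simp add: aut_basis_def vec_eq_8 axis_def)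

lemma span_aut_basis: "span (aut_basis ` {1..12}) = UNIV"
proof -
  have "(cs, a, b, c, d) \<in> span (aut_basis ` {1..12})" for cs a b c d
    by (subst aut_basis_expansion) (intro span_add span_scale span_base imageI; simp)
  then show ?thesis by auto
qed

text \<open>Twelve vectors spanning a space of dimension twelve are distinct and independent.\<close>

lemma independent_aut_basis: "independent (aut_basis ` {1..12})" "inj_on aut_basis {1..12}"
proof -
  have dim: "dim (UNIV :: aut_param set) = 12" by simp
  have le: "card (aut_basis ` {1..12}) \<le> 12" using card_image_le[of "{1..12}" aut_basis] by simp
  show "independent (aut_basis ` {1..12})"
    by (rule card_le_dim_spanning[of _ UNIV]) (use span_aut_basis dim le in auto)
  have "dim (UNIV :: aut_param set) \<le> card (aut_basis ` {1..12})"
    by (rule span_card_ge_dim) (use span_aut_basis in auto)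
  then have "card (aut_basis ` {1..12}) = card {1..12::nat}" using dim le by simp
  then show "inj_on aut_basis {1..12}" by (intro eq_card_imp_inj_on) auto
qed

lemma X_basis:
  "span (X ` {1..12}) = aut_CR M2" "independent (X ` {1..12})" "inj_on X {1..12}" "dim (aut_CR M2) = 12"
proof -
  have X: "X = aut_germ \<circ> aut_basis" by (simp add: fun_eq_iff X_eq)
  have im: "X ` {1..12} = aut_germ ` aut_basis ` {1..12}" by (simp add: X image_comp)
  show sp: "span (X ` {1..12}) = aut_CR M2"
    unfolding im linear_span_image[OF linear_aut_germ] span_aut_basis aut_CR_M2_range ..
  show ind: "independent (X ` {1..12})"
    unfolding im by (rule linear_independent_injective_image[OF linear_aut_germ independent_aut_basis(1)])
      (use inj_aut_germ in \<open>auto intro: inj_on_subset\<close>)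
  show inj: "inj_on X {1..12}"
    unfolding X by (intro comp_inj_on independent_aut_basis(2)) (use inj_aut_germ in \<open>auto intro: inj_on_subset\<close>)
  have "dim (aut_CR M2) = card (X ` {1..12})"
    unfolding sp[symmetric] by (rule dim_span_eq_card_independent[OF ind])
  then show "dim (aut_CR M2) = 12" using card_image[OF inj] by simp
qed

text \<open>The parameters of the commutator: the first component consists of its \<open>W\<close>-coefficients at the origin,
  the last two are the real and imaginary part of its \<open>Z\<close>-coefficient there.\<close>

fun aut_bracket :: "aut_param \<Rightarrow> aut_param \<Rightarrow> aut_param" where
  "aut_bracket (cs, a, b, c, d) (cs', a', b', c', d') = (vector [
     2 * a' * cs $ 1 - 2 * a * cs' $ 1 + 4 * (c * d' - c' * d),
     4 * c' * cs $ 1 + 3 * a' * cs $ 2 - b' * cs $ 3 - (4 * c * cs' $ 1 + 3 * a * cs' $ 2 - b * cs' $ 3),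
     4 * d' * cs $ 1 + b' * cs $ 2 + 3 * a' * cs $ 3 - (4 * d * cs' $ 1 + b * cs' $ 2 + 3 * a * cs' $ 3),
     3 * c' * cs $ 2 - 3 * d' * cs $ 3 + 4 * a' * cs $ 4 - 2 * b' * cs $ 5
       - (3 * c * cs' $ 2 - 3 * d * cs' $ 3 + 4 * a * cs' $ 4 - 2 * b * cs' $ 5),
     3 * d' * cs $ 2 + 3 * c' * cs $ 3 + 2 * b' * cs $ 4 + 4 * a' * cs $ 5
       - (3 * d * cs' $ 2 + 3 * c * cs' $ 3 + 2 * b * cs' $ 4 + 4 * a * cs' $ 5),
     2 * c' * cs $ 2 + 2 * d' * cs $ 3 + 4 * a' * cs $ 6 - (2 * c * cs' $ 2 + 2 * d * cs' $ 3 + 4 * a * cs' $ 6),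
     2 * c' * cs $ 4 + 2 * d' * cs $ 5 + 6 * c' * cs $ 6 + 5 * a' * cs $ 7 - b' * cs $ 8
       - (2 * c * cs' $ 4 + 2 * d * cs' $ 5 + 6 * c * cs' $ 6 + 5 * a * cs' $ 7 - b * cs' $ 8),
     - 2 * d' * cs $ 4 + 2 * c' * cs $ 5 + 6 * d' * cs $ 6 + b' * cs $ 7 + 5 * a' * cs $ 8
       - (- 2 * d * cs' $ 4 + 2 * c * cs' $ 5 + 6 * d * cs' $ 6 + b * cs' $ 7 + 5 * a * cs' $ 8)],
     0, 0, a' * c - b' * d - a * c' + b * d', a' * d + b' * c - a * d' - b * c')"

lemma bracket_aut_germ: "bracket (aut_germ q) (aut_germ q') = aut_germ (aut_bracket q q')"
proof -
  obtain cs a b c d cs' a' b' c' d' where q: "q = (cs, a, b, c, d)" "q' = (cs', a', b', c', d')"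
    by (cases q; cases q')
  have fd: "frechet_derivative (aut_field cs a b c d) (at p) = aut_deriv a b c d (fst p)" for cs a b c d p
    by (rule frechet_derivative_at[OF aut_field_has_derivative, symmetric])
  have "aut_deriv a' b' c' d' z (aut_field cs a b c d (z, w)) - aut_deriv a b c d z (aut_field cs' a' b' c' d' (z, w))
      = (\<lambda>(cs, a, b, c, d). aut_field cs a b c d (z, w)) (aut_bracket (cs, a, b, c, d) (cs', a', b', c', d'))" for z w
    by (simp add: aut_field_def aut_deriv_def vec_eq_8 vector_8; (intro conjI)?;
      simp add: algebra_simps power2_eq_square power3_eq_cube)
  then show ?thesis
    by (simp add: q aut_germ_def bracket.abs_eq fd) (auto intro!: arg_cong[of _ _ germ])
qed

section \<open>The grading\<close>

text \<open>The parameter \<open>c\<^sub>l\<close> multiplies \<open>\<partial>\<^sub>w\<^sub>l\<close>, whose degree is minus the weight of \<open>w\<^sup>l\<close>.\<close>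

definition wdeg :: "int ^ 8" where
  "wdeg = vector [- 2, - 3, - 3, - 4, - 4, - 4, - 5, - 5]"

text \<open>The projection to the homogeneous component of degree \<open>k\<close>; the component itself is described as
  the set of its fixed vectors.\<close>

definition aut_comp :: "int \<Rightarrow> aut_param \<Rightarrow> aut_param" where
  "aut_comp k = (\<lambda>(cs, a, b, c, d). (\<chi> l. if k = wdeg $ l then cs $ l else 0,
     if k = 0 then a else 0, if k = 0 then b else 0, if k = - 1 then c else 0, if k = - 1 then d else 0))"

lemma linear_aut_comp: "linear (aut_comp k)"
  by (rule linearI) (auto simp: aut_comp_def vec_eq_iff split_beta)

lemma aut_comp_aut_comp: "aut_comp i (aut_comp j q) = (if i = j then aut_comp i q else 0)"
  by (auto simp: aut_comp_def vec_eq_iff split_beta zero_prod_def)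

lemma sum_aut_comp: "(\<Sum>i\<in>{- int 5..int 0}. aut_comp i q) = q"
proof -
  have "{- int 5..int 0} = {-5, -4, -3, -2, -1, 0}" by auto
  then show ?thesis
    by (cases q) (simp add: aut_comp_def vec_eq_8 wdeg_def vector_8)
qed

text \<open>Allows the bracket relations to be checked on parameters, for all degrees at once.\<close>

lemma grading_eq: "grading k = aut_germ ` {q. aut_comp k q = q}"
proof -
  have sub: "subspace {q. aut_comp k q = q}" for k
    using linear_aut_comp[of k] by (auto simp: subspace_def linear_0 linear_add linear_scale)
  have sp: "span (X ` S) = aut_germ ` {q. aut_comp k q = q}"
    if "\<And>i. i \<in> S \<Longrightarrow> aut_comp k (aut_basis i) = aut_basis i"
      "\<And>q. aut_comp k q = q \<Longrightarrow> q \<in> span (aut_basis ` S)" for S k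
  proof -
    have "X ` S = aut_germ ` aut_basis ` S" by (simp add: X_eq image_image)
    moreover have "span (aut_basis ` S) = {q. aut_comp k q = q}"
      using span_minimal[OF _ sub, of "aut_basis ` S" k] that by auto
    ultimately show ?thesis using linear_span_image[OF linear_aut_germ] by simp
  qed
  note simps = aut_comp_def aut_basis_def vec_eq_8 axis_def wdeg_def vector_8
  have 5: "span (X ` {7, 8}) = aut_germ ` {q. aut_comp (- 5) q = q}"
  proof (rule sp)
    fix q assume *: "aut_comp (- 5) q = q"
    obtain cs a b c d where q: "q = (cs, a, b, c, d)" by (cases q)
    have "q = cs $ 7 *\<^sub>R aut_basis 7 + cs $ 8 *\<^sub>R aut_basis 8"
      using * by (simp add: q simps)
    also have "\<dots> \<in> span (aut_basis ` {7, 8})" by (intro span_add span_scale span_base) auto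
    finally show "q \<in> span (aut_basis ` {7, 8})" .
  qed (auto simp: simps)
  have 4: "span (X ` {4, 5, 6}) = aut_germ ` {q. aut_comp (- 4) q = q}"
  proof (rule sp)
    fix q assume *: "aut_comp (- 4) q = q"
    obtain cs a b c d where q: "q = (cs, a, b, c, d)" by (cases q)
    have "q = cs $ 4 *\<^sub>R aut_basis 4 + cs $ 5 *\<^sub>R aut_basis 5 + cs $ 6 *\<^sub>R aut_basis 6"
      using * by (simp add: q simps)
    also have "\<dots> \<in> span (aut_basis ` {4, 5, 6})" by (intro span_add span_scale span_base) auto
    finally show "q \<in> span (aut_basis ` {4, 5, 6})" .
  qed (auto simp: simps)
  have 3: "span (X ` {2, 3}) = aut_germ ` {q. aut_comp (- 3) q = q}"
  proof (rule sp)
    fix q assume *: "aut_comp (- 3) q = q"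
    obtain cs a b c d where q: "q = (cs, a, b, c, d)" by (cases q)
    have "q = cs $ 2 *\<^sub>R aut_basis 2 + cs $ 3 *\<^sub>R aut_basis 3"
      using * by (simp add: q simps)
    also have "\<dots> \<in> span (aut_basis ` {2, 3})" by (intro span_add span_scale span_base) auto
    finally show "q \<in> span (aut_basis ` {2, 3})" .
  qed (auto simp: simps)
  have 2: "span (X ` {1}) = aut_germ ` {q. aut_comp (- 2) q = q}"
  proof (rule sp)
    fix q assume *: "aut_comp (- 2) q = q"
    obtain cs a b c d where q: "q = (cs, a, b, c, d)" by (cases q)
    have "q = cs $ 1 *\<^sub>R aut_basis 1"
      using * by (simp add: q simps)
    also have "\<dots> \<in> span (aut_basis ` {1})" by (intro span_add span_scale span_base) auto
    finally show "q \<in> span (aut_basis ` {1})" .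
  qed (auto simp: simps)
  have 1: "span (X ` {11, 12}) = aut_germ ` {q. aut_comp (- 1) q = q}"
  proof (rule sp)
    fix q assume *: "aut_comp (- 1) q = q"
    obtain cs a b c d where q: "q = (cs, a, b, c, d)" by (cases q)
    have "q = c *\<^sub>R aut_basis 11 + d *\<^sub>R aut_basis 12"
      using * by (simp add: q simps)
    also have "\<dots> \<in> span (aut_basis ` {11, 12})" by (intro span_add span_scale span_base) auto
    finally show "q \<in> span (aut_basis ` {11, 12})" .
  qed (auto simp: simps)
  have 0: "span (X ` {9, 10}) = aut_germ ` {q. aut_comp 0 q = q}"
  proof (rule sp)
    fix q assume *: "aut_comp 0 q = q"
    obtain cs a b c d where q: "q = (cs, a, b, c, d)" by (cases q)
    have "q = a *\<^sub>R aut_basis 9 + b *\<^sub>R aut_basis 10"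
      using * by (simp add: q simps)
    also have "\<dots> \<in> span (aut_basis ` {9, 10})" by (intro span_add span_scale span_base) auto
    finally show "q \<in> span (aut_basis ` {9, 10})" .
  qed (auto simp: simps)
  have other: "{0} = aut_germ ` {q. aut_comp k q = q}" if "k \<notin> {-5, -4, -3, -2, -1, 0}"
  proof -
    have "aut_comp k q = 0" for q
      using that by (cases q) (simp add: simps zero_prod_def)
    then have "{q. aut_comp k q = q} = {0}" by auto
    then show ?thesis using linear_0[OF linear_aut_germ] by simp
  qed
  show ?thesis
    using 0 1 2 3 4 5 other by (auto simp: grading_def)
qed

text \<open>Each monomial of \<open>aut_bracket\<close> is a product of a parameter of degree \<open>i\<close> and one of degree \<open>j\<close> and sits
  in a component of degree \<open>i + j\<close>.\<close>

lemma aut_comp_bracket: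
  assumes "aut_comp i q = q" "aut_comp j q' = q'"
  shows "aut_comp (i + j) (aut_bracket q q') = aut_bracket q q'"
proof -
  obtain cs a b c d cs' a' b' c' d' where q: "q = (cs, a, b, c, d)" "q' = (cs', a', b', c', d')"
    by (cases q; cases q')
  have if_zero: "(if Q then x else 0) = x \<Longrightarrow> \<not> Q \<longrightarrow> x = 0" for Q and x :: real
    by (cases Q) simp_all
  have vec: "(\<chi> l. if i = wdeg $ l then cs $ l else 0) = cs" "(\<chi> l. if j = wdeg $ l then cs' $ l else 0) = cs'"
    and abcd: "(if i = 0 then a else 0) = a" "(if i = 0 then b else 0) = b"
      "(if i = - 1 then c else 0) = c" "(if i = - 1 then d else 0) = d"
      "(if j = 0 then a' else 0) = a'" "(if j = 0 then b' else 0) = b'"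
      "(if j = - 1 then c' else 0) = c'" "(if j = - 1 then d' else 0) = d'"
    using assms unfolding q aut_comp_def case_prod_conv prod.inject by blast+
  have cs: "i \<noteq> wdeg $ l \<longrightarrow> cs $ l = 0" "j \<noteq> wdeg $ l \<longrightarrow> cs' $ l = 0" for l
    by (rule if_zero[OF arg_cong[OF vec(1), of "\<lambda>v. v $ l", unfolded vec_lambda_beta]],
        rule if_zero[OF arg_cong[OF vec(2), of "\<lambda>v. v $ l", unfolded vec_lambda_beta]])
  note z = abcd[THEN if_zero]
    cs[of 1, unfolded wdeg_def vector_8] cs[of 2, unfolded wdeg_def vector_8]
    cs[of 3, unfolded wdeg_def vector_8] cs[of 4, unfolded wdeg_def vector_8]
    cs[of 5, unfolded wdeg_def vector_8] cs[of 6, unfolded wdeg_def vector_8]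
    cs[of 7, unfolded wdeg_def vector_8] cs[of 8, unfolded wdeg_def vector_8]
  consider "i = 0" | "i = -1" | "i = -2" | "i = -3" | "i = -4" | "i = -5" | "i \<notin> {0,-1,-2,-3,-4,-5}" by auto
  then show ?thesis
    by cases (use z in \<open>auto simp: q aut_comp_def vec_eq_8 wdeg_def vector_8\<close>)
qed

lemma graded_aut_CR: "graded_lie_algebra (aut_CR M2) 5 0 grading" "lie_subalgebra (aut_CR M2)"
proof -
  have sub: "subspace (grading k)" for k
    unfolding grading_def by (auto simp: subspace_span subspace_single_0)
  show lie: "lie_subalgebra (aut_CR M2)"
    unfolding lie_subalgebra_def
  proof (intro conjI ballI)
    show "subspace (aut_CR M2)" using X_basis(1) subspace_span by metis
    show "bracket x y \<in> aut_CR M2" if "x \<in> aut_CR M2" "y \<in> aut_CR M2" for x y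
      using that unfolding aut_CR_M2_range by (auto simp: bracket_aut_germ)
  qed
  let ?I = "{- int 5..int 0}"
  have "is_direct_sum (aut_CR M2) ?I grading"
    unfolding is_direct_sum_def
  proof (intro conjI ballI allI impI)
    show "aut_CR M2 = {\<Sum>i\<in>?I. x i |x. \<forall>i\<in>?I. x i \<in> grading i}"
    proof (intro equalityI subsetI)
      fix v assume "v \<in> aut_CR M2"
      then obtain q where q: "v = aut_germ q" unfolding aut_CR_M2_range by auto
      have "v = (\<Sum>i\<in>?I. aut_germ (aut_comp i q))"
        unfolding q linear_sum[OF linear_aut_germ, symmetric] sum_aut_comp ..
      moreover have "aut_germ (aut_comp i q) \<in> grading i" for i
        unfolding grading_eq by (auto simp: aut_comp_aut_comp)
      ultimately show "v \<in> {\<Sum>i\<in>?I. x i |x. \<forall>i\<in>?I. x i \<in> grading i}" by blast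
    next
      fix v assume "v \<in> {\<Sum>i\<in>?I. x i |x. \<forall>i\<in>?I. x i \<in> grading i}"
      then obtain x where v: "v = (\<Sum>i\<in>?I. x i)" and x: "\<forall>i\<in>?I. x i \<in> grading i" by blast
      have "x i \<in> aut_CR M2" if "i \<in> ?I" for i
        using bspec[OF x that] unfolding grading_eq aut_CR_M2_range by auto
      then show "v \<in> aut_CR M2"
        using lie unfolding v lie_subalgebra_def by (intro subspace_sum) auto
    qed
  next
    fix x i assume x: "(\<forall>i\<in>?I. x i \<in> grading i) \<and> (\<Sum>i\<in>?I. x i) = 0" and i: "i \<in> ?I"
    have "\<forall>i\<in>?I. \<exists>q. x i = aut_germ q \<and> aut_comp i q = q"
      using x unfolding grading_eq by blast
    then obtain q where q: "\<And>i. i \<in> ?I \<Longrightarrow> x i = aut_germ (q i)" "\<And>i. i \<in> ?I \<Longrightarrow> aut_comp i (q i) = q i"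
      by metis
    have "aut_germ (\<Sum>j\<in>?I. q j) = 0"
      using x q(1) by (simp add: linear_sum[OF linear_aut_germ])
    then have "0 = aut_comp i (\<Sum>j\<in>?I. q j)"
      using aut_germ_eq_0 linear_0[OF linear_aut_comp] by metis
    also have "\<dots> = (\<Sum>j\<in>?I. aut_comp i (q j))"
      by (rule linear_sum[OF linear_aut_comp])
    also have "\<dots> = (\<Sum>j\<in>?I. if j = i then q i else 0)"
    proof (rule sum.cong[OF refl])
      fix j assume "j \<in> ?I"
      then show "aut_comp i (q j) = (if j = i then q i else 0)"
        using aut_comp_aut_comp[of i j "q j"] q(2) by auto
    qed
    also have "\<dots> = q i" using i by simp
    finally show "x i = 0" using q(1)[OF i] linear_0[OF linear_aut_germ] by simp
  qed (rule sub)
  moreover have "grading i = {0}" if "i \<notin> ?I" for i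
    using that by (auto simp: grading_def)
  moreover have "bracket x y \<in> grading (i + j)" if "x \<in> grading i" "y \<in> grading j" for i j x y
  proof -
    obtain q q' where "x = aut_germ q" "aut_comp i q = q" "y = aut_germ q'" "aut_comp j q' = q'"
      using \<open>x \<in> grading i\<close> \<open>y \<in> grading j\<close> unfolding grading_eq by blast
    then show ?thesis
      unfolding grading_eq by (simp only: bracket_aut_germ) (intro imageI CollectI aut_comp_bracket)
  qed
  ultimately show "graded_lie_algebra (aut_CR M2) 5 0 grading"
    unfolding graded_lie_algebra_def using lie by blast
qed

section \<open>The structure theorem\<close>

lemma scaleR_X: "r *\<^sub>R X i = aut_germ (r *\<^sub>R aut_basis i)"
  by (simp add: X_eq linear_scale[OF linear_aut_germ])

lemma aut_germ_arith:
  "aut_germ q + aut_germ q' = aut_germ (q + q')" "- aut_germ q = aut_germ (- q)" "0 = aut_germ 0"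
  by (simp_all add: linear_add[OF linear_aut_germ] linear_neg[OF linear_aut_germ] linear_0[OF linear_aut_germ])

lemma bracket_X: "bracket (X i) (X j) = aut_germ (aut_bracket (aut_basis i) (aut_basis j))"
  by (simp add: X_eq bracket_aut_germ)

theorem theorem5p2:
  shows "lie_subalgebra (aut_CR M2) \<and>
    dim (aut_CR M2) = 12 \<and>
    aut_CR M2 = {germ (aut_field cs a b c d) | cs a b c d. True} \<and>
    inj_on X {1..12} \<and>
    independent (X ` {1..12}) \<and>
    aut_CR M2 = span (X ` {1..12}) \<and>
    graded_lie_algebra (aut_CR M2) 5 0 grading \<and>
    (\<forall>i\<in>{1..8}. \<forall>j\<in>{1..8}. bracket (X i) (X j) = 0) \<and>
    bracket (X 1) (X 9) = 2 *\<^sub>R X 1 \<and> bracket (X 1) (X 10) = 0 \<and>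
       bracket (X 1) (X 11) = 4 *\<^sub>R X 2 \<and> bracket (X 1) (X 12) = 4 *\<^sub>R X 3 \<and>
    bracket (X 2) (X 9) = 3 *\<^sub>R X 2 \<and> bracket (X 2) (X 10) = X 3 \<and>
       bracket (X 2) (X 11) = 3 *\<^sub>R X 4 + 2 *\<^sub>R X 6 \<and> bracket (X 2) (X 12) = 3 *\<^sub>R X 5 \<and>
    bracket (X 3) (X 9) = 3 *\<^sub>R X 3 \<and> bracket (X 3) (X 10) = - X 2 \<and>
       bracket (X 3) (X 11) = 3 *\<^sub>R X 5 \<and> bracket (X 3) (X 12) = - (3 *\<^sub>R X 4) + 2 *\<^sub>R X 6 \<and>
    bracket (X 4) (X 9) = 4 *\<^sub>R X 4 \<and> bracket (X 4) (X 10) = 2 *\<^sub>R X 5 \<and>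
       bracket (X 4) (X 11) = 2 *\<^sub>R X 7 \<and> bracket (X 4) (X 12) = - (2 *\<^sub>R X 8) \<and>
    bracket (X 5) (X 9) = 4 *\<^sub>R X 5 \<and> bracket (X 5) (X 10) = - (2 *\<^sub>R X 4) \<and>
       bracket (X 5) (X 11) = 2 *\<^sub>R X 8 \<and> bracket (X 5) (X 12) = 2 *\<^sub>R X 7 \<and>
    bracket (X 6) (X 9) = 4 *\<^sub>R X 6 \<and> bracket (X 6) (X 10) = 0 \<and>
       bracket (X 6) (X 11) = 6 *\<^sub>R X 7 \<and> bracket (X 6) (X 12) = 6 *\<^sub>R X 8 \<and>
    bracket (X 7) (X 9) = 5 *\<^sub>R X 7 \<and> bracket (X 7) (X 10) = X 8 \<and>
       bracket (X 7) (X 11) = 0 \<and> bracket (X 7) (X 12) = 0 \<and>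
    bracket (X 8) (X 9) = 5 *\<^sub>R X 8 \<and> bracket (X 8) (X 10) = - X 7 \<and>
       bracket (X 8) (X 11) = 0 \<and> bracket (X 8) (X 12) = 0 \<and>
    bracket (X 9) (X 10) = 0 \<and> bracket (X 9) (X 11) = - X 11 \<and>
       bracket (X 9) (X 12) = - X 12 \<and>
    bracket (X 10) (X 11) = - X 12 \<and> bracket (X 10) (X 12) = X 11 \<and>
    bracket (X 11) (X 12) = 4 *\<^sub>R X 1"
proof (intro conjI)
  show "\<forall>i\<in>{1..8}. \<forall>j\<in>{1..8}. bracket (X i) (X j) = 0"
    by (auto simp: bracket_X aut_basis_def aut_germ_arith vec_eq_8 vector_8 zero_prod_def intro!: arg_cong[of _ _ aut_germ])
qed ((fact X_basis graded_aut_CR aut_CR_M2 X_basis(1)[symmetric])+,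
    unfold bracket_X scaleR_X, unfold X_eq aut_germ_arith,
    (rule arg_cong[of _ _ aut_germ], simp add: aut_basis_def vec_eq_8 vector_8 axis_def zero_prod_def)+)

end
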